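(* Let $k$ be a complete valuation field such that $|k|$ is dense in $\mathbb{R}_{\geq 0}$, and let $\kappa$ be either an infinite cardinal or the class $\mathrm{Ord}$, satisfying the non-measurability condition. If $k$ is not spherically complete, then the dual Banach $k$-vector space $\mathrm{C}_{\mathrm{bd}}(\mathbb{Q},k)^{\vee}$ does not belong to $\mathscr{R}$, the Reid class of Banach $k$-vector spaces with respect to $\kappa$.
   Context: A complete valuation field is a field $k$ with a complete non-Archimedean absolute value $|\cdot|\colon k\to\mathbb{R}_{\geq 0}$; $|k|$ denotes its image. $\mathrm{C}_{\mathrm{bd}}(\mathbb{Q},k)$ is the Banach $k$-vector space of bounded continuous functions $\mathbb{Q}\to k$ ($\mathbb{Q}$ with its usual topology) with the supremum norm. For a Banach $k$-vector space $V$, $V^{\vee}$ is the Banach $k$-vector space of bounded $k$-linear maps $V\to k$ with the operator norm. $\mathrm{Ban}(k)$ is the class of (non-Archimedean, i.e. ultrametric) Banach $k$-vector spaces; $\cong$ means isometric $k$-linear isomorphism. For a set $I$ and a family $\mathcal{W}\in\mathrm{Ban}(k)^I$, $\Pi_I\mathcal{W}$ is the bounded direct product: all $w=(w(i))_{i\in I}$ with $w(i)\in\mathcal{W}(i)$ and $\sup_{i\in I}\|w(i)\|<\infty$, with the supremum norm. $\Sigma_I\mathcal{W}$ is the completed direct sum: the closed subspace of those $w\in\Pi_I\mathcal{W}$ such that $\{i\in I:\|w(i)\|\geq\epsilon\}$ is finite for every $\epsilon>0$. $F_k$ is the class of Banach spaces isomorphic to $k^n$ with the maximum norm for some integer $n\geq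 0$. "$\#I<\kappa$" means the cardinality of the set $I$ belongs to $\kappa$ (no restriction if $\kappa=\mathrm{Ord}$). Reid hierarchy: by recursion on the ordinal $\alpha$, $\mathscr{R}_{<\alpha}=\bigcup_{\beta<\alpha}\mathscr{R}_{\beta}$; $\Pi_{\alpha}$ is $F_k$ together with all $V\in\mathrm{Ban}(k)$ such that $V\cong\Pi_I\mathcal{W}$ for some set $I$ with $\#I<\kappa$ and some $\mathcal{W}\in(\mathscr{R}_{<\alpha})^I$; $\Sigma_{\alpha}$ is $F_k$ together with all $V$ such that $V\cong\Sigma_I\mathcal{W}$ for some such $I$, $\mathcal{W}$; $\mathscr{R}_{\alpha}=\Pi_{\alpha}\cup\Sigma_{\alpha}$. Reid class is $\mathscr{R}=\bigcup_{\alpha\in\mathrm{Ord}}\mathscr{R}_{\alpha}$. A set $X$ is $\omega_1$-measurable if it is uncountable and admits a non-principal ultrafilter closed under countable intersections; $\kappa$ satisfies the non-measurability condition if no $\alpha\in\kappa$ is $\omega_1$-measurable. *)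

theory Defs
  imports "HOL-Analysis.Analysis" "HOL-Library.Function_Algebras"
begin

unbundle cardinal_syntax

section \<open>Valuation fields\<close>

abbreviation vdist :: "('k::field \<Rightarrow> real) \<Rightarrow> 'k \<Rightarrow> 'k \<Rightarrow> real" where
  "vdist abv \<equiv> \<lambda>x y. abv (x - y)"

definition complete_valuation_field :: "('k::field \<Rightarrow> real) \<Rightarrow> bool" where
  "complete_valuation_field abv \<longleftrightarrow>
     (\<forall>x. 0 \<le> abv x) \<and> (\<forall>x. abv x = 0 \<longleftrightarrow> x = 0) \<and>
     (\<forall>x y. abv (x * y) = abv x * abv y) \<and>
     (\<forall>x y. abv (x + y) \<le> max (abv x) (abv y)) \<and>
     Metric_space.mcomplete UNIV (vdist abv)"

definition spherically_complete :: "('k::field \<Rightarrow> real) \<Rightarrow> bool" where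
  "spherically_complete abv \<longleftrightarrow>
     (\<forall>(c :: nat \<Rightarrow> 'k) (r :: nat \<Rightarrow> real).
        (\<forall>n. 0 < r n) \<longrightarrow> decseq (\<lambda>n. Metric_space.mcball UNIV (vdist abv) (c n) (r n)) \<longrightarrow>
        (\<Inter>n. Metric_space.mcball UNIV (vdist abv) (c n) (r n)) \<noteq> {})"


section \<open>Ultrametric Banach spaces\<close>

text \<open>
  A normed space over the field \<open>'k\<close> is given by a subspace \<open>vcarrier\<close> of an ambient
  vector space, which is the abelian group \<open>'v\<close> with scalar multiplication \<open>vscale\<close>,
  and by a norm on that subspace. The values of \<open>vnorm\<close> outside \<open>vcarrier\<close> carry no meaning.
\<close>

record ('k, 'v) nspace =
  vscale :: "'k \<Rightarrow> 'v \<Rightarrow> 'v"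
  vcarrier :: "'v set"
  vnorm :: "'v \<Rightarrow> real"

definition banach_space :: "('k::field \<Rightarrow> real) \<Rightarrow> ('k, 'v::ab_group_add) nspace \<Rightarrow> bool" where
  "banach_space abv V \<longleftrightarrow>
     vector_space (vscale V) \<and> module.subspace (vscale V) (vcarrier V) \<and>
     (\<forall>x\<in>vcarrier V. 0 \<le> vnorm V x) \<and>
     (\<forall>x\<in>vcarrier V. vnorm V x = 0 \<longleftrightarrow> x = 0) \<and>
     (\<forall>c. \<forall>x\<in>vcarrier V. vnorm V (vscale V c x) = abv c * vnorm V x) \<and>
     (\<forall>x\<in>vcarrier V. \<forall>y\<in>vcarrier V. vnorm V (x + y) \<le> max (vnorm V x) (vnorm V y)) \<and>
     (\<forall>\<sigma> :: nat \<Rightarrow> 'v. range \<sigma> \<subseteq> vcarrier V \<longrightarrow>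
        (\<forall>e>0. \<exists>N. \<forall>m\<ge>N. \<forall>n\<ge>N. vnorm V (\<sigma> m - \<sigma> n) < e) \<longrightarrow>
        (\<exists>x\<in>vcarrier V. (\<lambda>n. vnorm V (\<sigma> n - x)) \<longlonglongrightarrow> 0))"

definition isometrically_isomorphic ::
  "('k::field, 'v::ab_group_add) nspace \<Rightarrow> ('k, 'w::ab_group_add) nspace \<Rightarrow> bool"
  (infix "\<cong>\<^sub>B" 50) where
  "V \<cong>\<^sub>B W \<longleftrightarrow> (\<exists>f. bij_betw f (vcarrier V) (vcarrier W) \<and>
     (\<forall>x\<in>vcarrier V. \<forall>y\<in>vcarrier V. f (x + y) = f x + f y) \<and>
     (\<forall>c. \<forall>x\<in>vcarrier V. f (vscale V c x) = vscale W c (f x)) \<and>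
     (\<forall>x\<in>vcarrier V. vnorm W (f x) = vnorm V x))"

text \<open>
  Below, the \<open>0\<close> inserted under \<open>Sup\<close> and \<open>Max\<close> matters only for an empty index set,
  where it gives the zero space its norm.
\<close>

text \<open>Families indexed by \<open>I\<close> are functions vanishing outside \<open>I\<close>.\<close>

definition bounded_product ::
  "'i set \<Rightarrow> ('i \<Rightarrow> ('k::field, 'u::ab_group_add) nspace) \<Rightarrow> ('k, 'i \<Rightarrow> 'u) nspace" where
  "bounded_product I W =
     \<lparr>vscale = (\<lambda>c w i. if i \<in> I then vscale (W i) c (w i) else 0),
      vcarrier = {w. (\<forall>i\<in>I. w i \<in> vcarrier (W i)) \<and> (\<forall>i. i \<notin> I \<longrightarrow> w i = 0) \<and>
                     bdd_above ((\<lambda>i. vnorm (W i) (w i)) ` I)},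
      vnorm = (\<lambda>w. Sup (insert 0 ((\<lambda>i. vnorm (W i) (w i)) ` I)))\<rparr>"

definition completed_sum ::
  "'i set \<Rightarrow> ('i \<Rightarrow> ('k::field, 'u::ab_group_add) nspace) \<Rightarrow> ('k, 'i \<Rightarrow> 'u) nspace" where
  "completed_sum I W = (bounded_product I W)
     \<lparr>vcarrier := {w \<in> vcarrier (bounded_product I W).
                    \<forall>\<epsilon>>0. finite {i\<in>I. \<epsilon> \<le> vnorm (W i) (w i)}}\<rparr>"

definition finite_power :: "('k::field \<Rightarrow> real) \<Rightarrow> nat \<Rightarrow> ('k, nat \<Rightarrow> 'k) nspace" where
  "finite_power abv n =
     \<lparr>vscale = (\<lambda>c x i. c * x i),
      vcarrier = {x. \<forall>i\<ge>n. x i = 0},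
      vnorm = (\<lambda>x. Max (insert 0 ((\<lambda>i. abv (x i)) ` {..<n})))\<rparr>"

definition Fk :: "('k::field \<Rightarrow> real) \<Rightarrow> ('k, 'v::ab_group_add) nspace set" where
  "Fk abv = {V. banach_space abv V \<and> (\<exists>n. V \<cong>\<^sub>B finite_power abv n)}"

text \<open>
  Functionals on \<open>V\<close> are functions vanishing outside \<open>vcarrier V\<close>. In the operator norm the
  vector \<open>0\<close> contributes the quotient \<open>0 / 0 = 0\<close>.
\<close>

definition dual_space ::
  "('k::field \<Rightarrow> real) \<Rightarrow> ('k, 'v::ab_group_add) nspace \<Rightarrow> ('k, 'v \<Rightarrow> 'k) nspace" where
  "dual_space abv V =
     \<lparr>vscale = (\<lambda>c \<phi> x. c * \<phi> x),
      vcarrier = {\<phi>. (\<forall>x\<in>vcarrier V. \<forall>y\<in>vcarrier V. \<phi> (x + y) = \<phi> x + \<phi> y) \<and>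
                     (\<forall>c. \<forall>x\<in>vcarrier V. \<phi> (vscale V c x) = c * \<phi> x) \<and>
                     (\<exists>C. \<forall>x\<in>vcarrier V. abv (\<phi> x) \<le> C * vnorm V x) \<and>
                     (\<forall>x. x \<notin> vcarrier V \<longrightarrow> \<phi> x = 0)},
      vnorm = (\<lambda>\<phi>. SUP x\<in>vcarrier V. abv (\<phi> x) / vnorm V x)\<rparr>"

text \<open>The type \<^typ>\<open>rat\<close> comes without a topology; it is given the one induced from the reals.\<close>

definition rat_topology :: "rat topology" where
  "rat_topology = pullback_topology UNIV (of_rat :: rat \<Rightarrow> real) euclidean"

definition Cbd_rat :: "('k::field \<Rightarrow> real) \<Rightarrow> ('k, rat \<Rightarrow> 'k) nspace" where
  "Cbd_rat abv =
     \<lparr>vscale = (\<lambda>c f q. c * f q),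
      vcarrier = {f. continuous_map rat_topology (Metric_space.mtopology UNIV (vdist abv)) f \<and>
                     bdd_above (range (\<lambda>q. abv (f q)))},
      vnorm = (\<lambda>f. SUP q. abv (f q))\<rparr>"


section \<open>Cardinal bounds and measurability\<close>

definition omega1_complete_ultrafilter :: "'a set \<Rightarrow> 'a set set \<Rightarrow> bool" where
  "omega1_complete_ultrafilter X U \<longleftrightarrow>
     U \<subseteq> Pow X \<and> X \<in> U \<and> {} \<notin> U \<and>
     (\<forall>A\<in>U. \<forall>B. A \<subseteq> B \<and> B \<subseteq> X \<longrightarrow> B \<in> U) \<and>
     (\<forall>A\<in>U. \<forall>B\<in>U. A \<inter> B \<in> U) \<and>
     (\<forall>A. A \<subseteq> X \<longrightarrow> A \<in> U \<or> X - A \<in> U) \<and>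
     (\<forall>A :: nat \<Rightarrow> 'a set. range A \<subseteq> U \<longrightarrow> (\<Inter>n. A n) \<in> U)"

definition omega1_measurable :: "'a set \<Rightarrow> bool" where
  "omega1_measurable X \<longleftrightarrow>
     uncountable X \<and> (\<exists>U. omega1_complete_ultrafilter X U \<and> (\<forall>x\<in>X. {x} \<notin> U))"

text \<open>The bound \<open>\<kappa>\<close>: a cardinal, in the form of a well-order, or the class of all ordinals.\<close>

datatype 'c card_bound = Cardinal "'c rel" | Ord

fun infinite_bound :: "'c card_bound \<Rightarrow> bool" where
  "infinite_bound (Cardinal r) \<longleftrightarrow> Card_order r \<and> infinite (Field r)"
| "infinite_bound Ord \<longleftrightarrow> True"

fun card_below :: "'i set \<Rightarrow> 'c card_bound \<Rightarrow> bool" where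
  "card_below I (Cardinal r) \<longleftrightarrow> |I| <o r"
| "card_below I Ord \<longleftrightarrow> True"

text \<open>
  The elements of a cardinal \<open>r\<close> are its proper initial segments. For \<^const>\<open>Ord\<close>, the sets
  concerned are those of the type \<open>'i\<close> from which the index sets of products and sums are
  taken; larger sets play no role for these.
\<close>

fun non_measurability :: "'i itself \<Rightarrow> 'c card_bound \<Rightarrow> bool" where
  "non_measurability _ (Cardinal r) \<longleftrightarrow> (\<forall>a\<in>Field r. \<not> omega1_measurable (underS r a))"
| "non_measurability _ Ord \<longleftrightarrow> (\<forall>X :: 'i set. \<not> omega1_measurable X)"


section \<open>The Reid hierarchy\<close>

text \<open>
  One step of the hierarchy: if \<open>X\<close> is the class of spaces of rank below \<open>\<alpha>\<close>, then
  \<^term>\<open>reid_Pi\<close>, \<^term>\<open>reid_Sigma\<close> and \<^term>\<open>reid_step\<close> give the classes called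
  \<open>\<Pi>\<^sub>\<alpha>\<close>, \<open>\<Sigma>\<^sub>\<alpha>\<close> and \<open>R\<^sub>\<alpha>\<close>.
  The members of the new class may have any ambient type \<open>'v\<close>.
\<close>

definition reid_Pi ::
  "('k::field \<Rightarrow> real) \<Rightarrow> 'c card_bound \<Rightarrow> 'i itself \<Rightarrow>
   ('k, 'u::ab_group_add) nspace set \<Rightarrow> ('k, 'v::ab_group_add) nspace set" where
  "reid_Pi abv \<kappa> _ X = Fk abv \<union>
     {V. banach_space abv V \<and>
         (\<exists>(I :: 'i set) W. card_below I \<kappa> \<and> (\<forall>i\<in>I. W i \<in> X) \<and> V \<cong>\<^sub>B bounded_product I W)}"

definition reid_Sigma ::
  "('k::field \<Rightarrow> real) \<Rightarrow> 'c card_bound \<Rightarrow> 'i itself \<Rightarrow>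
   ('k, 'u::ab_group_add) nspace set \<Rightarrow> ('k, 'v::ab_group_add) nspace set" where
  "reid_Sigma abv \<kappa> _ X = Fk abv \<union>
     {V. banach_space abv V \<and>
         (\<exists>(I :: 'i set) W. card_below I \<kappa> \<and> (\<forall>i\<in>I. W i \<in> X) \<and> V \<cong>\<^sub>B completed_sum I W)}"

definition reid_step ::
  "('k::field \<Rightarrow> real) \<Rightarrow> 'c card_bound \<Rightarrow> 'i itself \<Rightarrow>
   ('k, 'u::ab_group_add) nspace set \<Rightarrow> ('k, 'v::ab_group_add) nspace set" where
  "reid_step abv \<kappa> ti X = reid_Pi abv \<kappa> ti X \<union> reid_Sigma abv \<kappa> ti X"

text \<open>Ordinals are elements of a well-ordered type \<open>'o\<close>.\<close>

function reid_less ::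
  "('k::field \<Rightarrow> real) \<Rightarrow> 'c card_bound \<Rightarrow> 'i itself \<Rightarrow> 'o::wellorder \<Rightarrow>
   ('k, 'u::ab_group_add) nspace set" where
  "reid_less abv \<kappa> ti \<alpha> = (\<Union>\<beta>\<in>{..<\<alpha>}. reid_step abv \<kappa> ti (reid_less abv \<kappa> ti \<beta>))"
  by pat_completeness auto
termination
  by (relation "inv_image {(x, y). x < y} (\<lambda>(_, _, _, \<alpha>). \<alpha>)")
     (auto intro: Wellfounded.wellorder_class.wf)

declare reid_less.simps [simp del]

text \<open>
  HOL has no class of all sets, so the Reid class is taken relative to types: \<open>'i\<close> for index
  sets, \<open>'u\<close> for the spaces of lower rank and \<open>'o\<close> for ordinals. A space belongs to the Reid
  class of set theory iff it does so here for some choice of these types, since its membership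
  involves only a set of spaces, index sets and ordinals, and a set of vector spaces embeds
  in its direct sum.
\<close>

definition reid_class ::
  "('k::field \<Rightarrow> real) \<Rightarrow> 'c card_bound \<Rightarrow> 'i itself \<Rightarrow> 'u::ab_group_add itself \<Rightarrow>
   'o::wellorder itself \<Rightarrow> ('k, 'v::ab_group_add) nspace set" where
  "reid_class abv \<kappa> ti _ _ =
     (\<Union>\<alpha> :: 'o. reid_step abv \<kappa> ti (reid_less abv \<kappa> ti \<alpha> :: ('k, 'u) nspace set))"

end

theory Submission
  imports Defs
begin

text \<open>
  Let \<open>C\<close> be the space of bounded continuous functions on the rationals and \<open>D\<close> its dual. The
  rationals contain clopen copies of themselves that are locally finite, and others that tend to a
  point. Extension by zero from the copies and restriction to them show that \<open>D\<close> contains, as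
  retracts, both the completed direct sum and the bounded direct product of infinitely many copies
  of \<open>D\<close>. A space of the Reid class cannot absorb both operations: on a suitable copy of \<open>D\<close>, an
  operator through a sum or a product is, up to a small error, one through finitely many of the
  entries, which have lower rank.

  To make this an induction, call a space \<open>W\<close> thin if every operator on \<open>D\<close> that factors through
  \<open>W\<close> has arbitrarily small norm after compression to some copy of \<open>D\<close> inside \<open>D\<close>. The identity of
  \<open>D\<close> compresses to the identity, so \<open>D\<close> is not thin. But all spaces of the Reid class are: the
  base field is thin, and thinness passes to bounded products (\<open>thin_bounded_product\<close>) and to
  completed sums (\<open>thin_completed_sum\<close>). In both cases some compression makes the operator small on
  the families that vanish on a finite set of indices. For products this uses that \<open>D\<close> contains an
  infinite sum of copies, for sums that it contains an infinite product. The remaining entries are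
  finite in number and pass through spaces of lower rank.

  The smallness on tails is a gliding hump (\<open>gliding_hump\<close>): functionals \<open>\<phi> n\<close> on \<open>\<ell>\<^sup>\<infinity>\<close> that
  tend to zero pointwise do not stay away from zero on the diagonal of unit sequences. Here the
  hypotheses on the field enter. Since it is not spherically complete and its values are dense, the
  dual of \<open>\<ell>\<^sup>\<infinity>\<close> is \<open>c\<^sub>0\<close> (\<open>functional_expansion\<close>), because a functional that vanishes on
  \<open>c\<^sub>0\<close> would map a spherically complete quotient onto the field
  (\<open>functional_vanishing_on_finite_support\<close>). The hypothesis on \<open>\<kappa>\<close> extends this to products over
  large index sets: a functional on a bounded product is small off a finite set of indices
  (\<open>functional_small_off_finite\<close>), as otherwise it would give a countably complete non-principal
  ultrafilter.
\<close>

section \<open>Complete ultrametric fields\<close>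

locale valuation_field =
  fixes abv :: "'k::field \<Rightarrow> real"
  assumes cvf: "complete_valuation_field abv"
begin

lemma abv_nonneg [simp]: "0 \<le> abv x"
  and abv_zero_iff [simp]: "abv x = 0 \<longleftrightarrow> x = 0"
  and abv_mult: "abv (x * y) = abv x * abv y"
  and abv_add_le: "abv (x + y) \<le> max (abv x) (abv y)"
  and abv_complete: "Metric_space.mcomplete UNIV (vdist abv)"
  using cvf unfolding complete_valuation_field_def by auto

lemma abv_zero [simp]: "abv 0 = 0"
  by simp

lemma abv_one [simp]: "abv 1 = 1"
proof -
  have "abv 1 * abv 1 = abv 1" "abv 1 \<noteq> 0"
    using abv_mult[of 1 1] by auto
  then show ?thesis by simp
qed

lemma abv_minus [simp]: "abv (- x) = abv x"
proof -
  have "abv (-1) * abv (-1) = 1"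
    using abv_mult[of "-1" "-1"] by simp
  then have "abv (-1) = 1"
    using abv_nonneg[of "-1"] square_eq_1_iff[of "abv (-1)"] by linarith
  then show ?thesis
    using abv_mult[of "-1" x] by simp
qed

lemma abv_diff_le: "abv (x - y) \<le> max (abv x) (abv y)"
  using abv_add_le[of x "- y"] by simp

lemma abv_diff_commute: "abv (x - y) = abv (y - x)"
  using abv_minus[of "x - y"] by simp

lemma abv_triangle: "abv (x - z) \<le> max (abv (x - y)) (abv (y - z))"
  using abv_add_le[of "x - y" "y - z"] by simp

lemma abv_inverse: "abv (inverse x) = inverse (abv x)"
proof (cases "x = 0")
  case False
  then have "abv x * abv (inverse x) = 1"
    using abv_mult[of x "inverse x"] by simp
  then show ?thesis
    using False by (simp add: inverse_unique)
qed simp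

lemma abv_divide: "abv (x / y) = abv x / abv y"
  by (simp add: divide_inverse abv_mult abv_inverse)

lemma abv_sum_le:
  assumes "\<And>i. i \<in> A \<Longrightarrow> abv (f i) \<le> B" "0 \<le> B"
  shows "abv (sum f A) \<le> B"
  using assms
proof (induction A rule: infinite_finite_induct)
  case (insert x F)
  then show ?case using abv_add_le[of "f x" "sum f F"] by fastforce
qed auto

lemma Metric_space_abv: "Metric_space UNIV (vdist abv)"
proof
  fix x y z :: 'k
  show "abv (x - y) = abv (y - x)" by (rule abv_diff_commute)
  show "abv (x - z) \<le> abv (x - y) + abv (y - z)"
    using abv_triangle[of x z y] abv_nonneg[of "x - y"] abv_nonneg[of "y - z"] by linarith
qed auto

definition ksum :: "(nat \<Rightarrow> 'k) \<Rightarrow> 'k" where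
  "ksum t = (SOME s. (\<lambda>n. abv (s - sum t {..<n})) \<longlonglongrightarrow> 0)"

text \<open>In an ultrametric field a series converges as soon as its terms tend to zero, because
  \<open>|t m + \<dots> + t n|\<close> is at most the largest of the absolute values.\<close>

lemma ksum_tendsto:
  assumes "(\<lambda>n. abv (t n)) \<longlonglongrightarrow> 0"
  shows "(\<lambda>n. abv (ksum t - sum t {..<n})) \<longlonglongrightarrow> 0"
proof -
  interpret K: Metric_space UNIV "vdist abv" by (rule Metric_space_abv)
  have "K.MCauchy (\<lambda>n. sum t {..<n})"
    unfolding K.MCauchy_def
  proof (intro conjI allI impI)
    fix e :: real assume e: "0 < e"
    then obtain N where N: "\<And>n. n \<ge> N \<Longrightarrow> abv (t n) < e / 2"
      using LIMSEQ_D[OF assms, of "e/2"] by auto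
    have ordered: "abv (sum t {..<n} - sum t {..<m}) < e" if "N \<le> m" "m \<le> n" for m n
    proof -
      have "sum t {..<n} - sum t {..<m} = sum t {m..<n}"
        using that sum_diff_nat_ivl[of 0 m n t] by (simp add: lessThan_atLeast0)
      moreover have "abv (sum t {m..<n}) \<le> e / 2"
        using N that e by (intro abv_sum_le) (auto intro: less_imp_le)
      ultimately show ?thesis using e by simp
    qed
    show "\<exists>N. \<forall>n n'. N \<le> n \<longrightarrow> N \<le> n' \<longrightarrow> abv (sum t {..<n} - sum t {..<n'}) < e"
    proof (intro exI[of _ N] allI impI)
      fix n n' assume "N \<le> n" "N \<le> n'"
      then show "abv (sum t {..<n} - sum t {..<n'}) < e"
        using ordered abv_diff_commute by (metis nle_le)
    qed
  qed auto
  then obtain s where "limitin K.mtopology (\<lambda>n. sum t {..<n}) s sequentially"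
    using abv_complete unfolding K.mcomplete_def by blast
  then have "(\<lambda>n. abv (sum t {..<n} - s)) \<longlonglongrightarrow> 0"
    unfolding K.limitin_metric_dist_null by simp
  then have "(\<lambda>n. abv (s - sum t {..<n})) \<longlonglongrightarrow> 0"
    by (simp add: abv_diff_commute)
  then show ?thesis
    unfolding ksum_def by (rule someI)
qed

lemma limit_eqI:
  assumes "(\<lambda>n. abv (s - u n)) \<longlonglongrightarrow> 0" "(\<lambda>n. abv (s' - u n)) \<longlonglongrightarrow> 0"
  shows "s = s'"
proof (rule ccontr)
  assume "s \<noteq> s'"
  then have pos: "abv (s - s') > 0" using abv_nonneg[of "s - s'"] by (simp add: less_le)
  obtain N N' where "\<And>n. n \<ge> N \<Longrightarrow> abv (s - u n) < abv (s - s')"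
    "\<And>n. n \<ge> N' \<Longrightarrow> abv (s' - u n) < abv (s - s')"
    using LIMSEQ_D[OF assms(1) pos] LIMSEQ_D[OF assms(2) pos] by auto
  then have "abv (s - u (max N N')) < abv (s - s')" "abv (s' - u (max N N')) < abv (s - s')"
    by auto
  then show False
    using abv_triangle[of s s' "u (max N N')"] abv_diff_commute[of s'] by auto
qed

lemma ksum_eqI:
  assumes "(\<lambda>n. abv (t n)) \<longlonglongrightarrow> 0" "(\<lambda>n. abv (s - sum t {..<n})) \<longlonglongrightarrow> 0"
  shows "ksum t = s"
  using limit_eqI[OF ksum_tendsto[OF assms(1)] assms(2)] .

lemma tendsto_zero_bounded:
  fixes f g :: "nat \<Rightarrow> real"
  assumes "g \<longlonglongrightarrow> 0" "\<And>n. 0 \<le> f n" "\<And>n. f n \<le> g n"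
  shows "f \<longlonglongrightarrow> 0"
  using assms by (intro real_tendsto_sandwich[of "\<lambda>_. 0" f sequentially g]) auto

lemma null_add:
  assumes "(\<lambda>n. abv (t n)) \<longlonglongrightarrow> 0" "(\<lambda>n. abv (u n)) \<longlonglongrightarrow> 0"
  shows "(\<lambda>n. abv (t n + u n)) \<longlonglongrightarrow> 0"
proof (rule tendsto_zero_bounded)
  show "(\<lambda>n. max (abv (t n)) (abv (u n))) \<longlonglongrightarrow> 0"
    using tendsto_max[OF assms] by simp
qed (auto simp: abv_add_le)

lemma null_mult:
  assumes "(\<lambda>n. abv (t n)) \<longlonglongrightarrow> 0" "\<And>n. abv (c n) \<le> M"
  shows "(\<lambda>n. abv (c n * t n)) \<longlonglongrightarrow> 0"
proof (rule tendsto_zero_bounded)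
  show "(\<lambda>n. M * abv (t n)) \<longlonglongrightarrow> 0"
    using tendsto_mult[OF tendsto_const assms(1), of M] by simp
qed (auto simp: abv_mult intro: mult_right_mono assms)

lemma ksum_add:
  assumes "(\<lambda>n. abv (t n)) \<longlonglongrightarrow> 0" "(\<lambda>n. abv (u n)) \<longlonglongrightarrow> 0"
  shows "ksum (\<lambda>n. t n + u n) = ksum t + ksum u"
  using null_add[OF ksum_tendsto[OF assms(1)] ksum_tendsto[OF assms(2)]]
  by (intro ksum_eqI null_add assms) (simp add: sum.distrib algebra_simps)

lemma ksum_mult:
  assumes "(\<lambda>n. abv (t n)) \<longlonglongrightarrow> 0"
  shows "ksum (\<lambda>n. a * t n) = a * ksum t"
  using null_mult[OF ksum_tendsto[OF assms], of "\<lambda>_. a" "abv a"]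
  by (intro ksum_eqI null_mult[of t "\<lambda>_. a" "abv a"] assms)
     (simp_all add: sum_distrib_left right_diff_distrib)

lemma abv_limit_le:
  assumes "(\<lambda>n. abv (s - u n)) \<longlonglongrightarrow> 0" "\<And>n. abv (u n) \<le> B" "0 \<le> B"
  shows "abv s \<le> B"
proof (rule field_le_epsilon)
  fix e :: real assume "0 < e"
  then obtain n where "abv (s - u n) < e"
    using LIMSEQ_D[OF assms(1)] by auto
  then show "abv s \<le> B + e"
    using abv_add_le[of "s - u n" "u n"] assms(2)[of n] assms(3) \<open>0 < e\<close> by auto
qed

lemma abv_ksum_le:
  assumes "(\<lambda>n. abv (t n)) \<longlonglongrightarrow> 0" "\<And>n. abv (t n) \<le> B"
  shows "abv (ksum t) \<le> B"
proof -
  have B: "0 \<le> B" using assms(2)[of 0] abv_nonneg[of "t 0"] by linarith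
  show ?thesis
    by (rule abv_limit_le[OF ksum_tendsto[OF assms(1)] abv_sum_le B]) (use assms B in auto)
qed

lemma ksum_finite:
  assumes "\<And>n. N \<le> n \<Longrightarrow> t n = 0"
  shows "ksum t = sum t {..<N}"
proof (rule ksum_eqI)
  show "(\<lambda>n. abv (t n)) \<longlonglongrightarrow> 0"
    using assms by (intro tendsto_eventually eventually_sequentiallyI[of N]) auto
  have "sum t {..<N} - sum t {..<n} = 0" if "N \<le> n" for n
    using assms that sum.mono_neutral_right[of "{..<n}" "{..<N}" t] by auto
  then show "(\<lambda>n. abv (sum t {..<N} - sum t {..<n})) \<longlonglongrightarrow> 0"
    by (intro tendsto_eventually eventually_sequentiallyI[of N]) simp
qed

end

section \<open>Nested balls with empty intersection\<close>

locale spherically_incomplete_field = valuation_field abv for abv :: "'k::field \<Rightarrow> real" +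
  assumes dense: "{0..} \<subseteq> closure (range abv)"
    and not_spherically_complete: "\<not> spherically_complete abv"
begin

lemma abv_between:
  assumes "0 \<le> s" "s < t"
  obtains a where "s < abv a" "abv a < t"
proof -
  have "(s + t) / 2 \<in> closure (range abv)"
    using dense assms by auto
  moreover have "(t - s) / 2 > 0" using assms by simp
  ultimately obtain y where "y \<in> range abv" "dist y ((s + t) / 2) < (t - s) / 2"
    unfolding closure_approachable by blast
  moreover then have "s < y \<and> y < t"
    by (auto simp: dist_real_def abs_less_iff field_simps)
  ultimately show ?thesis using that by auto
qed

text \<open>Density of the value group makes the radius of a ball a function of the ball, so that the
  radii of nested balls decrease; if they became constant then so would the balls.\<close>

lemma nested_balls:
  obtains c :: "nat \<Rightarrow> 'k" and r :: "nat \<Rightarrow> real"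
  where "\<And>n. 0 < r n" "\<And>n. r (Suc n) < r n" "\<And>n. abv (c (Suc n) - c n) \<le> r n"
    "\<And>y. \<exists>n. r n < abv (y - c n)"
proof -
  interpret K: Metric_space UNIV "vdist abv" by (rule Metric_space_abv)
  obtain c r where r: "\<And>n. 0 < r n" and dec: "decseq (\<lambda>n. K.mcball (c n) (r n))"
    and emp: "(\<Inter>n. K.mcball (c n) (r n)) = {}"
    using not_spherically_complete unfolding spherically_complete_def by blast
  have nest: "abv (c m - y) \<le> r m" if "m \<le> n" "abv (c n - y) \<le> r n" for m n y
    using decseqD[OF dec that(1)] that(2) by (auto simp: subset_iff)
  have cc: "abv (c m - c n) \<le> r m" if "m \<le> n" for m n
    using nest[OF that, of "c n"] r[of n] by simp
  have r_dec: "r n \<le> r m" if "m \<le> n" for m n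
  proof (rule ccontr)
    assume "\<not> r n \<le> r m"
    then obtain t where t: "r m < abv t" "abv t < r n"
      using abv_between[of "r m" "r n"] r[of m] by auto
    have "abv (c m - (c n - t)) \<le> r m"
      using nest[OF that, of "c n - t"] t by simp
    then have "abv ((c m - (c n - t)) - (c m - c n)) \<le> r m"
      using abv_diff_le[of "c m - (c n - t)" "c m - c n"] cc[OF that] by linarith
    then show False using t by simp
  qed
  have drop: "\<exists>m>n. r m < r n" for n
  proof (rule ccontr)
    assume "\<not> (\<exists>m>n. r m < r n)"
    then have eq: "r m = r n" if "n \<le> m" for m
      using r_dec[OF that] that by (cases "m = n") (auto simp: not_less intro: antisym)
    have "abv (c m - c n) \<le> r m" for m
    proof (cases "m \<le> n")
      case False
      then have "abv (c n - c m) \<le> r m" using cc[of n m] eq[of m] by simp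
      then show ?thesis by (subst abv_diff_commute)
    qed (rule cc)
    then have "c n \<in> (\<Inter>n. K.mcball (c n) (r n))" by auto
    then show False using emp by blast
  qed
  define \<phi> where "\<phi> = rec_nat 0 (\<lambda>_ n. SOME m. n < m \<and> r m < r n)"
  have \<phi>: "\<phi> n < \<phi> (Suc n) \<and> r (\<phi> (Suc n)) < r (\<phi> n)" for n
    using someI_ex[of "\<lambda>m. \<phi> n < m \<and> r m < r (\<phi> n)"] drop[of "\<phi> n"] by (simp add: \<phi>_def)
  then have sub: "strict_mono \<phi>" by (simp add: strict_mono_Suc_iff)
  show ?thesis
  proof (rule that[of "\<lambda>n. r (\<phi> n)" "\<lambda>n. c (\<phi> n)"])
    show "abv (c (\<phi> (Suc n)) - c (\<phi> n)) \<le> r (\<phi> n)" for n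
      using cc[of "\<phi> n" "\<phi> (Suc n)"] \<phi>[of n] by (simp add: abv_diff_commute)
    show "\<exists>n. r (\<phi> n) < abv (y - c (\<phi> n))" for y
    proof (rule ccontr)
      assume "\<nexists>n. r (\<phi> n) < abv (y - c (\<phi> n))"
      then have le: "abv (c (\<phi> n) - y) \<le> r (\<phi> n)" for n
        using abv_diff_commute[of y "c (\<phi> n)" for n] by (simp add: not_less)
      then have "abv (c n - y) \<le> r n" for n
        using nest[OF seq_suble[OF sub]] by blast
      then have "y \<in> (\<Inter>n. K.mcball (c n) (r n))" by auto
      then show False using emp by blast
    qed
  qed (use r \<phi> in auto)
qed

end

section \<open>Bounded linear maps\<close>

text \<open>The part of the axioms of an ultrametric Banach space that passes to the spaces of families
  and of functions below, on whose ambient types the scalar multiplication need not satisfy the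
  axioms of a vector space.\<close>

definition normed :: "('k::field \<Rightarrow> real) \<Rightarrow> ('k, 'v::ab_group_add) nspace \<Rightarrow> bool" where
  "normed abv V \<longleftrightarrow>
     0 \<in> vcarrier V \<and> (\<forall>x\<in>vcarrier V. \<forall>y\<in>vcarrier V. x + y \<in> vcarrier V) \<and>
     (\<forall>x\<in>vcarrier V. - x \<in> vcarrier V) \<and> (\<forall>c. \<forall>x\<in>vcarrier V. vscale V c x \<in> vcarrier V) \<and>
     vnorm V 0 = 0 \<and> (\<forall>x\<in>vcarrier V. 0 \<le> vnorm V x) \<and>
     (\<forall>x\<in>vcarrier V. vnorm V (- x) = vnorm V x) \<and>
     (\<forall>c. \<forall>x\<in>vcarrier V. vnorm V (vscale V c x) = abv c * vnorm V x) \<and>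
     (\<forall>x\<in>vcarrier V. \<forall>y\<in>vcarrier V. vnorm V (x + y) \<le> max (vnorm V x) (vnorm V y))"

lemma
  assumes "normed abv V"
  shows normed_zero_mem: "0 \<in> vcarrier V"
    and normed_add_mem: "x \<in> vcarrier V \<Longrightarrow> y \<in> vcarrier V \<Longrightarrow> x + y \<in> vcarrier V"
    and normed_minus_mem: "x \<in> vcarrier V \<Longrightarrow> - x \<in> vcarrier V"
    and normed_scale_mem: "x \<in> vcarrier V \<Longrightarrow> vscale V c x \<in> vcarrier V"
    and normed_zero: "vnorm V 0 = 0"
    and normed_nonneg: "x \<in> vcarrier V \<Longrightarrow> 0 \<le> vnorm V x"
    and normed_minus: "x \<in> vcarrier V \<Longrightarrow> vnorm V (- x) = vnorm V x"
    and normed_scale: "x \<in> vcarrier V \<Longrightarrow> vnorm V (vscale V c x) = abv c * vnorm V x"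
    and normed_add: "x \<in> vcarrier V \<Longrightarrow> y \<in> vcarrier V \<Longrightarrow>
           vnorm V (x + y) \<le> max (vnorm V x) (vnorm V y)"
  using assms unfolding normed_def by blast+

lemma normed_diff_mem:
  "normed abv V \<Longrightarrow> x \<in> vcarrier V \<Longrightarrow> y \<in> vcarrier V \<Longrightarrow> x - y \<in> vcarrier V"
  using normed_add_mem[of abv V x "- y"] normed_minus_mem[of abv V y] by simp

lemma normed_sum_mem:
  assumes "normed abv V" "\<And>i. i \<in> A \<Longrightarrow> x i \<in> vcarrier V"
  shows "sum x A \<in> vcarrier V"
  using assms(2)
  by (induction A rule: infinite_finite_induct)
     (auto intro: normed_zero_mem normed_add_mem assms(1))

lemma normed_sum_le:
  assumes "normed abv V" "\<And>i. i \<in> A \<Longrightarrow> x i \<in> vcarrier V"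
    and "\<And>i. i \<in> A \<Longrightarrow> vnorm V (x i) \<le> B" "0 \<le> B"
  shows "vnorm V (sum x A) \<le> B"
  using assms(2,3)
proof (induction A rule: infinite_finite_induct)
  case (insert i A)
  have "vnorm V (x i + sum x A) \<le> max (vnorm V (x i)) (vnorm V (sum x A))"
    using insert.prems by (intro normed_add[OF assms(1)] normed_sum_mem[OF assms(1)]) auto
  also have "\<dots> \<le> B"
    using insert.IH insert.prems by auto
  finally show ?case using insert.hyps by simp
qed (use assms(4) normed_zero[OF assms(1)] in auto)

definition bounded_map ::
  "('k::field, 'v::ab_group_add) nspace \<Rightarrow> ('k, 'w::ab_group_add) nspace \<Rightarrow> ('v \<Rightarrow> 'w) \<Rightarrow> bool" where
  "bounded_map V W f \<longleftrightarrow>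
     (\<forall>x\<in>vcarrier V. f x \<in> vcarrier W) \<and>
     (\<forall>x\<in>vcarrier V. \<forall>y\<in>vcarrier V. f (x + y) = f x + f y) \<and>
     (\<forall>c. \<forall>x\<in>vcarrier V. f (vscale V c x) = vscale W c (f x)) \<and>
     (\<exists>C. \<forall>x\<in>vcarrier V. vnorm W (f x) \<le> C * vnorm V x)"

lemma bounded_mapI:
  assumes "\<And>x. x \<in> vcarrier V \<Longrightarrow> f x \<in> vcarrier W"
    and "\<And>x y. x \<in> vcarrier V \<Longrightarrow> y \<in> vcarrier V \<Longrightarrow> f (x + y) = f x + f y"
    and "\<And>c x. x \<in> vcarrier V \<Longrightarrow> f (vscale V c x) = vscale W c (f x)"
    and "\<And>x. x \<in> vcarrier V \<Longrightarrow> vnorm W (f x) \<le> C * vnorm V x"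
  shows "bounded_map V W f"
  using assms unfolding bounded_map_def by blast

lemma
  assumes "bounded_map V W f"
  shows bounded_map_mem: "x \<in> vcarrier V \<Longrightarrow> f x \<in> vcarrier W"
    and bounded_map_add: "x \<in> vcarrier V \<Longrightarrow> y \<in> vcarrier V \<Longrightarrow> f (x + y) = f x + f y"
    and bounded_map_scale: "x \<in> vcarrier V \<Longrightarrow> f (vscale V c x) = vscale W c (f x)"
  using assms unfolding bounded_map_def by auto

lemma bounded_map_zero: "normed abv V \<Longrightarrow> bounded_map V W f \<Longrightarrow> f 0 = 0"
  using bounded_map_add[of V W f 0 0] normed_zero_mem[of abv V] by simp

lemma bounded_map_minus:
  "normed abv V \<Longrightarrow> bounded_map V W f \<Longrightarrow> x \<in> vcarrier V \<Longrightarrow> f (- x) = - f x"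
  using bounded_map_add[of V W f x "- x"] normed_minus_mem[of abv V x] bounded_map_zero[of abv V W f]
  by (simp add: minus_unique)

lemma bounded_map_diff:
  "normed abv V \<Longrightarrow> bounded_map V W f \<Longrightarrow> x \<in> vcarrier V \<Longrightarrow> y \<in> vcarrier V \<Longrightarrow> f (x - y) = f x - f y"
  using bounded_map_add[of V W f x "- y"] normed_minus_mem[of abv V y] bounded_map_minus[of abv V W f y]
  by simp

lemma bounded_map_sum:
  assumes "normed abv V" "bounded_map V W f" "\<And>i. i \<in> A \<Longrightarrow> x i \<in> vcarrier V"
  shows "f (sum x A) = (\<Sum>i\<in>A. f (x i))"
  using assms(3)
proof (induction A rule: infinite_finite_induct)
  case (insert i A)
  have "sum x A \<in> vcarrier V"
    using insert.prems by (intro normed_sum_mem[OF assms(1)]) auto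
  with insert show ?case
    using bounded_map_add[OF assms(2), of "x i" "sum x A"] by simp
qed (use bounded_map_zero[OF assms(1,2)] in auto)

lemma bounded_map_bound:
  assumes "normed abv V" "bounded_map V W f"
  obtains C where "0 < C" "\<And>x. x \<in> vcarrier V \<Longrightarrow> vnorm W (f x) \<le> C * vnorm V x"
proof -
  obtain C where C: "\<And>x. x \<in> vcarrier V \<Longrightarrow> vnorm W (f x) \<le> C * vnorm V x"
    using assms(2) unfolding bounded_map_def by blast
  show ?thesis
  proof (rule that[of "max C 1"])
    show "vnorm W (f x) \<le> max C 1 * vnorm V x" if x: "x \<in> vcarrier V" for x
      using C[OF x] normed_nonneg[OF assms(1) x] by (meson max.cobounded1 mult_right_mono order_trans)
  qed auto
qed

lemma bounded_map_comp:
  assumes "normed abv V" "normed abv W" "bounded_map U V f" "bounded_map V W g"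
  shows "bounded_map U W (\<lambda>x. g (f x))"
proof -
  obtain C where C: "0 < C" "\<And>x. x \<in> vcarrier V \<Longrightarrow> vnorm W (g x) \<le> C * vnorm V x"
    using bounded_map_bound[OF assms(1,4)] by blast
  obtain B where B: "\<And>x. x \<in> vcarrier U \<Longrightarrow> vnorm V (f x) \<le> B * vnorm U x"
    using assms(3) unfolding bounded_map_def by blast
  show ?thesis
  proof (rule bounded_mapI[where C = "C * B"])
    fix x assume x: "x \<in> vcarrier U"
    then have "vnorm W (g (f x)) \<le> C * vnorm V (f x)"
      by (intro C bounded_map_mem[OF assms(3)])
    also have "\<dots> \<le> C * (B * vnorm U x)"
      using C(1) B[OF x] by simp
    finally show "vnorm W (g (f x)) \<le> C * B * vnorm U x" by (simp add: mult.assoc)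
  qed (use assms(3,4) in \<open>auto simp: bounded_map_mem bounded_map_add bounded_map_scale\<close>)
qed

definition field_space :: "('k::field \<Rightarrow> real) \<Rightarrow> ('k, 'k) nspace" where
  "field_space abv = \<lparr>vscale = (*), vcarrier = UNIV, vnorm = abv\<rparr>"

lemma field_space_simps [simp]:
  "vscale (field_space abv) = (*)" "vcarrier (field_space abv) = UNIV"
  "vnorm (field_space abv) = abv"
  by (simp_all add: field_space_def)

abbreviation functional ::
  "('k::field \<Rightarrow> real) \<Rightarrow> ('k, 'v::ab_group_add) nspace \<Rightarrow> ('v \<Rightarrow> 'k) \<Rightarrow> bool" where
  "functional abv V \<equiv> bounded_map V (field_space abv)"

definition bounded_functions :: "('k::field \<Rightarrow> real) \<Rightarrow> ('k, 'x \<Rightarrow> 'k) nspace" where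
  "bounded_functions abv = \<lparr>vscale = (\<lambda>c x n. c * x n), vcarrier = {x. bdd_above (range (\<lambda>n. abv (x n)))},
     vnorm = (\<lambda>x. SUP n. abv (x n))\<rparr>"

abbreviation linf :: "('k::field \<Rightarrow> real) \<Rightarrow> ('k, nat \<Rightarrow> 'k) nspace" where
  "linf \<equiv> bounded_functions"

definition unit_seq :: "nat \<Rightarrow> nat \<Rightarrow> 'k::field" where
  "unit_seq n m = (if m = n then 1 else 0)"

lemma bounded_functions_scale [simp]: "vscale (bounded_functions abv) c x = (\<lambda>n. c * x n)"
  by (simp add: bounded_functions_def)

lemma bounded_functions_memI: "(\<And>n. abv (x n) \<le> M) \<Longrightarrow> x \<in> vcarrier (bounded_functions abv)"
  by (auto simp: bounded_functions_def bdd_above_def)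

lemma bounded_functions_coeff_le: "x \<in> vcarrier (bounded_functions abv) \<Longrightarrow> abv (x n) \<le> vnorm (bounded_functions abv) x"
  by (auto simp: bounded_functions_def intro: cSUP_upper)

lemma bounded_functions_norm_le: "(\<And>n. abv (x n) \<le> M) \<Longrightarrow> vnorm (bounded_functions abv) x \<le> M"
  by (auto simp: bounded_functions_def intro: cSUP_least)

lemma bounded_map_linfI:
  assumes "\<And>x n. x \<in> vcarrier V \<Longrightarrow> abv (f x n) \<le> C * vnorm V x"
    and "\<And>x y n. x \<in> vcarrier V \<Longrightarrow> y \<in> vcarrier V \<Longrightarrow> f (x + y) n = f x n + f y n"
    and "\<And>c x n. x \<in> vcarrier V \<Longrightarrow> f (vscale V c x) n = c * f x n"
  shows "bounded_map V (linf abv) f"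
proof (rule bounded_mapI[where C = C])
  show "f x \<in> vcarrier (linf abv)" if "x \<in> vcarrier V" for x
    by (rule bounded_functions_memI) (rule assms(1)[OF that])
  show "vnorm (linf abv) (f x) \<le> C * vnorm V x" if "x \<in> vcarrier V" for x
    by (rule bounded_functions_norm_le) (rule assms(1)[OF that])
qed (use assms(2,3) in auto)

context valuation_field
begin

lemma normed_field_space [simp]: "normed abv (field_space abv)"
  by (auto simp: normed_def abv_mult abv_add_le)

lemma normed_bounded_functions [simp]: "normed abv (bounded_functions abv :: (_, 'x \<Rightarrow> _) nspace)"
proof -
  let ?B = "bounded_functions abv :: ('k, 'x \<Rightarrow> 'k) nspace"
  have add: "abv (x n + y n) \<le> max (vnorm ?B x) (vnorm ?B y)"
    if "x \<in> vcarrier ?B" "y \<in> vcarrier ?B" for x y n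
    using abv_add_le[of "x n" "y n"] bounded_functions_coeff_le[OF that(1), of n] bounded_functions_coeff_le[OF that(2), of n]
    by linarith
  have scale_mem: "abv (c * x n) \<le> abv c * vnorm ?B x"
    if "x \<in> vcarrier ?B" for c x n
    using bounded_functions_coeff_le[OF that, of n] by (simp add: abv_mult mult_left_mono)
  have scale: "vnorm ?B (\<lambda>n. c * x n) = abv c * vnorm ?B x"
    if x: "x \<in> vcarrier ?B" for c x
  proof (rule antisym)
    show "vnorm ?B (\<lambda>n. c * x n) \<le> abv c * vnorm ?B x"
      by (rule bounded_functions_norm_le) (rule scale_mem[OF x])
    have cx: "(\<lambda>n. c * x n) \<in> vcarrier ?B"
      by (rule bounded_functions_memI) (rule scale_mem[OF x])
    show "abv c * vnorm ?B x \<le> vnorm ?B (\<lambda>n. c * x n)"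
    proof (cases "c = 0")
      case True
      then show ?thesis using bounded_functions_coeff_le[OF cx, of undefined] by simp
    next
      case False
      then have pos: "0 < abv c" using abv_nonneg[of c] by (simp add: less_le)
      have "abv (x n) \<le> vnorm ?B (\<lambda>n. c * x n) / abv c" for n
        using bounded_functions_coeff_le[OF cx, of n] pos by (simp add: abv_mult field_simps)
      then have "vnorm ?B x \<le> vnorm ?B (\<lambda>n. c * x n) / abv c"
        by (rule bounded_functions_norm_le)
      then show ?thesis
        using pos by (simp add: field_simps)
    qed
  qed
  have "0 \<le> vnorm ?B x" if "x \<in> vcarrier ?B" for x
    using bounded_functions_coeff_le[OF that, of undefined] abv_nonneg order_trans by blast
  moreover have "vnorm ?B 0 = 0"
    using bounded_functions_norm_le[of abv "0 :: 'x \<Rightarrow> 'k" 0] bounded_functions_coeff_le[of "0 :: 'x \<Rightarrow> 'k" abv undefined] bounded_functions_memI[of abv "0 :: 'x \<Rightarrow> 'k" 0] by simp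
  moreover have "- x \<in> vcarrier ?B \<and> vnorm ?B (- x) = vnorm ?B x"
    if "x \<in> vcarrier ?B" for x
    using that by (simp add: bounded_functions_def)
  ultimately show ?thesis
    unfolding normed_def
    using add scale_mem scale
    by (auto intro: bounded_functions_memI[of abv "0 :: 'x \<Rightarrow> 'k" 0])
       (auto intro!: bounded_functions_memI bounded_functions_norm_le simp: plus_fun_def)
qed

lemma unit_seq_mem [simp]: "unit_seq n \<in> vcarrier (linf abv)"
  by (rule bounded_functions_memI[of _ _ 1]) (auto simp: unit_seq_def)

lemma functional_diff:
  assumes "normed abv V" "functional abv V f" "functional abv V g"
  shows "functional abv V (\<lambda>x. f x - g x)"
proof -
  obtain C where C: "0 < C" "\<And>x. x \<in> vcarrier V \<Longrightarrow> abv (f x) \<le> C * vnorm V x"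
    using bounded_map_bound[OF assms(1,2)] by auto
  obtain B where B: "0 < B" "\<And>x. x \<in> vcarrier V \<Longrightarrow> abv (g x) \<le> B * vnorm V x"
    using bounded_map_bound[OF assms(1,3)] by auto
  show ?thesis
  proof (rule bounded_mapI[where C = "max C B"])
    fix x assume x: "x \<in> vcarrier V"
    have "C * vnorm V x \<le> max C B * vnorm V x" "B * vnorm V x \<le> max C B * vnorm V x"
      using normed_nonneg[OF assms(1) x] by (auto intro: mult_right_mono)
    then show "vnorm (field_space abv) (f x - g x) \<le> max C B * vnorm V x"
      using C(2)[OF x] B(2)[OF x] abv_diff_le[of "f x" "g x"] by simp
  qed (use assms in \<open>auto simp: bounded_map_add bounded_map_scale algebra_simps\<close>)
qed

section \<open>The dual of \<open>\<ell>\<^sup>\<infinity>\<close>\<close>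

lemma functional_finite_support:
  assumes "functional abv (linf abv) \<phi>" "\<And>n. N \<le> n \<Longrightarrow> x n = 0"
  shows "\<phi> x = (\<Sum>m<N. x m * \<phi> (unit_seq m))"
  using assms(2)
proof (induction N arbitrary: x)
  case 0
  then have "x = 0" by auto
  then have "\<phi> x = 0" using bounded_map_zero[OF normed_bounded_functions assms(1)] by simp
  then show ?case by simp
next
  case (Suc N)
  have mem: "x(N := 0) \<in> vcarrier (linf abv)"
  proof (rule bounded_functions_memI[of _ _ "Max (insert 0 ((\<lambda>i. abv (x i)) ` {..<N}))"])
    fix n show "abv ((x(N := 0)) n) \<le> Max (insert 0 ((\<lambda>i. abv (x i)) ` {..<N}))"
      using Suc.prems[of n] by (cases "n < N") (auto intro: Max_ge)
  qed
  have "x = x(N := 0) + vscale (linf abv) (x N) (unit_seq N)"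
    by (auto simp: unit_seq_def fun_eq_iff)
  moreover have "\<phi> (x(N := 0) + vscale (linf abv) (x N) (unit_seq N)) = \<phi> (x(N := 0)) + x N * \<phi> (unit_seq N)"
    using mem bounded_map_add[OF assms(1) mem normed_scale_mem[OF normed_bounded_functions unit_seq_mem]]
      bounded_map_scale[OF assms(1) unit_seq_mem] by simp
  moreover have "\<phi> (x(N := 0)) = (\<Sum>m<N. (x(N := 0)) m * \<phi> (unit_seq m))"
    by (rule Suc.IH) (use Suc.prems le_antisym not_less_eq_eq in fastforce)
  ultimately show ?case by simp
qed

end

context spherically_incomplete_field
begin

text \<open>Nested balls of the one-dimensional quotient of \<open>\<ell>\<^sup>\<infinity>\<close> by the kernel of \<open>\<phi>\<close> lift to nested
  balls of \<open>\<ell>\<^sup>\<infinity>\<close>, with centres \<open>X n\<close>. The diagonal sequence \<open>y i = X i i\<close> lies in all of them up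
  to finitely many coordinates, on which \<open>\<phi>\<close> does not depend. So \<open>\<phi> y\<close> is in all the given
  balls, and if these have no common point, then there is no such \<open>\<phi>\<close> but zero.\<close>

lemma functional_vanishing_on_finite_support:
  assumes \<phi>: "functional abv (linf abv) \<phi>"
    and fin: "\<And>x N. x \<in> vcarrier (linf abv) \<Longrightarrow> (\<And>n. N \<le> n \<Longrightarrow> x n = 0) \<Longrightarrow> \<phi> x = 0"
    and x: "x \<in> vcarrier (linf abv)"
  shows "\<phi> x = 0"
proof (rule ccontr)
  let ?L = "linf abv"
  assume "\<phi> x \<noteq> 0"
  \<comment> \<open>\<open>K\<close> is the operator norm. Vectors that almost attain it give preimages of scalars of almost
    the smallest possible norm; the loss is made up for by the strict decrease of the radii, which
    is why the centres are shifted by one index below.\<close>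
  define S where "S = {C. 0 \<le> C \<and> (\<forall>x\<in>vcarrier ?L. abv (\<phi> x) \<le> C * vnorm ?L x)}"
  define K where "K = Inf S"
  obtain C where "0 < C" "\<And>x. x \<in> vcarrier ?L \<Longrightarrow> abv (\<phi> x) \<le> C * vnorm ?L x"
    using bounded_map_bound[OF normed_bounded_functions \<phi>] by auto
  then have "C \<in> S" by (simp add: S_def)
  then have "S \<noteq> {}" by blast
  have K0: "0 \<le> K"
    unfolding K_def using \<open>S \<noteq> {}\<close> by (intro cInf_greatest) (auto simp: S_def)
  have K_bound: "abv (\<phi> x) \<le> K * vnorm ?L x" if x: "x \<in> vcarrier ?L" for x
  proof (cases "vnorm ?L x = 0")
    case True
    then show ?thesis using \<open>S \<noteq> {}\<close> x by (auto simp: S_def)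
  next
    case False
    then have pos: "0 < vnorm ?L x" using normed_nonneg[OF normed_bounded_functions x] by simp
    have "abv (\<phi> x) / vnorm ?L x \<le> K"
      unfolding K_def using \<open>S \<noteq> {}\<close> x pos by (intro cInf_greatest) (auto simp: S_def field_simps)
    then show ?thesis using pos by (simp add: field_simps)
  qed
  have K: "0 < K"
    using K0 K_bound[OF x] \<open>\<phi> x \<noteq> 0\<close> abv_nonneg[of "\<phi> x"] by (cases "K = 0") auto
  have lift: "\<exists>e\<in>vcarrier ?L. \<phi> e = d \<and> vnorm ?L e \<le> s / K" if "abv d < s" for d s
  proof -
    have s: "0 < s" using that abv_nonneg[of d] by linarith
    have "K * (abv d / s) < K * 1"
      using that s K by (intro mult_strict_left_mono) auto
    then have "K * (abv d / s) \<notin> S"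
      using cInf_lower[of "K * (abv d / s)" S] unfolding K_def[symmetric]
      by (auto simp: S_def bdd_below_def)
    then obtain u where u: "u \<in> vcarrier ?L" "K * (abv d / s) * vnorm ?L u < abv (\<phi> u)"
      using K s by (auto simp: S_def not_le)
    have "0 \<le> K * (abv d / s) * vnorm ?L u"
      using K s normed_nonneg[OF normed_bounded_functions u(1)] by simp
    then have pos: "0 < abv (\<phi> u)" using u(2) by linarith
    then have nz: "\<phi> u \<noteq> 0" by auto
    let ?e = "vscale ?L (d / \<phi> u) u"
    have "vnorm ?L ?e = abv d / abv (\<phi> u) * vnorm ?L u"
      using normed_scale[OF normed_bounded_functions u(1)] by (simp only: abv_divide)
    also have "\<dots> \<le> s / K"
      using u(2) pos K s by (simp add: field_simps)
    finally have "vnorm ?L ?e \<le> s / K" .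
    moreover have "\<phi> ?e = d"
      using bounded_map_scale[OF \<phi> u(1), of "d / \<phi> u"] nz by (simp del: bounded_functions_scale)
    ultimately show ?thesis
      using normed_scale_mem[OF normed_bounded_functions u(1)] by blast
  qed
  obtain c r where r: "\<And>n. 0 < r n" "\<And>n. r (Suc n) < r n" and c: "\<And>n. abv (c (Suc n) - c n) \<le> r n"
    and gap: "\<And>y. \<exists>n. r n < abv (y - c n)"
    using nested_balls by metis
  have r_mono: "r m \<le> r n" if "n \<le> m" for m n
    using decseqD[OF decseq_SucI[of r, OF less_imp_le[OF r(2)]] that] .
  have "\<exists>e. \<forall>n. e n \<in> vcarrier ?L \<and> \<phi> (e n) = c (Suc (Suc n)) - c (Suc n) \<and> vnorm ?L (e n) \<le> r n / K"
  proof (rule choice, rule allI)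
    fix n
    have "abv (c (Suc (Suc n)) - c (Suc n)) < r n"
      using c[of "Suc n"] r(2)[of n] by linarith
    from lift[OF this] show "\<exists>e. e \<in> vcarrier ?L \<and> \<phi> e = c (Suc (Suc n)) - c (Suc n) \<and> vnorm ?L e \<le> r n / K"
      by blast
  qed
  then obtain e where e: "\<And>n. e n \<in> vcarrier ?L" "\<And>n. \<phi> (e n) = c (Suc (Suc n)) - c (Suc n)"
    "\<And>n. vnorm ?L (e n) \<le> r n / K"
    by blast
  obtain x0 where x0: "x0 \<in> vcarrier ?L" "\<phi> x0 = c 1"
    using lift[of "c 1" "abv (c 1) + 1"] by auto
  define X where "X = rec_nat x0 (\<lambda>n x. x + e n)"
  have X_simps: "X 0 = x0" "X (Suc n) = X n + e n" for n by (simp_all add: X_def)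
  have X: "X n \<in> vcarrier ?L \<and> \<phi> (X n) = c (Suc n)" for n
  proof (induction n)
    case (Suc n)
    have "X n + e n \<in> vcarrier ?L" "\<phi> (X n + e n) = c (Suc (Suc n))"
      using bounded_map_add[OF \<phi>, of "X n" "e n"] normed_add_mem[OF normed_bounded_functions, of "X n" "e n"] e Suc
      by simp_all
    then show ?case by (simp only: X_simps)
  qed (simp add: X_simps x0)
  define y where "y i = X i i" for i
  have tail: "abv (X i j - X n j) \<le> r n / K" if "n \<le> i" for i j n
    using that
  proof (induction i rule: dec_induct)
    case (step m)
    have "abv (e m j) \<le> r m / K"
      using bounded_functions_coeff_le[OF e(1), of m j] e(3)[of m] by linarith
    also have "\<dots> \<le> r n / K"
      using r_mono[OF step.hyps(1)] K by (simp add: divide_right_mono)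
    finally show ?case
      using step.IH abv_add_le[of "X m j - X n j" "e m j"] by (simp add: X_simps algebra_simps)
  qed (use r(1)[of n] K in simp)
  have "abv (y i) \<le> max (r 0 / K) (vnorm ?L x0)" for i
    using abv_add_le[of "X i i - X 0 i" "X 0 i"] tail[of 0 i i] bounded_functions_coeff_le[OF x0(1), of i]
    by (simp add: y_def X_simps)
  then have y: "y \<in> vcarrier ?L" by (rule bounded_functions_memI)
  have "abv (\<phi> y - c (Suc n)) \<le> r n" for n
  proof -
    \<comment> \<open>The finite part \<open>z1\<close> may be large, but \<open>\<phi>\<close> vanishes there.\<close>
    define z where "z = y - X n"
    define z1 where "z1 i = (if i < n then z i else 0)" for i
    define z2 where "z2 i = (if i < n then 0 else z i)" for i
    have z: "z \<in> vcarrier ?L" "\<phi> z = \<phi> y - c (Suc n)"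
      using X[of n] y normed_diff_mem[OF normed_bounded_functions] bounded_map_diff[OF normed_bounded_functions \<phi>]
      by (auto simp: z_def)
    have "abv (z1 i) \<le> max 0 (vnorm ?L z)" for i
      using bounded_functions_coeff_le[OF z(1), of i] by (auto simp: z1_def)
    then have z1: "z1 \<in> vcarrier ?L" by (rule bounded_functions_memI)
    have z2_le: "abv (z2 i) \<le> r n / K" for i
      using tail[of n i i] r(1)[of n] K by (auto simp: z2_def z_def y_def)
    then have z2: "z2 \<in> vcarrier ?L" by (rule bounded_functions_memI)
    have "z = z1 + z2" by (auto simp: z1_def z2_def)
    moreover have "\<phi> z1 = 0" by (rule fin[OF z1, of n]) (simp add: z1_def)
    ultimately have "\<phi> z = \<phi> z2" using bounded_map_add[OF \<phi> z1 z2] by simp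
    moreover have "abv (\<phi> z2) \<le> K * (r n / K)"
      using K_bound[OF z2] bounded_functions_norm_le[of abv z2, OF z2_le] K by (meson mult_le_cancel_left_pos order_trans)
    ultimately show ?thesis using z(2) K by simp
  qed
  then have "abv (\<phi> y - c n) \<le> r n" for n
    using abv_triangle[of "\<phi> y" "c n" "c (Suc n)"] c[of n] by (meson max.bounded_iff order_trans)
  then show False using gap[of "\<phi> y"] by (meson not_le)
qed

text \<open>If \<open>|\<phi> (unit_seq n)| \<ge> \<epsilon>\<close> infinitely often, then after passing to a subsequence and
  rescaling, \<open>\<phi>\<close> takes the value 1 on all unit sequences. The difference of \<open>\<phi>\<close> and of its
  composition with the right shift then vanishes on sequences of finite support, hence everywhere;
  but on the constant sequence 1 it takes the value \<open>\<phi> (unit_seq 0)\<close>.\<close>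

lemma functional_unit_seq_tendsto:
  assumes \<phi>: "functional abv (linf abv) \<phi>"
  shows "(\<lambda>n. abv (\<phi> (unit_seq n))) \<longlonglongrightarrow> 0"
proof (rule ccontr)
  let ?L = "linf abv"
  assume "\<not> ?thesis"
  then obtain \<epsilon> where \<epsilon>: "0 < \<epsilon>" "\<And>N. \<exists>n\<ge>N. \<epsilon> \<le> abv (\<phi> (unit_seq n))"
    unfolding LIMSEQ_iff by (auto simp: not_less)
  define S where "S = {n. \<epsilon> \<le> abv (\<phi> (unit_seq n))}"
  define s where "s = enumerate S"
  have inf: "infinite S"
    using \<epsilon>(2) by (auto simp: S_def infinite_nat_iff_unbounded_le)
  have inj: "inj s"
    unfolding s_def by (rule strict_mono_imp_inj_on[OF strict_mono_enumerate[OF inf]])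
  have sS: "s n \<in> S" for n
    unfolding s_def by (rule enumerate_in_set[OF inf])
  \<comment> \<open>\<open>T\<close> spreads a sequence over the chosen indices, rescaled so that \<open>\<phi> \<circ> T\<close> is 1 on unit
    sequences; \<open>R\<close> is the right shift.\<close>
  define T where "T b m = (if m \<in> range s then b (inv s m) / \<phi> (unit_seq m) else 0)"
    for b :: "nat \<Rightarrow> 'k" and m
  have T_le: "abv (T b m) \<le> 1 / \<epsilon> * vnorm ?L b" if b: "b \<in> vcarrier ?L" for b m
  proof (cases "m \<in> range s")
    case True
    then have "\<epsilon> \<le> abv (\<phi> (unit_seq m))" using sS by (auto simp: S_def)
    then have "abv (b (inv s m)) / abv (\<phi> (unit_seq m)) \<le> vnorm ?L b / \<epsilon>"
      using bounded_functions_coeff_le[OF b, of "inv s m"] \<epsilon>(1) normed_nonneg[OF normed_bounded_functions b] by (intro frac_le) auto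
    then show ?thesis using True by (simp add: T_def abv_divide)
  next
    case False
    then show ?thesis
      using normed_nonneg[OF normed_bounded_functions b] \<epsilon>(1) by (simp add: T_def)
  qed
  have T: "bounded_map ?L ?L T"
    by (rule bounded_map_linfI[OF T_le]) (auto simp: T_def add_divide_distrib)
  define \<psi> where "\<psi> b = \<phi> (T b)" for b
  have \<psi>: "functional abv ?L \<psi>"
    unfolding \<psi>_def by (rule bounded_map_comp[OF normed_bounded_functions normed_field_space T \<phi>])
  have \<psi>_unit: "\<psi> (unit_seq n) = 1" for n
  proof -
    have nz: "\<phi> (unit_seq (s n)) \<noteq> 0" using sS[of n] \<epsilon>(1) by (auto simp: S_def)
    have "T (unit_seq n) = vscale ?L (1 / \<phi> (unit_seq (s n))) (unit_seq (s n))"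
      using inj by (auto simp: T_def unit_seq_def fun_eq_iff inv_f_f)
    then show ?thesis
      unfolding \<psi>_def using bounded_map_scale[OF \<phi> unit_seq_mem] nz by (simp del: bounded_functions_scale)
  qed
  define R where "R b = case_nat (0::'k) b" for b
  have R_le: "abv (R b m) \<le> 1 * vnorm ?L b" if b: "b \<in> vcarrier ?L" for b m
    using bounded_functions_coeff_le[OF b] normed_nonneg[OF normed_bounded_functions b] by (auto simp: R_def split: nat.split)
  have R: "bounded_map ?L ?L R"
    by (rule bounded_map_linfI[OF R_le]) (auto simp: R_def split: nat.split)
  define \<mu> where "\<mu> b = \<psi> b - \<psi> (R b)" for b
  have \<mu>: "functional abv ?L \<mu>"
    unfolding \<mu>_def
    by (rule functional_diff[OF normed_bounded_functions \<psi> bounded_map_comp[OF normed_bounded_functions normed_field_space R \<psi>]])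
  have "\<mu> b = 0" if "\<And>n. N \<le> n \<Longrightarrow> b n = 0" for b N
  proof -
    have "\<psi> b = (\<Sum>m<N. b m)"
      using functional_finite_support[OF \<psi>, of N b] that \<psi>_unit by simp
    moreover have "\<psi> (R b) = (\<Sum>m<Suc N. R b m)"
      using functional_finite_support[OF \<psi>, of "Suc N" "R b"] that \<psi>_unit
      by (auto simp: R_def split: nat.split)
    moreover have "(\<Sum>m<Suc N. R b m) = (\<Sum>m<N. b m)"
      by (subst sum.lessThan_Suc_shift) (simp add: R_def)
    ultimately show ?thesis by (simp add: \<mu>_def)
  qed
  moreover have one: "(\<lambda>_. 1) \<in> vcarrier ?L" by (rule bounded_functions_memI[of _ _ 1]) simp
  ultimately have "\<mu> (\<lambda>_. 1) = 0"
    using functional_vanishing_on_finite_support[OF \<mu>] by blast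
  moreover have "(\<lambda>_. 1) = R (\<lambda>_. 1) + unit_seq 0"
    by (auto simp: R_def unit_seq_def fun_eq_iff split: nat.split)
  then have "\<psi> (\<lambda>_. 1) = \<psi> (R (\<lambda>_. 1)) + \<psi> (unit_seq 0)"
    using bounded_map_add[OF \<psi> bounded_map_mem[OF R one] unit_seq_mem[of 0]] by simp
  ultimately show False using \<psi>_unit by (simp add: \<mu>_def)
qed

text \<open>The difference of the two sides vanishes on sequences of finite support. So the dual of
  \<open>\<ell>\<^sup>\<infinity>\<close> is \<open>c\<^sub>0\<close>.\<close>

lemma functional_expansion:
  assumes \<phi>: "functional abv (linf abv) \<phi>" and x: "x \<in> vcarrier (linf abv)"
  shows "\<phi> x = ksum (\<lambda>n. x n * \<phi> (unit_seq n))"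
proof -
  let ?L = "linf abv"
  define \<sigma> where "\<sigma> x = ksum (\<lambda>n. x n * \<phi> (unit_seq n))" for x
  have null: "(\<lambda>n. abv (x n * \<phi> (unit_seq n))) \<longlonglongrightarrow> 0" if "x \<in> vcarrier ?L" for x
    using null_mult[OF functional_unit_seq_tendsto[OF \<phi>] bounded_functions_coeff_le[OF that]] .
  obtain C where C: "0 < C" "\<And>x. x \<in> vcarrier ?L \<Longrightarrow> abv (\<phi> x) \<le> C * vnorm ?L x"
    using bounded_map_bound[OF normed_bounded_functions \<phi>] by auto
  have "functional abv ?L \<sigma>"
  proof (rule bounded_mapI[where C = C])
    fix x assume x: "x \<in> vcarrier ?L"
    have "abv (x n * \<phi> (unit_seq n)) \<le> C * vnorm ?L x" for n
    proof -
      have "vnorm ?L (unit_seq n) \<le> 1" by (rule bounded_functions_norm_le) (auto simp: unit_seq_def)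
      then have "abv (\<phi> (unit_seq n)) \<le> C"
        using C(2)[OF unit_seq_mem, of n] mult_left_mono[of "vnorm ?L (unit_seq n)" 1 C] C(1) by linarith
      then show ?thesis
        using bounded_functions_coeff_le[OF x, of n] normed_nonneg[OF normed_bounded_functions x]
        by (simp add: abv_mult mult.commute[of C] mult_mono)
    qed
    then show "vnorm (field_space abv) (\<sigma> x) \<le> C * vnorm ?L x"
      unfolding \<sigma>_def by (simp add: abv_ksum_le[OF null[OF x]])
  qed (use null in \<open>auto simp: \<sigma>_def algebra_simps ksum_add ksum_mult[symmetric]\<close>)
  from functional_diff[OF normed_bounded_functions \<phi> this]
  have "\<phi> x - \<sigma> x = 0"
  proof (rule functional_vanishing_on_finite_support[OF _ _ x])
    fix b :: "nat \<Rightarrow> 'k" and N assume "\<And>n. N \<le> n \<Longrightarrow> b n = 0"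
    then show "\<phi> b - \<sigma> b = 0"
      unfolding \<sigma>_def using functional_finite_support[OF \<phi>] by (subst ksum_finite[of N]) auto
  qed
  then show ?thesis by (simp add: \<sigma>_def)
qed

lemma functional_le_coeffs:
  assumes \<phi>: "functional abv (linf abv) \<phi>" and x: "x \<in> vcarrier (linf abv)"
    and le: "\<And>n. abv (x n * \<phi> (unit_seq n)) \<le> B"
  shows "abv (\<phi> x) \<le> B"
  unfolding functional_expansion[OF \<phi> x]
  by (rule abv_ksum_le[OF null_mult[OF functional_unit_seq_tendsto[OF \<phi>] bounded_functions_coeff_le[OF x]] le])

text \<open>A gliding hump. Along a sparse enough subsequence the values \<open>\<phi> n (unit_seq m)\<close> with
  \<open>m \<noteq> n\<close> are at most \<open>\<epsilon> / 2\<close>: for \<open>m > n\<close> because \<open>\<phi> n\<close> is in \<open>c\<^sub>0\<close>, for \<open>m < n\<close> by the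
  hypothesis at \<open>unit_seq m\<close>. The hypothesis at the indicator sequence of this subsequence bounds
  the diagonal values.\<close>

lemma gliding_hump:
  assumes \<phi>: "\<And>n. functional abv (linf abv) (\<phi> n)"
    and lim: "\<And>x. x \<in> vcarrier (linf abv) \<Longrightarrow> (\<lambda>n. abv (\<phi> n x)) \<longlonglongrightarrow> 0"
    and \<epsilon>: "0 < \<epsilon>"
  shows "\<exists>n. abv (\<phi> n (unit_seq n)) \<le> \<epsilon>"
proof (rule ccontr)
  let ?L = "linf abv"
  assume "\<not> ?thesis"
  then have big: "\<epsilon> < abv (\<phi> n (unit_seq n))" for n by (auto simp: not_le)
  have "\<exists>N. \<forall>m\<ge>N. abv (\<phi> n (unit_seq m)) \<le> \<epsilon> / 2 \<and> abv (\<phi> m (unit_seq n)) \<le> \<epsilon> / 2" for n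
  proof -
    obtain N N' where "\<And>m. m \<ge> N \<Longrightarrow> abv (\<phi> n (unit_seq m)) < \<epsilon> / 2"
      "\<And>m. m \<ge> N' \<Longrightarrow> abv (\<phi> m (unit_seq n)) < \<epsilon> / 2"
      using LIMSEQ_D[OF functional_unit_seq_tendsto[OF \<phi>], of "\<epsilon> / 2" n]
        LIMSEQ_D[OF lim[OF unit_seq_mem], of "\<epsilon> / 2" n] \<epsilon> by auto
    then show ?thesis by (intro exI[of _ "max N N'"]) (auto intro: less_imp_le)
  qed
  then obtain N where N: "\<And>n m. N n \<le> m \<Longrightarrow>
      abv (\<phi> n (unit_seq m)) \<le> \<epsilon> / 2 \<and> abv (\<phi> m (unit_seq n)) \<le> \<epsilon> / 2"
    by metis
  define s where "s = rec_nat 0 (\<lambda>_ n. Suc n + (\<Sum>i\<le>n. N i))"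
  have s_Suc: "s (Suc k) = Suc (s k) + (\<Sum>i\<le>s k. N i)" for k by (simp add: s_def)
  then have mono: "strict_mono s" by (simp add: strict_mono_Suc_iff)
  have sparse: "N (s i) \<le> s k" if "i < k" for i k
  proof -
    from \<open>i < k\<close> obtain j where "k = Suc j" by (cases k) auto
    with \<open>i < k\<close> have j: "k = Suc j" "i \<le> j" by auto
    then have "N (s i) \<le> (\<Sum>i\<le>s j. N i)"
      using strict_mono_less_eq[OF mono] by (intro member_le_sum) auto
    then show ?thesis using s_Suc[of j] j by simp
  qed
  have small: "abv (\<phi> (s k) (unit_seq (s i))) \<le> \<epsilon> / 2" if "i \<noteq> k" for i k
    using that sparse[of i k] sparse[of k i] N by (cases i k rule: linorder_cases) auto
  define x where "x m = (if m \<in> range s then 1 else 0 :: 'k)" for m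
  have x: "x \<in> vcarrier ?L" by (rule bounded_functions_memI[of _ _ 1]) (auto simp: x_def)
  have "\<epsilon> < abv (\<phi> (s k) x)" for k
  proof -
    define y where "y = x - unit_seq (s k)"
    have y: "y \<in> vcarrier ?L" unfolding y_def by (intro normed_diff_mem[OF normed_bounded_functions] x unit_seq_mem)
    have "abv (y m * \<phi> (s k) (unit_seq m)) \<le> \<epsilon> / 2" for m
    proof (cases "m \<in> range s \<and> m \<noteq> s k")
      case True
      then obtain i where "m = s i" "i \<noteq> k" by auto
      then show ?thesis using small[of i k] True by (simp add: y_def x_def unit_seq_def)
    next
      case False
      then have "x m = unit_seq (s k) m" unfolding x_def unit_seq_def by (cases "m = s k") auto
      then have "y m = 0" by (simp add: y_def)
      then show ?thesis using \<epsilon> by simp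
    qed
    then have "abv (\<phi> (s k) y) \<le> \<epsilon> / 2" by (rule functional_le_coeffs[OF \<phi> y])
    moreover have "\<phi> (s k) (unit_seq (s k)) = \<phi> (s k) x - \<phi> (s k) y"
      using bounded_map_diff[OF normed_bounded_functions \<phi> x unit_seq_mem] by (simp add: y_def)
    ultimately show ?thesis
      using big[of "s k"] abv_diff_le[of "\<phi> (s k) x" "\<phi> (s k) y"] \<epsilon> by auto
  qed
  moreover obtain M where "\<And>n. n \<ge> M \<Longrightarrow> abv (\<phi> n x) < \<epsilon>"
    using LIMSEQ_D[OF lim[OF x] \<epsilon>] by auto
  ultimately show False
    using seq_suble[OF mono, of M] by (meson less_asym)
qed

end

section \<open>Products and sums\<close>

definition normed_space :: "('k::field \<Rightarrow> real) \<Rightarrow> ('k, 'v::ab_group_add) nspace \<Rightarrow> bool" where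
  "normed_space abv V \<longleftrightarrow> normed abv V \<and> vector_space (vscale V)"

lemma normed_space_normed: "normed_space abv V \<Longrightarrow> normed abv V"
  by (simp add: normed_space_def)

lemma
  assumes "normed_space abv V"
  shows normed_space_add_scale: "vscale V (c + d) x = vscale V c x + vscale V d x"
    and normed_space_scale_scale: "vscale V c (vscale V d x) = vscale V (c * d) x"
    and normed_space_scale_one: "vscale V 1 x = x"
    and normed_space_zero_scale: "vscale V 0 x = 0"
    and normed_space_scale_zero: "vscale V c 0 = 0"
proof -
  interpret vector_space "vscale V" using assms by (simp add: normed_space_def)
  show "vscale V (c + d) x = vscale V c x + vscale V d x"
    "vscale V c (vscale V d x) = vscale V (c * d) x"
    "vscale V 1 x = x" "vscale V 0 x = 0" "vscale V c 0 = 0"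
    by (simp_all add: scale_left_distrib)
qed

lemma (in valuation_field) banach_space_normed_space:
  assumes "banach_space abv V"
  shows "normed_space abv V"
proof -
  interpret vector_space "vscale V" using assms by (simp add: banach_space_def)
  have sub: "subspace (vcarrier V)" using assms by (simp add: banach_space_def)
  have "vnorm V (- x) = vnorm V x" if "x \<in> vcarrier V" for x
  proof -
    have "vnorm V (vscale V (- 1) x) = abv (- 1) * vnorm V x"
      using assms that by (simp only: banach_space_def)
    then show ?thesis by simp
  qed
  then show ?thesis
    using assms subspace_0[OF sub] subspace_add[OF sub] subspace_neg[OF sub] subspace_scale[OF sub]
    unfolding normed_space_def normed_def banach_space_def by auto
qed

lemma (in valuation_field) normed_space_field_space: "normed_space abv (field_space abv)"
  unfolding normed_space_def by (simp add: vector_space_def algebra_simps)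

lemma bounded_product_memI:
  assumes "\<And>i. i \<in> I \<Longrightarrow> w i \<in> vcarrier (W i)" "\<And>i. i \<notin> I \<Longrightarrow> w i = 0"
    and "\<And>i. i \<in> I \<Longrightarrow> vnorm (W i) (w i) \<le> B"
  shows "w \<in> vcarrier (bounded_product I W)"
  using assms by (auto simp: bounded_product_def bdd_above_def)

lemma bounded_product_coord_mem:
  "w \<in> vcarrier (bounded_product I W) \<Longrightarrow> i \<in> I \<Longrightarrow> w i \<in> vcarrier (W i)"
  "w \<in> vcarrier (bounded_product I W) \<Longrightarrow> i \<notin> I \<Longrightarrow> w i = 0"
  by (auto simp: bounded_product_def)

lemma bounded_product_scale:
  "vscale (bounded_product I W) c w i = (if i \<in> I then vscale (W i) c (w i) else 0)"
  by (simp add: bounded_product_def)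

lemma bounded_product_coord_le:
  "w \<in> vcarrier (bounded_product I W) \<Longrightarrow> i \<in> I \<Longrightarrow>
    vnorm (W i) (w i) \<le> vnorm (bounded_product I W) w"
  by (auto simp: bounded_product_def intro!: cSup_upper)

lemma bounded_product_norm_le:
  "(\<And>i. i \<in> I \<Longrightarrow> vnorm (W i) (w i) \<le> B) \<Longrightarrow> 0 \<le> B \<Longrightarrow> vnorm (bounded_product I W) w \<le> B"
  by (auto simp: bounded_product_def intro!: cSup_least)

lemma completed_sum_simps:
  "vscale (completed_sum I W) = vscale (bounded_product I W)"
  "vnorm (completed_sum I W) = vnorm (bounded_product I W)"
  "w \<in> vcarrier (completed_sum I W) \<longleftrightarrow> w \<in> vcarrier (bounded_product I W) \<and>
     (\<forall>\<epsilon>>0. finite {i\<in>I. \<epsilon> \<le> vnorm (W i) (w i)})"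
  by (simp_all add: completed_sum_def)

lemma (in valuation_field) normed_bounded_product:
  fixes W :: "'i \<Rightarrow> ('k, 'u::ab_group_add) nspace"
  assumes W: "\<And>i. i \<in> I \<Longrightarrow> normed abv (W i)"
  shows "normed abv (bounded_product I W)"
proof -
  let ?P = "bounded_product I W"
  note mem = bounded_product_coord_mem and le = bounded_product_coord_le
  have "(\<lambda>i. vnorm (W i) (x i)) ` I = (\<lambda>i. 0) ` I" if "x = 0" for x
    using normed_zero[OF W] that by (intro image_cong) auto
  then have zero: "vnorm ?P 0 = 0"
    by (cases "I = {}") (simp_all add: bounded_product_def image_constant_conv)
  have nonneg: "0 \<le> vnorm ?P w" if "w \<in> vcarrier ?P" for w
    using that by (auto simp: bounded_product_def intro!: cSup_upper)
  have zero_mem: "0 \<in> vcarrier ?P"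
    by (rule bounded_product_memI[where B = 0]) (auto simp: normed_zero[OF W] normed_zero_mem[OF W])
  have add: "vnorm (W i) (v i + w i) \<le> max (vnorm ?P v) (vnorm ?P w)"
    if "v \<in> vcarrier ?P" "w \<in> vcarrier ?P" "i \<in> I" for v w i
    using normed_add[OF W[OF that(3)] mem(1)[OF that(1,3)] mem(1)[OF that(2,3)]]
      le[OF that(1,3)] le[OF that(2,3)] by linarith
  have add_mem: "v + w \<in> vcarrier ?P" if "v \<in> vcarrier ?P" "w \<in> vcarrier ?P" for v w
    using that add[OF that]
    by (intro bounded_product_memI[where B = "max (vnorm ?P v) (vnorm ?P w)"])
       (auto intro: normed_add_mem[OF W] mem simp: mem(2))
  have add_le: "vnorm ?P (v + w) \<le> max (vnorm ?P v) (vnorm ?P w)"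
    if "v \<in> vcarrier ?P" "w \<in> vcarrier ?P" for v w
    using add[OF that] nonneg[OF that(1)] by (intro bounded_product_norm_le) auto
  have minus_coord: "vnorm (W i) (- w i) = vnorm (W i) (w i)" if "w \<in> vcarrier ?P" "i \<in> I" for w i
    using normed_minus[OF W[OF that(2)] mem(1)[OF that]] .
  have minus_mem: "- w \<in> vcarrier ?P" if "w \<in> vcarrier ?P" for w
    using that le[OF that]
    by (intro bounded_product_memI[where B = "vnorm ?P w"])
       (auto intro: normed_minus_mem[OF W] mem simp: minus_coord mem(2))
  have minus_le: "vnorm ?P (- w) \<le> vnorm ?P w" if "w \<in> vcarrier ?P" for w
    using that le[OF that] nonneg[OF that]
    by (intro bounded_product_norm_le) (auto simp: minus_coord)
  have minus: "vnorm ?P (- w) = vnorm ?P w" if "w \<in> vcarrier ?P" for w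
    using minus_le[OF that] minus_le[OF minus_mem[OF that]] by simp
  have scale: "vnorm (W i) (vscale (W i) c (w i)) = abv c * vnorm (W i) (w i)"
    if "w \<in> vcarrier ?P" "i \<in> I" for w c i
    using normed_scale[OF W[OF that(2)] mem(1)[OF that]] .
  have scale_mem: "vscale ?P c w \<in> vcarrier ?P" if "w \<in> vcarrier ?P" for w c
    using that le[OF that]
    by (intro bounded_product_memI[where B = "abv c * vnorm ?P w"])
       (auto simp: bounded_product_scale scale intro: normed_scale_mem[OF W] mem mult_left_mono)
  have scale_le: "vnorm ?P (vscale ?P c w) \<le> abv c * vnorm ?P w" if "w \<in> vcarrier ?P" for w c
    using that le[OF that] nonneg[OF that]
    by (intro bounded_product_norm_le) (auto simp: bounded_product_scale scale intro: mult_left_mono)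
  have scale_ge: "abv c * vnorm ?P w \<le> vnorm ?P (vscale ?P c w)" if w: "w \<in> vcarrier ?P" for w c
  proof (cases "c = 0")
    case False
    then have pos: "0 < abv c" using abv_nonneg[of c] by (simp add: less_le)
    have "vnorm (W i) (w i) \<le> vnorm ?P (vscale ?P c w) / abv c" if "i \<in> I" for i
      using le[OF scale_mem[OF w] that, of c] pos that
      by (simp add: bounded_product_scale scale[OF w] field_simps)
    then have "vnorm ?P w \<le> vnorm ?P (vscale ?P c w) / abv c"
      using nonneg[OF scale_mem[OF w]] pos by (intro bounded_product_norm_le) auto
    then show ?thesis using pos by (simp add: field_simps)
  qed (use nonneg[OF scale_mem[OF w]] in simp)
  show ?thesis
    unfolding normed_def
    by (intro conjI allI ballI)
       (simp_all add: zero zero_mem nonneg add_mem add_le minus_mem minus scale_mem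
          antisym[OF scale_le scale_ge])
qed

lemma (in valuation_field) normed_completed_sum:
  fixes W :: "'i \<Rightarrow> ('k, 'u::ab_group_add) nspace"
  assumes W: "\<And>i. i \<in> I \<Longrightarrow> normed abv (W i)"
  shows "normed abv (completed_sum I W)"
proof -
  let ?P = "bounded_product I W" and ?S = "completed_sum I W"
  have P: "normed abv ?P" by (rule normed_bounded_product[OF W])
  note mem = bounded_product_coord_mem(1)
  have "finite {i\<in>I. \<epsilon> \<le> vnorm (W i) 0}" if "0 < \<epsilon>" for \<epsilon>
  proof -
    have "{i\<in>I. \<epsilon> \<le> vnorm (W i) 0} = {}" using normed_zero[OF W] that by auto
    then show ?thesis by (metis finite.emptyI)
  qed
  then have zero_mem: "0 \<in> vcarrier ?S"
    using normed_zero_mem[OF P] by (simp add: completed_sum_simps)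
  have add_mem: "v + w \<in> vcarrier ?S" if "v \<in> vcarrier ?S" "w \<in> vcarrier ?S" for v w
  proof -
    have P_mem: "v \<in> vcarrier ?P" "w \<in> vcarrier ?P" using that by (simp_all add: completed_sum_simps)
    have "finite {i\<in>I. \<epsilon> \<le> vnorm (W i) ((v + w) i)}" if "0 < \<epsilon>" for \<epsilon>
    proof (rule finite_subset)
      show "{i\<in>I. \<epsilon> \<le> vnorm (W i) ((v + w) i)} \<subseteq>
          {i\<in>I. \<epsilon> \<le> vnorm (W i) (v i)} \<union> {i\<in>I. \<epsilon> \<le> vnorm (W i) (w i)}"
      proof (rule subsetI, rule ccontr)
        fix i assume i: "i \<in> {i\<in>I. \<epsilon> \<le> vnorm (W i) ((v + w) i)}"
          and "i \<notin> {i\<in>I. \<epsilon> \<le> vnorm (W i) (v i)} \<union> {i\<in>I. \<epsilon> \<le> vnorm (W i) (w i)}"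
        moreover have "vnorm (W i) (v i + w i) \<le> max (vnorm (W i) (v i)) (vnorm (W i) (w i))"
          using i normed_add[OF W mem[OF P_mem(1)] mem[OF P_mem(2)], of i] by simp
        ultimately show False by (auto simp: not_le max_def split: if_splits)
      qed
      show "finite ({i\<in>I. \<epsilon> \<le> vnorm (W i) (v i)} \<union> {i\<in>I. \<epsilon> \<le> vnorm (W i) (w i)})"
        using \<open>v \<in> vcarrier ?S\<close> \<open>w \<in> vcarrier ?S\<close> that by (simp add: completed_sum_simps)
    qed
    then show ?thesis
      using that normed_add_mem[OF P] by (simp add: completed_sum_simps)
  qed
  have minus_mem: "- w \<in> vcarrier ?S" if "w \<in> vcarrier ?S" for w
  proof -
    have "{i\<in>I. \<epsilon> \<le> vnorm (W i) ((- w) i)} = {i\<in>I. \<epsilon> \<le> vnorm (W i) (w i)}" for \<epsilon>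
      using that normed_minus[OF W mem[of w I W]] by (auto simp: completed_sum_simps)
    then show ?thesis using that normed_minus_mem[OF P] by (simp add: completed_sum_simps)
  qed
  have scale_mem: "vscale ?S c w \<in> vcarrier ?S" if "w \<in> vcarrier ?S" for w c
  proof -
    have w: "w \<in> vcarrier ?P" using that by (simp add: completed_sum_simps)
    have eq: "{i\<in>I. \<epsilon> \<le> vnorm (W i) (vscale ?P c w i)} = {i\<in>I. \<epsilon> \<le> abv c * vnorm (W i) (w i)}" for \<epsilon>
      using normed_scale[OF W mem[OF w]] by (simp add: bounded_product_scale cong: conj_cong)
    have "finite {i\<in>I. \<epsilon> \<le> abv c * vnorm (W i) (w i)}" if "0 < \<epsilon>" for \<epsilon>
    proof (cases "c = 0")
      case False
      then have "0 < abv c" using abv_nonneg[of c] by (simp add: less_le)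
      then have "{i\<in>I. \<epsilon> \<le> abv c * vnorm (W i) (w i)} = {i\<in>I. \<epsilon> / abv c \<le> vnorm (W i) (w i)}"
        by (auto simp: field_simps)
      then show ?thesis
        using \<open>w \<in> vcarrier ?S\<close> \<open>0 < \<epsilon>\<close> \<open>0 < abv c\<close> by (simp add: completed_sum_simps)
    qed (use that in auto)
    then show ?thesis using normed_scale_mem[OF P w] by (simp add: completed_sum_simps eq)
  qed
  have sub: "w \<in> vcarrier ?P" if "w \<in> vcarrier ?S" for w
    using that by (simp add: completed_sum_simps)
  note P' = P[unfolded normed_def, folded completed_sum_simps]
  show ?thesis
    unfolding normed_def using P' zero_mem add_mem minus_mem scale_mem sub by blast
qed

definition restr :: "'i set \<Rightarrow> ('i \<Rightarrow> 'u::zero) \<Rightarrow> 'i \<Rightarrow> 'u" where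
  "restr A w i = (if i \<in> A then w i else 0)"

definition single :: "'i \<Rightarrow> 'u::zero \<Rightarrow> 'i \<Rightarrow> 'u" where
  "single i u j = (if j = i then u else 0)"

text \<open>The common properties of \<open>\<Pi>\<close> and \<open>\<Sigma>\<close> on which the splitting of a family into finitely many
  entries and a tail rests.\<close>

definition family_space ::
  "('k::field \<Rightarrow> real) \<Rightarrow> 'i set \<Rightarrow> ('i \<Rightarrow> ('k, 'u::ab_group_add) nspace) \<Rightarrow>
    ('k, 'i \<Rightarrow> 'u) nspace \<Rightarrow> bool" where
  "family_space abv I W V \<longleftrightarrow>
     normed abv V \<and> (\<forall>i\<in>I. normed_space abv (W i)) \<and>
     vcarrier V \<subseteq> vcarrier (bounded_product I W) \<and>
     vscale V = vscale (bounded_product I W) \<and> vnorm V = vnorm (bounded_product I W) \<and>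
     (\<forall>A. \<forall>w\<in>vcarrier V. restr A w \<in> vcarrier V) \<and>
     (\<forall>i\<in>I. \<forall>u\<in>vcarrier (W i). single i u \<in> vcarrier V)"

lemma restr_coord_le:
  assumes "\<And>i. i \<in> I \<Longrightarrow> normed abv (W i)" "w \<in> vcarrier (bounded_product I W)" "i \<in> I"
  shows "vnorm (W i) (restr A w i) \<le> vnorm (W i) (w i)"
  using normed_zero[OF assms(1)[OF assms(3)]]
    normed_nonneg[OF assms(1)[OF assms(3)] bounded_product_coord_mem(1)[OF assms(2,3)]]
  by (simp add: restr_def)

lemma (in valuation_field) family_space_bounded_product:
  assumes W: "\<And>i. i \<in> I \<Longrightarrow> normed_space abv (W i)"
  shows "family_space abv I W (bounded_product I W)"
proof -
  have N: "normed abv (W i)" if "i \<in> I" for i using normed_space_normed[OF W[OF that]] .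
  have "restr A w \<in> vcarrier (bounded_product I W)" if w: "w \<in> vcarrier (bounded_product I W)" for A w
    using bounded_product_coord_mem[OF w] normed_zero_mem[OF N]
      order_trans[OF restr_coord_le[OF N w] bounded_product_coord_le[OF w]]
    by (intro bounded_product_memI[where B = "vnorm (bounded_product I W) w"]) (auto simp: restr_def)
  moreover have "single i u \<in> vcarrier (bounded_product I W)" if "i \<in> I" "u \<in> vcarrier (W i)" for i u
    using that normed_zero_mem[OF N] normed_zero[OF N] normed_nonneg[OF N]
    by (intro bounded_product_memI[where B = "vnorm (W i) u"]) (auto simp: single_def)
  ultimately show ?thesis
    unfolding family_space_def using W normed_bounded_product[OF N] by auto
qed

lemma (in valuation_field) family_space_completed_sum:
  assumes W: "\<And>i. i \<in> I \<Longrightarrow> normed_space abv (W i)"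
  shows "family_space abv I W (completed_sum I W)"
proof -
  note P = family_space_bounded_product[of I W, OF W]
  have N: "normed abv (W i)" if "i \<in> I" for i using normed_space_normed[OF W[OF that]] .
  have "restr A w \<in> vcarrier (completed_sum I W)" if w: "w \<in> vcarrier (completed_sum I W)" for A w
  proof -
    have w': "w \<in> vcarrier (bounded_product I W)" using w by (simp add: completed_sum_simps)
    have "finite {i\<in>I. \<epsilon> \<le> vnorm (W i) (restr A w i)}" if "0 < \<epsilon>" for \<epsilon>
    proof (rule finite_subset)
      show "{i\<in>I. \<epsilon> \<le> vnorm (W i) (restr A w i)} \<subseteq> {i\<in>I. \<epsilon> \<le> vnorm (W i) (w i)}"
        using restr_coord_le[of I abv W w _ A, OF _ w'] N by (smt (verit) Collect_mono_iff)
    qed (use w that in \<open>simp add: completed_sum_simps\<close>)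
    then show ?thesis using P w' by (simp add: completed_sum_simps family_space_def)
  qed
  moreover have "single i u \<in> vcarrier (completed_sum I W)" if "i \<in> I" "u \<in> vcarrier (W i)" for i u
  proof -
    have "finite {j\<in>I. \<epsilon> \<le> vnorm (W j) (single i u j)}" if "0 < \<epsilon>" for \<epsilon>
    proof (rule finite_subset)
      show "{j\<in>I. \<epsilon> \<le> vnorm (W j) (single i u j)} \<subseteq> {i}"
        using normed_zero[OF N] that by (auto simp: single_def split: if_splits)
    qed simp
    then show ?thesis using P that by (simp add: completed_sum_simps family_space_def)
  qed
  ultimately show ?thesis
    unfolding family_space_def
    using W normed_completed_sum[OF N] by (auto simp: completed_sum_simps)
qed

lemma bounded_map_coord:
  assumes "family_space abv I W V" "i \<in> I"
  shows "bounded_map V (W i) (\<lambda>w. w i)"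
  using assms unfolding family_space_def
  by (intro bounded_mapI[where C = 1])
     (auto intro: bounded_product_coord_mem bounded_product_coord_le simp: bounded_product_scale)

lemma bounded_map_single:
  assumes "family_space abv I W V" "i \<in> I"
  shows "bounded_map (W i) V (single i)"
proof -
  have W: "normed_space abv (W j)" if "j \<in> I" for j
    using assms that by (simp add: family_space_def)
  have "vnorm (W j) (single i u j) \<le> vnorm (W i) u" if "u \<in> vcarrier (W i)" "j \<in> I" for u j
    using that assms(2) normed_zero[OF normed_space_normed[OF W]] normed_nonneg[OF normed_space_normed[OF W]]
    by (auto simp: single_def)
  then show ?thesis
    using assms normed_nonneg[OF normed_space_normed[OF W]] unfolding family_space_def
    by (intro bounded_mapI[where C = 1])
       (auto intro: bounded_product_norm_le
         simp: single_def fun_eq_iff bounded_product_scale normed_space_scale_zero[OF W])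
qed

lemma restr_finite_eq_sum:
  assumes "finite F"
  shows "restr F w = (\<Sum>i\<in>F. single i (w i))"
  using assms
proof (induction F)
  case (insert i F)
  have "restr (insert i F) w = single i (w i) + restr F w"
    using insert.hyps by (auto simp: restr_def single_def)
  then show ?case using insert by simp
qed (auto simp: restr_def)

lemma restr_norm_le:
  assumes "family_space abv I W V" "w \<in> vcarrier V"
  shows "vnorm V (restr A w) \<le> vnorm V w"
proof -
  have W: "normed abv (W i)" if "i \<in> I" for i
    using assms(1) that by (simp add: family_space_def normed_space_def)
  have w: "w \<in> vcarrier (bounded_product I W)" and V: "vnorm V = vnorm (bounded_product I W)"
    using assms by (auto simp: family_space_def)
  have "0 \<le> vnorm V w" using assms normed_nonneg unfolding family_space_def by blast
  then show ?thesis
    using order_trans[OF restr_coord_le[OF W w] bounded_product_coord_le[OF w]]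
    unfolding V by (intro bounded_product_norm_le) auto
qed

text \<open>A bounded sequence of families with disjoint supports is the image of the unit sequences
  under an operator on \<open>\<ell>\<^sup>\<infinity>\<close>: the coefficient of each entry is chosen by the index \<open>\<nu> i\<close> of the
  family to whose support \<open>i\<close> belongs.\<close>

lemma (in valuation_field) glue_disjoint_families:
  fixes w :: "nat \<Rightarrow> 'i \<Rightarrow> 'u::ab_group_add"
  assumes W: "\<And>i. i \<in> I \<Longrightarrow> normed_space abv (W i)"
    and w: "\<And>n. w n \<in> vcarrier (bounded_product I W)"
    and le: "\<And>n. vnorm (bounded_product I W) (w n) \<le> M"
    and supp: "\<And>n i. w n i \<noteq> 0 \<Longrightarrow> \<nu> i = n"
  obtains T where "bounded_map (linf abv) (bounded_product I W) T" "\<And>n. T (unit_seq n) = w n"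
    "T (\<lambda>_. 1) = (\<lambda>i. w (\<nu> i) i)"
proof -
  let ?P = "bounded_product I W" and ?L = "linf abv"
  define T where "T c i = (if i \<in> I then vscale (W i) (c (\<nu> i)) (w (\<nu> i) i) else 0)" for c i
  have N: "normed abv (W i)" if "i \<in> I" for i using normed_space_normed[OF W[OF that]] .
  have T_mem: "T c i \<in> vcarrier (W i)" if "i \<in> I" for c i
    using that normed_scale_mem[OF N] bounded_product_coord_mem(1)[OF w] by (simp add: T_def)
  have T_le: "vnorm (W i) (T c i) \<le> M * vnorm ?L c" if "c \<in> vcarrier ?L" "i \<in> I" for c i
  proof -
    have "vnorm (W i) (T c i) = abv (c (\<nu> i)) * vnorm (W i) (w (\<nu> i) i)"
      using that normed_scale[OF N] bounded_product_coord_mem(1)[OF w] by (simp add: T_def)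
    also have "\<dots> \<le> vnorm ?L c * M"
      using that bounded_functions_coeff_le[OF that(1)] bounded_product_coord_le[OF w that(2), of "\<nu> i"] le[of "\<nu> i"]
        normed_nonneg[OF normed_bounded_functions that(1)] normed_nonneg[OF N[OF that(2)] bounded_product_coord_mem(1)[OF w that(2)]]
      by (intro mult_mono) auto
    finally show ?thesis by (simp add: mult.commute)
  qed
  have M: "0 \<le> M"
    using normed_nonneg[OF normed_bounded_product[OF N] w] le order_trans by blast
  have T: "bounded_map ?L ?P T"
  proof (rule bounded_mapI[where C = M])
    fix c assume c: "c \<in> vcarrier ?L"
    show "T c \<in> vcarrier ?P"
      by (rule bounded_product_memI[OF T_mem _ T_le[OF c]]) (auto simp: T_def)
    show "vnorm ?P (T c) \<le> M * vnorm ?L c"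
      using M normed_nonneg[OF normed_bounded_functions c] by (intro bounded_product_norm_le T_le[OF c]) auto
  next
    fix c d
    show "T (c + d) = T c + T d"
      using normed_space_add_scale[OF W] by (auto simp: T_def fun_eq_iff)
  next
    fix a c
    show "T (vscale ?L a c) = vscale ?P a (T c)"
      using normed_space_scale_scale[OF W] by (auto simp: T_def fun_eq_iff bounded_product_scale)
  qed
  have unit: "T (unit_seq n) = w n" for n
  proof
    fix i
    show "T (unit_seq n) i = w n i"
      using normed_space_scale_one[OF W] normed_space_zero_scale[OF W]
        bounded_product_coord_mem(2)[OF w] supp[of n i]
      by (auto simp: T_def unit_seq_def)
  qed
  have "T (\<lambda>_. 1) = (\<lambda>i. w (\<nu> i) i)"
    using normed_space_scale_one[OF W] bounded_product_coord_mem(2)[OF w]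
    by (auto simp: T_def fun_eq_iff)
  with T unit show ?thesis using that by blast
qed

section \<open>Index sets of non-measurable cardinality\<close>

text \<open>The sets that are not null form a countably complete ultrafilter on any of them that cannot
  be split in two of them. There are such atoms in every set that is not null, since splitting
  again and again gives infinitely many disjoint sets that are not null. By non-measurability each
  atom contains a point that is not null, and there are only finitely many such points.\<close>

lemma sigma_ideal_cofinite:
  fixes null :: "'i set \<Rightarrow> bool"
  assumes mono: "\<And>A B. A \<subseteq> B \<Longrightarrow> null B \<Longrightarrow> null A"
    and union: "\<And>A :: nat \<Rightarrow> 'i set. (\<And>n. null (A n)) \<Longrightarrow> null (\<Union>n. A n)"
    and ccc: "\<And>A :: nat \<Rightarrow> 'i set. disjoint_family A \<Longrightarrow> \<exists>n. null (A n)"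
    and nonmeasurable: "\<And>B. B \<subseteq> I \<Longrightarrow> \<not> omega1_measurable B"
  obtains F where "finite F" "F \<subseteq> I" "null (I - F)"
proof -
  have empty: "null {}" using ccc[of "\<lambda>_. {}"] by (simp add: disjoint_family_on_def)
  have null_Un: "null (A \<union> B)" if "null A" "null B" for A B
  proof -
    have "null (\<Union>n::nat. if n = 0 then A else B)" using that by (intro union) auto
    moreover have "A \<union> B \<subseteq> (\<Union>n::nat. if n = 0 then A else B)" by force
    ultimately show ?thesis using mono by blast
  qed
  have atom: "\<exists>B\<subseteq>A. \<not> null B \<and> (\<forall>C\<subseteq>B. null C \<or> null (B - C))" if A: "\<not> null A" for A
  proof (rule ccontr)
    assume "\<not> ?thesis"
    then have split: "\<exists>C\<subseteq>B. \<not> null C \<and> \<not> null (B - C)" if "B \<subseteq> A" "\<not> null B" for B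
      using that by blast
    obtain B where B: "\<And>n. B n \<subseteq> A \<and> \<not> null (B n)"
      "\<And>n. B (Suc n) \<subseteq> B n \<and> \<not> null (B n - B (Suc n))"
    proof (rule exE[OF dependent_nat_choice[of "\<lambda>_ B. B \<subseteq> A \<and> \<not> null B"
            "\<lambda>_ B C. C \<subseteq> B \<and> \<not> null (B - C)"]])
      show "\<exists>B. B \<subseteq> A \<and> \<not> null B" using A by blast
      show "\<exists>C. (C \<subseteq> A \<and> \<not> null C) \<and> C \<subseteq> B \<and> \<not> null (B - C)" if "B \<subseteq> A \<and> \<not> null B" for B and n :: nat
        using split[of B] that by blast
    qed blast
    have B_dec: "B n \<subseteq> B m" if "m \<le> n" for m n
      using decseqD[OF decseq_SucI[of B] that] B(2) by blast
    have "disjoint_family (\<lambda>n. B n - B (Suc n))"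
      unfolding disjoint_family_on_def
    proof (intro ballI impI)
      fix m n :: nat assume "m \<noteq> n"
      then show "(B m - B (Suc m)) \<inter> (B n - B (Suc n)) = {}"
        using B_dec[of "Suc m" n] B_dec[of "Suc n" m] by (cases m n rule: linorder_cases) auto
    qed
    then show False using ccc B(2) by blast
  qed
  have point: "\<exists>i\<in>A. \<not> null {i}" if A: "A \<subseteq> I" "\<not> null A" for A
  proof (rule ccontr)
    assume "\<not> ?thesis"
    then have points: "\<And>i. i \<in> A \<Longrightarrow> null {i}" by blast
    obtain B where B: "B \<subseteq> A" "\<not> null B" "\<And>C. C \<subseteq> B \<Longrightarrow> null C \<or> null (B - C)"
      using atom[OF A(2)] by blast
    show False
    proof (cases "countable B")
      case True
      have "B \<noteq> {}" using B(2) empty by auto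
      then have "null (\<Union>n. {from_nat_into B n})"
        using points B(1) from_nat_into[of B] by (intro union) blast
      moreover have "(\<Union>n. {from_nat_into B n}) = B"
        using range_from_nat_into[OF \<open>B \<noteq> {}\<close> True] by auto
      ultimately show False using B(2) by simp
    next
      case False
      let ?U = "{C. C \<subseteq> B \<and> \<not> null C}"
      have compl: "C \<in> ?U" if "C \<subseteq> B" "null (B - C)" for C
      proof -
        have "B \<subseteq> C \<union> (B - C)" by blast
        then show ?thesis using null_Un[of C "B - C"] that mono B(2) by blast
      qed
      have Inter: "(\<Inter>n. C n) \<in> ?U" if C: "\<And>n. C n \<in> ?U" for C :: "nat \<Rightarrow> 'i set"
      proof (rule compl)
        have "null (\<Union>n. B - C n)" using C B(3) by (intro union) blast
        moreover have "B - (\<Inter>n. C n) = (\<Union>n. B - C n)" by blast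
        ultimately show "null (B - (\<Inter>n. C n))" by (simp only:)
        show "(\<Inter>n. C n) \<subseteq> B" using C by blast
      qed
      have "omega1_complete_ultrafilter B ?U"
        unfolding omega1_complete_ultrafilter_def
      proof (intro conjI ballI allI impI)
        fix C D assume CD: "C \<in> ?U" "D \<in> ?U"
        have "(\<Inter>n::nat. if n = 0 then C else D) \<in> ?U" using CD by (intro Inter) auto
        moreover have "(\<Inter>n::nat. if n = 0 then C else D) = C \<inter> D"
        proof (rule set_eqI)
          fix x
          show "x \<in> (\<Inter>n::nat. if n = 0 then C else D) \<longleftrightarrow> x \<in> C \<inter> D"
            by simp (metis zero_neq_one)
        qed
        ultimately show "C \<inter> D \<in> ?U" by simp
      next
        fix C D assume "C \<in> ?U" "C \<subseteq> D \<and> D \<subseteq> B"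
        then show "D \<in> ?U" using mono by blast
      next
        fix C assume "C \<subseteq> B"
        then show "C \<in> ?U \<or> B - C \<in> ?U" using compl[of C] by blast
      next
        fix C :: "nat \<Rightarrow> 'i set" assume "range C \<subseteq> ?U"
        then show "(\<Inter>n. C n) \<in> ?U" by (intro Inter) blast
      qed (use B empty in auto)
      then have "omega1_measurable B"
        using False points B(1) unfolding omega1_measurable_def by blast
      then show False using nonmeasurable B(1) A(1) by blast
    qed
  qed
  define F where "F = {i\<in>I. \<not> null {i}}"
  have "finite F"
  proof (rule ccontr)
    assume "infinite F"
    then obtain f :: "nat \<Rightarrow> 'i" where f: "inj f" "range f \<subseteq> F"
      using infinite_countable_subset by blast
    have "disjoint_family (\<lambda>n. {f n})"
      using f(1) by (auto simp: disjoint_family_on_def inj_def)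
    then show False using ccc[of "\<lambda>n. {f n}"] f(2) by (auto simp: F_def)
  qed
  moreover have "null (I - F)" using point[of "I - F"] by (auto simp: F_def)
  moreover have "F \<subseteq> I" by (simp add: F_def)
  ultimately show ?thesis using that by blast
qed

lemma omega1_measurable_bij:
  assumes b: "bij_betw b A B" and A: "omega1_measurable A"
  shows "omega1_measurable B"
proof -
  obtain U where U: "omega1_complete_ultrafilter A U" "\<And>x. x \<in> A \<Longrightarrow> {x} \<notin> U" and unc: "uncountable A"
    using A by (auto simp: omega1_measurable_def)
  define V where "V = {C. C \<subseteq> B \<and> b -` C \<inter> A \<in> U}"
  have bA: "b ` A = B" and inj: "inj_on b A" using b by (auto simp: bij_betw_def)
  note U' = U(1)[unfolded omega1_complete_ultrafilter_def]
  have "omega1_complete_ultrafilter B V"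
    unfolding omega1_complete_ultrafilter_def
  proof (intro conjI ballI allI impI)
    have "b -` B \<inter> A = A" using bA by blast
    then show "B \<in> V" using U' by (simp add: V_def)
  next
    fix C D assume "C \<in> V" "C \<subseteq> D \<and> D \<subseteq> B"
    moreover have "b -` C \<inter> A \<subseteq> b -` D \<inter> A" using calculation by blast
    ultimately show "D \<in> V" using U' by (auto simp: V_def)
  next
    fix C D assume "C \<in> V" "D \<in> V"
    moreover have "b -` (C \<inter> D) \<inter> A = (b -` C \<inter> A) \<inter> (b -` D \<inter> A)" by blast
    ultimately show "C \<inter> D \<in> V" using U' by (auto simp: V_def)
  next
    fix C assume "C \<subseteq> B"
    moreover have "b -` (B - C) \<inter> A = A - (b -` C \<inter> A)" using bA by blast
    ultimately show "C \<in> V \<or> B - C \<in> V" using U' by (auto simp: V_def)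
  next
    fix C :: "nat \<Rightarrow> _" assume "range C \<subseteq> V"
    then have C: "\<And>n. C n \<subseteq> B \<and> b -` C n \<inter> A \<in> U" by (auto simp: V_def)
    then have "range (\<lambda>n. b -` C n \<inter> A) \<subseteq> U" by blast
    then have "(\<Inter>n. b -` C n \<inter> A) \<in> U" using U' by blast
    moreover have "b -` (\<Inter>n. C n) \<inter> A = (\<Inter>n. b -` C n \<inter> A)" by blast
    moreover have "(\<Inter>n. C n) \<subseteq> B" using C by blast
    ultimately show "(\<Inter>n. C n) \<in> V" by (simp add: V_def)
  qed (use U' in \<open>auto simp: V_def\<close>)
  moreover have "{y} \<notin> V" if "y \<in> B" for y
  proof -
    obtain x where "x \<in> A" "y = b x" using \<open>y \<in> B\<close> bA by blast
    moreover then have "b -` {y} \<inter> A = {x}" using inj by (auto simp: inj_on_def)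
    ultimately show ?thesis using U(2) by (simp add: V_def)
  qed
  moreover have "uncountable B"
    using unc countable_image_inj_on[of b A] bA inj by auto
  ultimately show ?thesis by (auto simp: omega1_measurable_def)
qed

lemma non_measurability_index:
  fixes \<kappa> :: "'c card_bound" and I :: "'i set"
  assumes "infinite_bound \<kappa>" "non_measurability TYPE('i) \<kappa>" "card_below I \<kappa>" "B \<subseteq> I"
  shows "\<not> omega1_measurable B"
proof (cases \<kappa>)
  case (Cardinal r)
  then have r: "Card_order r" "|I| <o r" using assms by auto
  have "|B| <o r" using ordLeq_ordLess_trans[OF card_of_mono1[OF assms(4)] r(2)] .
  then obtain a where a: "a \<in> Field r" "|B| =o Restr r (underS r a)"
    using ordLess_iff_ordIso_Restr[of r "|B|"] r(1) card_of_Well_order[of B]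
    by (auto simp: card_order_on_well_order_on)
  have "Well_order r" using r(1) by (auto simp: card_order_on_well_order_on)
  then have "Field (Restr r (underS r a)) = underS r a"
    by (intro Field_Restr_ofilter) (auto intro: wo_rel.underS_ofilter simp: wo_rel_def)
  then obtain b where "bij_betw b B (underS r a)"
    using a(2) unfolding ordIso_def iso_def by (auto simp: card_of_Well_order Field_card_of)
  moreover have "\<not> omega1_measurable (underS r a)" using assms(2) a(1) Cardinal by simp
  ultimately show ?thesis using omega1_measurable_bij by blast
qed (use assms in auto)

section \<open>Functionals on products\<close>

text \<open>The sets \<open>A\<close> for which \<open>|\<phi>| \<le> \<epsilon>\<close> on the families with support in \<open>A\<close> and norm at most
  \<open>M\<close> form an ideal. It is countably complete, and it contains one of any infinite sequence of
  disjoint sets, both because a sequence of families with disjoint supports gives a functional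
  on \<open>\<ell>\<^sup>\<infinity>\<close>.\<close>

lemma (in spherically_incomplete_field) functional_small_off_finite:
  fixes W :: "'i \<Rightarrow> ('k, 'u::ab_group_add) nspace"
  assumes W: "\<And>i. i \<in> I \<Longrightarrow> normed_space abv (W i)"
    and \<phi>: "functional abv (bounded_product I W) \<phi>" and "0 < \<epsilon>"
    and nonmeasurable: "\<And>B. B \<subseteq> I \<Longrightarrow> \<not> omega1_measurable B"
  obtains F where "finite F" "F \<subseteq> I"
    "\<And>w. w \<in> vcarrier (bounded_product I W) \<Longrightarrow> vnorm (bounded_product I W) w \<le> M \<Longrightarrow>
       (\<And>i. i \<in> F \<Longrightarrow> w i = 0) \<Longrightarrow> abv (\<phi> w) \<le> \<epsilon>"
proof -
  let ?P = "bounded_product I W"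
  have N: "normed abv ?P" by (rule normed_bounded_product[OF normed_space_normed[OF W]])
  have FP: "family_space abv I W ?P" by (rule family_space_bounded_product[OF W])
  define null where "null A \<longleftrightarrow>
    (\<forall>w\<in>vcarrier ?P. vnorm ?P w \<le> M \<longrightarrow> (\<forall>i. w i \<noteq> 0 \<longrightarrow> i \<in> A) \<longrightarrow> abv (\<phi> w) \<le> \<epsilon>)" for A
  have union: "null (\<Union>n. A n)" if A: "\<And>n. null (A n)" for A :: "nat \<Rightarrow> 'i set"
    unfolding null_def
  proof (intro ballI impI)
    fix w assume w: "w \<in> vcarrier ?P" "vnorm ?P w \<le> M" "\<forall>i. w i \<noteq> 0 \<longrightarrow> i \<in> (\<Union>n. A n)"
    define \<nu> where "\<nu> i = (LEAST n. i \<in> A n)" for i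
    define v where "v n = restr (\<nu> -` {n}) w" for n
    have v: "v n \<in> vcarrier ?P" "vnorm ?P (v n) \<le> M" for n
      using FP w order_trans[OF restr_norm_le[OF FP w(1)]] by (auto simp: v_def family_space_def)
    have supp: "\<nu> i = n" if "v n i \<noteq> 0" for n i
      using that by (simp add: v_def restr_def split: if_splits)
    obtain T where T: "bounded_map (linf abv) ?P T" "\<And>n. T (unit_seq n) = v n"
      "T (\<lambda>_. 1) = (\<lambda>i. v (\<nu> i) i)"
      using glue_disjoint_families[where w = v and \<nu> = \<nu> and M = M, OF W v supp] by blast
    have "T (\<lambda>_. 1) = w" by (simp add: T(3) v_def restr_def)
    moreover have "abv (\<phi> (T (\<lambda>_. 1))) \<le> \<epsilon>"
    proof (rule functional_le_coeffs[OF bounded_map_comp[OF N normed_field_space T(1) \<phi>]])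
      show "(\<lambda>_. 1) \<in> vcarrier (linf abv)" by (rule bounded_functions_memI[of _ _ 1]) simp
      have "i \<in> A n" if "v n i \<noteq> 0" for n i
      proof -
        have "w i \<noteq> 0" using that by (auto simp: v_def restr_def split: if_splits)
        then have "\<exists>n. i \<in> A n" using w(3) by blast
        then have "i \<in> A (\<nu> i)" unfolding \<nu>_def by (rule LeastI_ex)
        then show ?thesis using supp[OF that] by simp
      qed
      then show "abv (1 * \<phi> (T (unit_seq n))) \<le> \<epsilon>" for n
        using A[of n] v[of n] unfolding null_def T(2) by auto
    qed
    ultimately show "abv (\<phi> w) \<le> \<epsilon>" by simp
  qed
  have ccc: "\<exists>n. null (A n)" if A: "disjoint_family A" for A :: "nat \<Rightarrow> 'i set"
  proof (rule ccontr)
    assume "\<not> ?thesis"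
    then have "\<exists>w. \<forall>n. w n \<in> vcarrier ?P \<and> vnorm ?P (w n) \<le> M \<and> (\<forall>i. w n i \<noteq> 0 \<longrightarrow> i \<in> A n) \<and>
        \<epsilon> < abv (\<phi> (w n))"
      unfolding null_def by (intro choice) (auto simp: not_le)
    then obtain w where w: "\<And>n. w n \<in> vcarrier ?P" "\<And>n. vnorm ?P (w n) \<le> M"
      "\<And>n i. w n i \<noteq> 0 \<Longrightarrow> i \<in> A n" "\<And>n. \<epsilon> < abv (\<phi> (w n))" by blast
    define \<nu> where "\<nu> i = (LEAST n. i \<in> A n)" for i
    have supp: "\<nu> i = n" if "w n i \<noteq> 0" for n i
    proof -
      have "i \<in> A n" using w(3)[OF that] .
      moreover have "i \<in> A (\<nu> i)" unfolding \<nu>_def by (rule LeastI[of _ n]) (rule w(3)[OF that])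
      ultimately show ?thesis using A by (auto simp: disjoint_family_on_def)
    qed
    obtain T where T: "bounded_map (linf abv) ?P T" "\<And>n. T (unit_seq n) = w n"
      using glue_disjoint_families[where w = w and \<nu> = \<nu> and M = M, OF W w(1,2) supp] by blast
    have "(\<lambda>n. abv (\<phi> (T (unit_seq n)))) \<longlonglongrightarrow> 0"
      by (rule functional_unit_seq_tendsto[OF bounded_map_comp[OF N normed_field_space T(1) \<phi>]])
    then obtain n where "abv (\<phi> (T (unit_seq n))) < \<epsilon>"
      using LIMSEQ_D[of "\<lambda>n. abv (\<phi> (T (unit_seq n)))" 0, OF _ \<open>0 < \<epsilon>\<close>] by auto
    then show False using w(4)[of n] T(2)[of n] by simp
  qed
  obtain F where F: "finite F" "F \<subseteq> I" "null (I - F)"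
  proof (rule sigma_ideal_cofinite[of null I, OF _ union ccc nonmeasurable])
    show "null A" if "A \<subseteq> B" "null B" for A B
      using that unfolding null_def by blast
  qed
  have "abv (\<phi> w) \<le> \<epsilon>"
    if w: "w \<in> vcarrier ?P" "vnorm ?P w \<le> M" "\<And>i. i \<in> F \<Longrightarrow> w i = 0" for w
  proof -
    have "\<forall>i. w i \<noteq> 0 \<longrightarrow> i \<in> I - F"
      using w(3) bounded_product_coord_mem(2)[OF w(1)] by blast
    then show ?thesis using F(3) w(1,2) unfolding null_def by blast
  qed
  then show ?thesis using that F by blast
qed

section \<open>Thin spaces\<close>

definition contraction ::
  "('k::field, 'v::ab_group_add) nspace \<Rightarrow> ('k, 'w::ab_group_add) nspace \<Rightarrow> ('v \<Rightarrow> 'w) \<Rightarrow> bool" where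
  "contraction V W f \<longleftrightarrow> bounded_map V W f \<and> (\<forall>x\<in>vcarrier V. vnorm W (f x) \<le> vnorm V x)"

text \<open>A copy \<open>\<alpha>\<close> of \<open>D\<close> inside \<open>D\<close>, with a projection \<open>\<beta>\<close> onto it.\<close>

definition compression ::
  "('k::field, 'v::ab_group_add) nspace \<Rightarrow> ('v \<Rightarrow> 'v) \<Rightarrow> ('v \<Rightarrow> 'v) \<Rightarrow> bool" where
  "compression D \<alpha> \<beta> \<longleftrightarrow> contraction D D \<alpha> \<and> contraction D D \<beta> \<and> (\<forall>x\<in>vcarrier D. \<beta> (\<alpha> x) = x)"

definition compresses ::
  "('k::field, 'v::ab_group_add) nspace \<Rightarrow> ('v \<Rightarrow> 'v) \<Rightarrow> real \<Rightarrow> bool" where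
  "compresses D T \<delta> \<longleftrightarrow> (\<exists>\<alpha> \<beta>. compression D \<alpha> \<beta> \<and>
     (\<forall>x\<in>vcarrier D. vnorm D x \<le> 1 \<longrightarrow> vnorm D (\<beta> (T (\<alpha> x))) \<le> \<delta>))"

text \<open>Every operator on \<open>D\<close> that factors through a thin space is small on some copy of \<open>D\<close>. Since
  the identity is not small on any copy, a non-zero space \<open>D\<close> is not thin itself.\<close>

definition thin ::
  "('k::field, 'v::ab_group_add) nspace \<Rightarrow> ('k, 'w::ab_group_add) nspace \<Rightarrow> bool" where
  "thin D W \<longleftrightarrow> (\<forall>f g \<delta>. bounded_map D W f \<longrightarrow> bounded_map W D g \<longrightarrow> 0 < \<delta> \<longrightarrow>
     compresses D (\<lambda>x. g (f x)) \<delta>)"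

lemma
  assumes "compression D \<alpha> \<beta>"
  shows compression_bounded: "bounded_map D D \<alpha>" "bounded_map D D \<beta>"
    and compression_mem: "x \<in> vcarrier D \<Longrightarrow> \<alpha> x \<in> vcarrier D" "x \<in> vcarrier D \<Longrightarrow> \<beta> x \<in> vcarrier D"
    and compression_le: "x \<in> vcarrier D \<Longrightarrow> vnorm D (\<alpha> x) \<le> vnorm D x"
      "x \<in> vcarrier D \<Longrightarrow> vnorm D (\<beta> x) \<le> vnorm D x"
    and compression_retract: "x \<in> vcarrier D \<Longrightarrow> \<beta> (\<alpha> x) = x"
  using assms by (auto simp: compression_def contraction_def intro: bounded_map_mem)

lemma contraction_comp:
  assumes "normed abv D" "contraction D D f" "contraction D D g"
  shows "contraction D D (\<lambda>x. g (f x))"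
  using assms bounded_map_comp[OF assms(1,1), of D f g]
  by (auto simp: contraction_def intro: bounded_map_mem order_trans)

lemma compression_comp:
  assumes "normed abv D" "compression D \<alpha> \<beta>" "compression D \<alpha>' \<beta>'"
  shows "compression D (\<lambda>x. \<alpha> (\<alpha>' x)) (\<lambda>x. \<beta>' (\<beta> x))"
  using assms contraction_comp[OF assms(1)] compression_mem[OF assms(3)]
  by (auto simp: compression_def)

lemma compression_id: "compression D (\<lambda>x. x) (\<lambda>x. x)"
  by (auto simp: compression_def contraction_def bounded_map_def intro: exI[of _ 1])

lemma thinD:
  assumes "thin D W" "bounded_map D W f" "bounded_map W D g" "0 < \<delta>"
  obtains \<alpha> \<beta> where "compression D \<alpha> \<beta>"
    "\<And>x. x \<in> vcarrier D \<Longrightarrow> vnorm D x \<le> 1 \<Longrightarrow> vnorm D (\<beta> (g (f (\<alpha> x)))) \<le> \<delta>"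
  using assms unfolding thin_def compresses_def by blast

text \<open>What is small on a copy of \<open>D\<close> remains small on a copy inside this copy, so finitely many
  operators can be treated one after the other.\<close>

lemma thin_simultaneous:
  assumes D: "normed abv D" and "finite F" and "0 < \<delta>"
    and "\<And>i. i \<in> F \<Longrightarrow> thin D (W i) \<and> normed abv (W i) \<and>
           bounded_map D (W i) (f i) \<and> bounded_map (W i) D (g i)"
  obtains \<alpha> \<beta> where "compression D \<alpha> \<beta>"
    "\<And>i x. i \<in> F \<Longrightarrow> x \<in> vcarrier D \<Longrightarrow> vnorm D x \<le> 1 \<Longrightarrow> vnorm D (\<beta> (g i (f i (\<alpha> x)))) \<le> \<delta>"
  using assms(2,4)
proof (induction F arbitrary: thesis)
  case empty
  show ?case by (rule empty(1)[OF compression_id]) auto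
next
  case (insert i F)
  obtain \<alpha> \<beta> where c: "compression D \<alpha> \<beta>" and small:
    "\<And>j x. j \<in> F \<Longrightarrow> x \<in> vcarrier D \<Longrightarrow> vnorm D x \<le> 1 \<Longrightarrow> vnorm D (\<beta> (g j (f j (\<alpha> x)))) \<le> \<delta>"
    using insert.IH insert.prems(2) by blast
  have i: "thin D (W i)" "normed abv (W i)" "bounded_map D (W i) (f i)" "bounded_map (W i) D (g i)"
    using insert.prems(2)[of i] by auto
  obtain \<alpha>' \<beta>' where c': "compression D \<alpha>' \<beta>'" and small':
    "\<And>x. x \<in> vcarrier D \<Longrightarrow> vnorm D x \<le> 1 \<Longrightarrow> vnorm D (\<beta>' (\<beta> (g i (f i (\<alpha> (\<alpha>' x)))))) \<le> \<delta>"
    using thinD[OF i(1) bounded_map_comp[OF D i(2) compression_bounded(1)[OF c] i(3)]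
        bounded_map_comp[OF D D i(4) compression_bounded(2)[OF c]] assms(3)] by blast
  show ?case
  proof (rule insert.prems(1)[OF compression_comp[OF D c c']])
    fix j x assume j: "j \<in> insert i F" and x: "x \<in> vcarrier D" "vnorm D x \<le> 1"
    show "vnorm D (\<beta>' (\<beta> (g j (f j (\<alpha> (\<alpha>' x)))))) \<le> \<delta>"
    proof (cases "j = i")
      case False
      then have "j \<in> F" using j by simp
      have x': "\<alpha>' x \<in> vcarrier D" "vnorm D (\<alpha>' x) \<le> 1"
        using x compression_mem[OF c'] compression_le[OF c'] by (auto intro: order_trans)
      have "g j (f j (\<alpha> (\<alpha>' x))) \<in> vcarrier D"
        using insert.prems(2)[OF j] compression_mem(1)[OF c x'(1)] by (auto intro: bounded_map_mem)
      then have "vnorm D (\<beta>' (\<beta> (g j (f j (\<alpha> (\<alpha>' x)))))) \<le> vnorm D (\<beta> (g j (f j (\<alpha> (\<alpha>' x)))))"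
        using compression_le(2)[OF c'] compression_mem(2)[OF c] by blast
      then show ?thesis using small[OF \<open>j \<in> F\<close> x'] by linarith
    qed (use small' x in simp)
  qed
qed

lemma thin_retract:
  assumes D: "normed abv D" and V: "normed abv V" and W: "normed abv W" and thin: "thin D W"
    and u: "bounded_map V W u" and v: "bounded_map W V v" and vu: "\<And>x. x \<in> vcarrier V \<Longrightarrow> v (u x) = x"
  shows "thin D V"
  unfolding thin_def
proof (intro allI impI)
  fix f g and \<delta> :: real assume f: "bounded_map D V f" and g: "bounded_map V D g" and "0 < \<delta>"
  obtain \<alpha> \<beta> where c: "compression D \<alpha> \<beta>" and small:
    "\<And>x. x \<in> vcarrier D \<Longrightarrow> vnorm D x \<le> 1 \<Longrightarrow> vnorm D (\<beta> (g (v (u (f (\<alpha> x)))))) \<le> \<delta>"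
    using thinD[OF thin bounded_map_comp[OF V W f u] bounded_map_comp[OF V D v g] \<open>0 < \<delta>\<close>] by blast
  moreover have "v (u (f (\<alpha> x))) = f (\<alpha> x)" if "x \<in> vcarrier D" for x
    using vu bounded_map_mem[OF f compression_mem(1)[OF c that]] .
  ultimately show "compresses D (\<lambda>x. g (f x)) \<delta>"
    unfolding compresses_def by auto
qed

lemma thin_isometric:
  assumes D: "normed abv D" and V: "normed abv V" and W: "normed abv W" and thin: "thin D W"
    and iso: "V \<cong>\<^sub>B W"
  shows "thin D V"
proof -
  obtain u where bij: "bij_betw u (vcarrier V) (vcarrier W)"
    and add: "\<And>x y. x \<in> vcarrier V \<Longrightarrow> y \<in> vcarrier V \<Longrightarrow> u (x + y) = u x + u y"
    and scale: "\<And>c x. x \<in> vcarrier V \<Longrightarrow> u (vscale V c x) = vscale W c (u x)"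
    and norm: "\<And>x. x \<in> vcarrier V \<Longrightarrow> vnorm W (u x) = vnorm V x"
    using iso unfolding isometrically_isomorphic_def by blast
  define v where "v = the_inv_into (vcarrier V) u"
  have vu: "v (u x) = x" if "x \<in> vcarrier V" for x
    using bij that by (simp add: v_def bij_betw_def the_inv_into_f_f)
  have surj: "\<exists>x\<in>vcarrier V. y = u x" if "y \<in> vcarrier W" for y
    using bij that by (auto simp: bij_betw_def)
  have u: "bounded_map V W u"
    using bij add scale norm by (intro bounded_mapI[where C = 1]) (auto simp: bij_betw_def)
  have v: "bounded_map W V v"
  proof (rule bounded_mapI[where C = 1])
    fix y assume "y \<in> vcarrier W"
    then obtain x where x: "x \<in> vcarrier V" "y = u x" using surj by blast
    then show "v y \<in> vcarrier V" "vnorm V (v y) \<le> 1 * vnorm W y"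
      using vu norm by auto
    show "v (vscale W c y) = vscale V c (v y)" for c
      using x vu scale[of x c] normed_scale_mem[OF V x(1), of c] vu[of "vscale V c x"] by simp
    fix y' assume "y' \<in> vcarrier W"
    then obtain x' where x': "x' \<in> vcarrier V" "y' = u x'" using surj by blast
    then show "v (y + y') = v y + v y'"
      using x vu add[of x x'] normed_add_mem[OF V x(1) x'(1)] vu[of "x + x'"] by simp
  qed
  show ?thesis by (rule thin_retract[OF D V W thin u v vu])
qed

text \<open>It is enough to make an operator small on the tails of the families: the finitely many
  entries before the tail pass through thin spaces.\<close>

lemma thin_finitely_many_entries:
  assumes D: "normed abv D" and V: "family_space abv I W V"
    and thin: "\<And>i. i \<in> I \<Longrightarrow> thin D (W i)"
    and f: "bounded_map D V f" and g: "bounded_map V D g" and "0 < \<delta>"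
    and c: "compression D \<alpha> \<beta>" and F: "finite F" "F \<subseteq> I"
    and tail: "\<And>x. x \<in> vcarrier D \<Longrightarrow> vnorm D x \<le> 1 \<Longrightarrow> vnorm D (\<beta> (g (restr (- F) (f (\<alpha> x))))) \<le> \<delta>"
  shows "compresses D (\<lambda>x. g (f x)) \<delta>"
proof -
  have N: "normed abv V" and W: "\<And>i. i \<in> I \<Longrightarrow> normed abv (W i)"
    using V by (auto simp: family_space_def normed_space_def)
  have c\<alpha>: "bounded_map D D \<alpha>" and c\<beta>: "bounded_map D D \<beta>" using compression_bounded[OF c] .
  have f\<alpha>: "bounded_map D V (\<lambda>x. f (\<alpha> x))" by (rule bounded_map_comp[OF D N c\<alpha> f])
  have "thin D (W i) \<and> normed abv (W i) \<and> bounded_map D (W i) (\<lambda>x. f (\<alpha> x) i) \<and>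
      bounded_map (W i) D (\<lambda>u. \<beta> (g (single i u)))" if "i \<in> F" for i
  proof -
    have i: "i \<in> I" using F that by blast
    show ?thesis
      using thin[OF i] W[OF i] bounded_map_comp[OF N W[OF i] f\<alpha> bounded_map_coord[OF V i]]
        bounded_map_comp[OF D D bounded_map_comp[OF N D bounded_map_single[OF V i] g] c\<beta>] by blast
  qed
  then obtain \<alpha>' \<beta>' where c': "compression D \<alpha>' \<beta>'" and small:
    "\<And>i x. i \<in> F \<Longrightarrow> x \<in> vcarrier D \<Longrightarrow> vnorm D x \<le> 1 \<Longrightarrow>
       vnorm D (\<beta>' (\<beta> (g (single i (f (\<alpha> (\<alpha>' x)) i))))) \<le> \<delta>"
    using thin_simultaneous[OF D F(1) \<open>0 < \<delta>\<close>, of W "\<lambda>i x. f (\<alpha> x) i" "\<lambda>i u. \<beta> (g (single i u))"]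
    by blast
  have "vnorm D (\<beta>' (\<beta> (g (f (\<alpha> (\<alpha>' x)))))) \<le> \<delta>" if x: "x \<in> vcarrier D" "vnorm D x \<le> 1" for x
  proof -
    define w where "w = f (\<alpha> (\<alpha>' x))"
    have x': "\<alpha>' x \<in> vcarrier D" "vnorm D (\<alpha>' x) \<le> 1"
      using x compression_mem[OF c'] compression_le[OF c'] by (auto intro: order_trans)
    have w: "w \<in> vcarrier V" unfolding w_def by (rule bounded_map_mem[OF f\<alpha> x'(1)])
    have restr: "restr A w \<in> vcarrier V" for A using V w by (simp add: family_space_def)
    let ?T = "\<lambda>w. \<beta>' (\<beta> (g w))"
    have T: "bounded_map V D ?T"
      using bounded_map_comp[OF D D bounded_map_comp[OF D D g c\<beta>] compression_bounded(2)[OF c']] .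
    have "w i \<in> vcarrier (W i)" if "i \<in> F" for i
      using bounded_map_mem[OF bounded_map_coord[OF V] w] F that by blast
    then have single: "single i (w i) \<in> vcarrier V" if "i \<in> F" for i
      using bounded_map_mem[OF bounded_map_single[OF V]] F that by blast
    have "?T (restr F w) = (\<Sum>i\<in>F. ?T (single i (w i)))"
      unfolding restr_finite_eq_sum[OF F(1)] by (rule bounded_map_sum[OF N T single])
    moreover have "vnorm D (\<Sum>i\<in>F. ?T (single i (w i))) \<le> \<delta>"
      using small[OF _ x] bounded_map_mem[OF T single] \<open>0 < \<delta>\<close> unfolding w_def
      by (intro normed_sum_le[OF D]) auto
    moreover have "vnorm D (?T (restr (- F) w)) \<le> \<delta>"
      using tail[OF x'] compression_le(2)[OF c' compression_mem(2)[OF c bounded_map_mem[OF g restr]]]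
      unfolding w_def by (rule order_trans[rotated])
    moreover have "w = restr F w + restr (- F) w" by (auto simp: restr_def)
    then have "?T w = ?T (restr F w) + ?T (restr (- F) w)"
      using bounded_map_add[OF T restr restr, of F "- F"] by simp
    ultimately show ?thesis
      using normed_add[OF D bounded_map_mem[OF T restr] bounded_map_mem[OF T restr], of F "- F"]
      unfolding w_def by simp
  qed
  then show ?thesis unfolding compresses_def using compression_comp[OF D c c'] by blast
qed

text \<open>The assumptions \<open>shrinking\<close> and \<open>gathering\<close> say what is left of a completed direct sum and of
  a bounded direct product of infinitely many copies of \<open>D\<close>, sitting inside \<open>D\<close> as retracts, when
  only the single copies are kept: an element of the sum has projections that tend to zero, and
  bounded multiples of elements of the copies can be gathered to an element of the product.\<close>

locale self_similar = spherically_incomplete_field abv for abv :: "'k::field \<Rightarrow> real" +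
  fixes D :: "('k, 'v::ab_group_add) nspace"
  assumes D: "normed_space abv D"
    and norming: "\<And>x t. x \<in> vcarrier D \<Longrightarrow> 0 < t \<Longrightarrow> t < vnorm D x \<Longrightarrow>
      \<exists>h. functional abv D h \<and> (\<forall>y\<in>vcarrier D. abv (h y) \<le> vnorm D y) \<and> t < abv (h x)"
    and shrinking: "\<exists>\<alpha> \<beta>. (\<forall>n. compression D (\<alpha> n) (\<beta> n)) \<and>
      (\<forall>x\<in>vcarrier D. (\<lambda>n. vnorm D (\<beta> n x)) \<longlonglongrightarrow> 0)"
    and gathering: "\<exists>\<alpha> \<beta>. (\<forall>n. compression D (\<alpha> n) (\<beta> n)) \<and>
      (\<forall>y. (\<forall>n. y n \<in> vcarrier D \<and> vnorm D (y n) \<le> 1) \<longrightarrow>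
         (\<exists>R. bounded_map (linf abv) D R \<and> (\<forall>n. R (unit_seq n) = \<alpha> n (y n))))"
begin

lemmas normed_D = normed_space_normed[OF D]

text \<open>An operator that factors through the field has rank one, and the projections of the shrinking
  copies make a vector that spans its image as small as desired.\<close>

lemma thin_field_space: "thin D (field_space abv)"
  unfolding thin_def
proof (intro allI impI)
  fix f g and \<delta> :: real
  assume f: "functional abv D f" and g: "bounded_map (field_space abv) D g" and "0 < \<delta>"
  obtain \<alpha> \<beta> where c: "\<And>n. compression D (\<alpha> n) (\<beta> n)"
    and shrink: "\<And>x. x \<in> vcarrier D \<Longrightarrow> (\<lambda>n. vnorm D (\<beta> n x)) \<longlonglongrightarrow> 0"
    using shrinking by blast
  obtain C where C: "0 < C" "\<And>x. x \<in> vcarrier D \<Longrightarrow> abv (f x) \<le> C * vnorm D x"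
    using bounded_map_bound[OF normed_D f] by auto
  have g1: "g 1 \<in> vcarrier D" using bounded_map_mem[OF g] by simp
  have "0 < \<delta> / C" using \<open>0 < \<delta>\<close> C(1) by simp
  then obtain n where n: "vnorm D (\<beta> n (g 1)) < \<delta> / C"
    using LIMSEQ_D[OF shrink[OF g1] \<open>0 < \<delta> / C\<close>] by (auto simp: abs_less_iff)
  have "vnorm D (\<beta> n (g (f (\<alpha> n x)))) \<le> \<delta>" if x: "x \<in> vcarrier D" "vnorm D x \<le> 1" for x
  proof -
    have "C * vnorm D (\<alpha> n x) \<le> C * 1"
      using compression_le(1)[OF c x(1), of n] x(2) C(1) by (intro mult_left_mono) auto
    then have "abv (f (\<alpha> n x)) \<le> C"
      using C(2)[OF compression_mem(1)[OF c x(1)], of n] by simp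
    moreover have "\<beta> n (g (f (\<alpha> n x))) = vscale D (f (\<alpha> n x)) (\<beta> n (g 1))"
      using bounded_map_scale[OF g, of 1 "f (\<alpha> n x)"]
        bounded_map_scale[OF compression_bounded(2)[OF c] g1] by simp
    then have "vnorm D (\<beta> n (g (f (\<alpha> n x)))) = abv (f (\<alpha> n x)) * vnorm D (\<beta> n (g 1))"
      using normed_scale[OF normed_D compression_mem(2)[OF c g1]] by simp
    moreover have "abv (f (\<alpha> n x)) * vnorm D (\<beta> n (g 1)) \<le> C * (\<delta> / C)"
      using calculation(1) n C(1) normed_nonneg[OF normed_D compression_mem(2)[OF c g1], of n]
      by (intro mult_mono) auto
    ultimately show ?thesis using C(1) by simp
  qed
  then show "compresses D (\<lambda>x. g (f x)) \<delta>"
    unfolding compresses_def using c by blast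
qed

text \<open>If the operators \<open>\<beta> n \<circ> g\<close> are not small on any tail, then there are families \<open>w n\<close> with
  disjoint finite supports on which they are not small: each value is detected by a functional,
  which is small on a tail itself. By the gliding hump this contradicts \<open>\<beta> n x \<longrightarrow> 0\<close>.\<close>

lemma thin_bounded_product:
  fixes W :: "'i \<Rightarrow> ('k, 'u::ab_group_add) nspace"
  assumes W: "\<And>i. i \<in> I \<Longrightarrow> normed_space abv (W i)" and thin: "\<And>i. i \<in> I \<Longrightarrow> thin D (W i)"
    and nonmeasurable: "\<And>B. B \<subseteq> I \<Longrightarrow> \<not> omega1_measurable B"
  shows "thin D (bounded_product I W)"
  unfolding thin_def
proof (intro allI impI)
  let ?P = "bounded_product I W" and ?L = "linf abv"
  fix f g and \<delta> :: real
  assume f: "bounded_map D ?P f" and g: "bounded_map ?P D g" and "0 < \<delta>"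
  have P: "family_space abv I W ?P" by (rule family_space_bounded_product[OF W])
  have N: "normed abv ?P" using P by (simp add: family_space_def)
  obtain \<alpha> \<beta> where c: "\<And>n. compression D (\<alpha> n) (\<beta> n)"
    and shrink: "\<And>x. x \<in> vcarrier D \<Longrightarrow> (\<lambda>n. vnorm D (\<beta> n x)) \<longlonglongrightarrow> 0"
    using shrinking by blast
  have \<beta>g: "bounded_map ?P D (\<lambda>w. \<beta> n (g w))" for n
    using bounded_map_comp[OF normed_D normed_D g compression_bounded(2)[OF c]] .
  obtain M where M: "0 < M" "\<And>x. x \<in> vcarrier D \<Longrightarrow> vnorm ?P (f x) \<le> M * vnorm D x"
    using bounded_map_bound[OF normed_D f] by blast
  have "\<exists>n F. finite F \<and> F \<subseteq> I \<and>
    (\<forall>w\<in>vcarrier ?P. vnorm ?P w \<le> M \<longrightarrow> (\<forall>i\<in>F. w i = 0) \<longrightarrow> vnorm D (\<beta> n (g w)) \<le> \<delta>)"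
  proof (rule ccontr)
    assume no: "\<not> ?thesis"
    define hump where "hump n F G \<longleftrightarrow> F \<subseteq> G \<and>
      (\<exists>w h. w \<in> vcarrier ?P \<and> vnorm ?P w \<le> M \<and> (\<forall>i. w i \<noteq> 0 \<longrightarrow> i \<in> G - F) \<and>
         functional abv D h \<and> (\<forall>y\<in>vcarrier D. abv (h y) \<le> vnorm D y) \<and> \<delta> < abv (h (\<beta> n (g w))))"
      for n F G
    have step: "\<exists>G. (finite G \<and> G \<subseteq> I) \<and> hump n F G" if F: "finite F \<and> F \<subseteq> I" for F n
    proof -
      obtain w where w: "w \<in> vcarrier ?P" "vnorm ?P w \<le> M" "\<And>i. i \<in> F \<Longrightarrow> w i = 0"
        and big: "\<delta> < vnorm D (\<beta> n (g w))"
        using no F by (meson not_le)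
      obtain h where h: "functional abv D h" "\<And>y. y \<in> vcarrier D \<Longrightarrow> abv (h y) \<le> vnorm D y"
        "\<delta> < abv (h (\<beta> n (g w)))"
        using norming[OF bounded_map_mem[OF \<beta>g w(1)] \<open>0 < \<delta>\<close> big] by blast
      have h\<beta>g: "functional abv ?P (\<lambda>w. h (\<beta> n (g w)))"
        using bounded_map_comp[OF normed_D normed_field_space \<beta>g h(1)] .
      obtain G where G: "finite G" "G \<subseteq> I" and small:
        "\<And>w. w \<in> vcarrier ?P \<Longrightarrow> vnorm ?P w \<le> M \<Longrightarrow> (\<And>i. i \<in> G \<Longrightarrow> w i = 0) \<Longrightarrow> abv (h (\<beta> n (g w))) \<le> \<delta>"
        using functional_small_off_finite[OF W h\<beta>g \<open>0 < \<delta>\<close> nonmeasurable] by metis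
      have restr: "restr A w \<in> vcarrier ?P" "vnorm ?P (restr A w) \<le> M" for A
        using P w restr_norm_le[OF P w(1)] by (auto simp: family_space_def intro: order_trans)
      have "abv (h (\<beta> n (g (restr (- G) w)))) \<le> \<delta>"
        by (rule small[OF restr]) (simp add: restr_def)
      moreover have "w = restr G w + restr (- G) w" by (auto simp: restr_def)
      then have "h (\<beta> n (g w)) = h (\<beta> n (g (restr G w))) + h (\<beta> n (g (restr (- G) w)))"
        using bounded_map_add[OF h\<beta>g restr(1) restr(1), of G "- G"] by simp
      ultimately have "\<delta> < abv (h (\<beta> n (g (restr G w))))"
        using h(3) abv_add_le[of "h (\<beta> n (g (restr G w)))" "h (\<beta> n (g (restr (- G) w)))"] by auto
      moreover have "\<forall>i. restr G w i \<noteq> 0 \<longrightarrow> i \<in> (F \<union> G) - F"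
        using w(3) by (auto simp: restr_def)
      ultimately show ?thesis
        unfolding hump_def using F G h(1,2) restr[of G] by (intro exI[of _ "F \<union> G"]) blast
    qed
    obtain F where F: "\<And>n. hump n (F n) (F (Suc n))"
      using dependent_nat_choice[of "\<lambda>_ F. finite F \<and> F \<subseteq> I" hump, OF _ step] by blast
    then obtain w h where w: "\<And>n. w n \<in> vcarrier ?P" "\<And>n. vnorm ?P (w n) \<le> M"
      "\<And>n i. w n i \<noteq> 0 \<Longrightarrow> i \<in> F (Suc n) - F n"
      and h: "\<And>n. functional abv D (h n)" "\<And>n y. y \<in> vcarrier D \<Longrightarrow> abv (h n y) \<le> vnorm D y"
      and big: "\<And>n. \<delta> < abv (h n (\<beta> n (g (w n))))"
      unfolding hump_def by metis
    define \<nu> where "\<nu> i = (LEAST n. i \<in> F (Suc n))" for i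
    have F_mono: "F m \<subseteq> F n" if "m \<le> n" for m n
      using lift_Suc_mono_le[of F m n] F that by (simp add: hump_def)
    have supp: "\<nu> i = n" if "w n i \<noteq> 0" for n i
      unfolding \<nu>_def
    proof (rule Least_equality)
      show "i \<in> F (Suc n)" using w(3)[OF that] by blast
      show "n \<le> m" if "i \<in> F (Suc m)" for m
        using that w(3)[OF \<open>w n i \<noteq> 0\<close>] F_mono[of "Suc m" n] by (meson DiffD2 not_less_eq_eq subsetD)
    qed
    obtain T where T: "bounded_map ?L ?P T" "\<And>n. T (unit_seq n) = w n"
      using glue_disjoint_families[where w = w and \<nu> = \<nu> and M = M, OF W w(1,2) supp] by blast
    have \<beta>gT: "bounded_map ?L D (\<lambda>x. \<beta> n (g (T x)))" for n
      using bounded_map_comp[OF N normed_D T(1) \<beta>g] .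
    have "\<exists>n. abv (h n (\<beta> n (g (T (unit_seq n))))) \<le> \<delta>"
    proof (rule gliding_hump[OF _ _ \<open>0 < \<delta>\<close>])
      show "functional abv ?L (\<lambda>x. h n (\<beta> n (g (T x))))" for n
        using bounded_map_comp[OF normed_D normed_field_space \<beta>gT h(1)] .
      show "(\<lambda>n. abv (h n (\<beta> n (g (T x))))) \<longlonglongrightarrow> 0" if x: "x \<in> vcarrier ?L" for x
        using shrink[OF bounded_map_mem[OF g bounded_map_mem[OF T(1) x]]] abv_nonneg
          h(2)[OF bounded_map_mem[OF \<beta>gT x]] by (rule tendsto_zero_bounded)
    qed
    then obtain n where "abv (h n (\<beta> n (g (w n)))) \<le> \<delta>" unfolding T(2) by blast
    then show False using big[of n] by simp
  qed
  then obtain n F where F: "finite F" "F \<subseteq> I" and small: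
    "\<forall>w\<in>vcarrier ?P. vnorm ?P w \<le> M \<longrightarrow> (\<forall>i\<in>F. w i = 0) \<longrightarrow> vnorm D (\<beta> n (g w)) \<le> \<delta>"
    by (elim exE conjE)
  show "compresses D (\<lambda>x. g (f x)) \<delta>"
  proof (rule thin_finitely_many_entries[OF normed_D P thin f g \<open>0 < \<delta>\<close> c F])
    fix x assume x: "x \<in> vcarrier D" "vnorm D x \<le> 1"
    have \<alpha>x: "\<alpha> n x \<in> vcarrier D" using compression_mem(1)[OF c x(1)] .
    have fx: "f (\<alpha> n x) \<in> vcarrier ?P" by (rule bounded_map_mem[OF f \<alpha>x])
    show "vnorm D (\<beta> n (g (restr (- F) (f (\<alpha> n x))))) \<le> \<delta>"
    proof (rule small[rule_format])
      show "restr (- F) (f (\<alpha> n x)) \<in> vcarrier ?P" using P fx by (simp add: family_space_def)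
      have "vnorm ?P (restr (- F) (f (\<alpha> n x))) \<le> M * vnorm D (\<alpha> n x)"
        using restr_norm_le[OF P fx] M(2)[OF \<alpha>x] by (rule order_trans)
      also have "\<dots> \<le> M * 1"
        using M(1) compression_le(1)[OF c x(1), of n] x(2) by (intro mult_left_mono) auto
      finally show "vnorm ?P (restr (- F) (f (\<alpha> n x))) \<le> M" by simp
    qed (simp add: restr_def)
  qed
qed

text \<open>If the operators \<open>f \<circ> \<alpha> n\<close> are not small off any finite set, then there are vectors \<open>y n\<close>
  for which \<open>f (\<alpha> n (y n))\<close> is not small on \<open>F (Suc n) - F n\<close>, the finite sets \<open>F n\<close> being
  increasing. Restricted to \<open>F (Suc n) - F n\<close>, each single family in \<open>\<Sigma>\<close> becomes small as \<open>n\<close>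
  grows, and so the gliding hump gives a contradiction.\<close>

lemma thin_completed_sum:
  fixes W :: "'i \<Rightarrow> ('k, 'u::ab_group_add) nspace"
  assumes W: "\<And>i. i \<in> I \<Longrightarrow> normed_space abv (W i)" and thin: "\<And>i. i \<in> I \<Longrightarrow> thin D (W i)"
  shows "thin D (completed_sum I W)"
  unfolding thin_def
proof (intro allI impI)
  let ?S = "completed_sum I W" and ?L = "linf abv"
  fix f g and \<delta> :: real
  assume f: "bounded_map D ?S f" and g: "bounded_map ?S D g" and "0 < \<delta>"
  have S: "family_space abv I W ?S" by (rule family_space_completed_sum[OF W])
  have N: "normed abv ?S" using S by (simp add: family_space_def)
  have NW: "normed abv (W i)" if "i \<in> I" for i using normed_space_normed[OF W[OF that]] .
  obtain \<alpha> \<beta> where c: "\<And>n. compression D (\<alpha> n) (\<beta> n)"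
    and gather: "\<And>y. (\<And>n. y n \<in> vcarrier D \<and> vnorm D (y n) \<le> 1) \<Longrightarrow>
         (\<exists>R. bounded_map ?L D R \<and> (\<forall>n. R (unit_seq n) = \<alpha> n (y n)))"
    using gathering by blast
  have \<beta>g: "bounded_map ?S D (\<lambda>w. \<beta> n (g w))" for n
    using bounded_map_comp[OF normed_D normed_D g compression_bounded(2)[OF c]] .
  obtain M where M: "0 < M" "\<And>w. w \<in> vcarrier ?S \<Longrightarrow> vnorm D (g w) \<le> M * vnorm ?S w"
    using bounded_map_bound[OF N g] by blast
  have restr: "restr A w \<in> vcarrier ?S" if "w \<in> vcarrier ?S" for A w
    using S that by (simp add: family_space_def)
  have small_entries: "vnorm D (\<beta> n (g (restr A w))) \<le> M * \<eta>"
    if w: "w \<in> vcarrier ?S" and A: "\<And>i. i \<in> I \<Longrightarrow> i \<in> A \<Longrightarrow> vnorm (W i) (w i) \<le> \<eta>" and "0 \<le> \<eta>"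
    for w A \<eta> n
  proof -
    have "vnorm ?S (restr A w) \<le> \<eta>"
      unfolding completed_sum_simps using A \<open>0 \<le> \<eta>\<close> normed_zero[OF NW]
      by (intro bounded_product_norm_le) (auto simp: restr_def)
    then have "M * vnorm ?S (restr A w) \<le> M * \<eta>" using M(1) by simp
    then show ?thesis
      using M(2)[OF restr[OF w], of A] compression_le(2)[OF c bounded_map_mem[OF g restr[OF w]], of n A]
      by linarith
  qed
  have "\<exists>n F. finite F \<and> F \<subseteq> I \<and>
    (\<forall>x\<in>vcarrier D. vnorm D x \<le> 1 \<longrightarrow> vnorm D (\<beta> n (g (restr (- F) (f (\<alpha> n x))))) \<le> \<delta>)"
  proof (rule ccontr)
    assume no: "\<not> ?thesis"
    define hump where "hump n F G \<longleftrightarrow> F \<subseteq> G \<and>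
      (\<exists>y h. y \<in> vcarrier D \<and> vnorm D y \<le> 1 \<and>
         functional abv D h \<and> (\<forall>y\<in>vcarrier D. abv (h y) \<le> vnorm D y) \<and>
         \<delta> < abv (h (\<beta> n (g (restr (G - F) (f (\<alpha> n y)))))))"
      for n F G
    have step: "\<exists>G. (finite G \<and> G \<subseteq> I) \<and> hump n F G" if F: "finite F \<and> F \<subseteq> I" for F n
    proof -
      obtain y where y: "y \<in> vcarrier D" "vnorm D y \<le> 1"
        and big: "\<delta> < vnorm D (\<beta> n (g (restr (- F) (f (\<alpha> n y)))))"
        using no F by (meson not_le)
      define w where "w = f (\<alpha> n y)"
      have w: "w \<in> vcarrier ?S"
        unfolding w_def by (rule bounded_map_mem[OF f compression_mem(1)[OF c y(1)]])
      define G where "G = {i\<in>I. \<delta> / M \<le> vnorm (W i) (w i)}"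
      have G: "finite G" "G \<subseteq> I"
        using w M(1) \<open>0 < \<delta>\<close> by (auto simp: G_def completed_sum_simps)
      have "vnorm D (\<beta> n (g (restr (- (F \<union> G)) w))) \<le> M * (\<delta> / M)"
        using M(1) \<open>0 < \<delta>\<close> by (intro small_entries[OF w]) (auto simp: G_def)
      then have tail: "vnorm D (\<beta> n (g (restr (- (F \<union> G)) w))) \<le> \<delta>" using M(1) by simp
      have "restr (- F) w = restr ((F \<union> G) - F) w + restr (- (F \<union> G)) w" by (auto simp: restr_def)
      then have "\<beta> n (g (restr (- F) w)) =
          \<beta> n (g (restr ((F \<union> G) - F) w)) + \<beta> n (g (restr (- (F \<union> G)) w))"
        using bounded_map_add[OF \<beta>g restr[OF w] restr[OF w]] by simp
      then have "vnorm D (\<beta> n (g (restr (- F) w))) \<le>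
          max (vnorm D (\<beta> n (g (restr ((F \<union> G) - F) w)))) (vnorm D (\<beta> n (g (restr (- (F \<union> G)) w))))"
        using normed_add[OF normed_D bounded_map_mem[OF \<beta>g restr[OF w]] bounded_map_mem[OF \<beta>g restr[OF w]]]
        by simp
      then have "\<delta> < vnorm D (\<beta> n (g (restr ((F \<union> G) - F) w)))"
        using big tail unfolding w_def by linarith
      then obtain h where "functional abv D h" "\<forall>y\<in>vcarrier D. abv (h y) \<le> vnorm D y"
        "\<delta> < abv (h (\<beta> n (g (restr ((F \<union> G) - F) w))))"
        using norming[OF bounded_map_mem[OF \<beta>g restr[OF w]] \<open>0 < \<delta>\<close>] by blast
      then show ?thesis
        using F G y unfolding w_def hump_def by (intro exI[of _ "F \<union> G"]) blast
    qed
    obtain F where F: "\<And>n. hump n (F n) (F (Suc n))"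
      using dependent_nat_choice[of "\<lambda>_ F. finite F \<and> F \<subseteq> I" hump, OF _ step] by blast
    then obtain y h where y: "\<And>n. y n \<in> vcarrier D \<and> vnorm D (y n) \<le> 1"
      and h: "\<And>n. functional abv D (h n)" "\<And>n y. y \<in> vcarrier D \<Longrightarrow> abv (h n y) \<le> vnorm D y"
      and big: "\<And>n. \<delta> < abv (h n (\<beta> n (g (restr (F (Suc n) - F n) (f (\<alpha> n (y n)))))))"
      unfolding hump_def by metis
    obtain R where R: "bounded_map ?L D R" "\<And>n. R (unit_seq n) = \<alpha> n (y n)"
      using gather[of y, OF y] by blast
    have fR: "bounded_map ?L ?S (\<lambda>x. f (R x))"
      by (rule bounded_map_comp[OF normed_D N R(1) f])
    have restr_map: "bounded_map ?S ?S (restr A)" for A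
      using restr restr_norm_le[OF S] normed_space_scale_zero[OF W]
      by (intro bounded_mapI[where C = 1])
         (auto simp: restr_def fun_eq_iff completed_sum_simps(1) bounded_product_scale)
    have F_mono: "F m \<subseteq> F n" if "m \<le> n" for m n
      using lift_Suc_mono_le[of F m n] F that by (simp add: hump_def)
    define A where "A n = F (Suc n) - F n" for n
    have map: "bounded_map ?L D (\<lambda>x. \<beta> n (g (restr (A n) (f (R x)))))" for n
      using bounded_map_comp[OF N normed_D bounded_map_comp[OF N N fR restr_map] \<beta>g] .
    have "\<exists>n. abv (h n (\<beta> n (g (restr (A n) (f (R (unit_seq n))))))) \<le> \<delta>"
    proof (rule gliding_hump[OF _ _ \<open>0 < \<delta>\<close>])
      show "functional abv ?L (\<lambda>x. h n (\<beta> n (g (restr (A n) (f (R x))))))" for n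
        using bounded_map_comp[OF normed_D normed_field_space map h(1)] .
      fix x assume x: "x \<in> vcarrier ?L"
      define w where "w = f (R x)"
      have w: "w \<in> vcarrier ?S" unfolding w_def by (rule bounded_map_mem[OF fR x])
      show "(\<lambda>n. abv (h n (\<beta> n (g (restr (A n) (f (R x))))))) \<longlonglongrightarrow> 0"
        unfolding w_def[symmetric]
      proof (rule LIMSEQ_I)
        fix e :: real assume e: "0 < e"
        define \<eta> where "\<eta> = e / (2 * M)"
        have \<eta>: "0 < \<eta>" using e M(1) by (simp add: \<eta>_def)
        define X where "X = {i\<in>I. \<eta> \<le> vnorm (W i) (w i)}"
        have X: "finite X" using w \<eta> by (simp add: X_def completed_sum_simps)
        have "\<exists>n0. \<forall>n\<ge>n0. X \<inter> A n = {}"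
          using X
        proof induction
          case (insert i X)
          then obtain n0 where n0: "\<And>n. n \<ge> n0 \<Longrightarrow> X \<inter> A n = {}" by blast
          have "\<exists>m. \<forall>n\<ge>m. i \<notin> A n"
          proof (cases "\<exists>m. i \<in> F m")
            case True
            then obtain m where "i \<in> F m" by blast
            then show ?thesis using F_mono by (intro exI[of _ m]) (auto simp: A_def)
          qed (auto simp: A_def)
          then obtain m where "\<And>n. n \<ge> m \<Longrightarrow> i \<notin> A n" by blast
          then show ?case using n0 by (intro exI[of _ "max m n0"]) auto
        qed simp
        then obtain n0 where n0: "\<And>n. n \<ge> n0 \<Longrightarrow> X \<inter> A n = {}" by blast
        have "abv (h n (\<beta> n (g (restr (A n) w)))) < e" if "n \<ge> n0" for n
        proof -
          have "vnorm D (\<beta> n (g (restr (A n) w))) \<le> M * \<eta>"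
            using n0[OF that] \<eta> by (intro small_entries[OF w]) (auto simp: X_def)
          then show ?thesis
            using h(2)[OF bounded_map_mem[OF \<beta>g restr[OF w]], of n n "A n"] e M(1)
            by (simp add: \<eta>_def)
        qed
        then show "\<exists>n0. \<forall>n\<ge>n0. norm (abv (h n (\<beta> n (g (restr (A n) w)))) - 0) < e"
          by auto
      qed
    qed
    then obtain n where "abv (h n (\<beta> n (g (restr (A n) (f (\<alpha> n (y n))))))) \<le> \<delta>"
      unfolding R(2) by blast
    then show False using big[of n] by (simp add: A_def)
  qed
  then obtain n F where F: "finite F" "F \<subseteq> I" and small: "\<And>x. x \<in> vcarrier D \<Longrightarrow> vnorm D x \<le> 1 \<Longrightarrow>
      vnorm D (\<beta> n (g (restr (- F) (f (\<alpha> n x))))) \<le> \<delta>"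
    by blast
  show "compresses D (\<lambda>x. g (f x)) \<delta>"
    by (rule thin_finitely_many_entries[OF normed_D S thin f g \<open>0 < \<delta>\<close> c F small])
qed

text \<open>The spaces \<open>k\<^sup>n\<close> are products over index sets of natural numbers, which are countable and
  therefore not measurable.\<close>

lemma thin_Fk:
  assumes "V \<in> Fk abv"
  shows "thin D V"
proof -
  obtain n where V: "banach_space abv V" "V \<cong>\<^sub>B finite_power abv n"
    using assms by (auto simp: Fk_def)
  let ?P = "bounded_product {..<n} (\<lambda>_. field_space abv)" and ?F = "finite_power abv n"
  have P: "normed abv ?P"
    by (rule normed_bounded_product[OF normed_field_space])
  have carrier: "vcarrier ?F = vcarrier ?P"
    by (auto simp: finite_power_def bounded_product_def not_less)
  have norm: "vnorm ?F = vnorm ?P"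
    by (auto simp: finite_power_def bounded_product_def fun_eq_iff cSup_eq_Max)
  have scale: "vscale ?F c x = vscale ?P c x" if "x \<in> vcarrier ?P" for c x
    using that by (auto simp: finite_power_def bounded_product_def fun_eq_iff)
  have F: "normed abv ?F"
    using P unfolding normed_def carrier norm by (simp add: scale)
  have "thin D ?P"
  proof (rule thin_bounded_product[OF normed_space_field_space thin_field_space])
    fix B :: "nat set"
    show "\<not> omega1_measurable B" by (auto simp: omega1_measurable_def)
  qed
  then have "thin D ?F"
    by (rule thin_retract[OF normed_D F P, of "\<lambda>x. x" "\<lambda>x. x"])
       (auto intro!: bounded_mapI[where C = 1] simp: carrier norm scale)
  then show ?thesis
    using thin_isometric[OF normed_D normed_space_normed[OF banach_space_normed_space[OF V(1)]] F _ V(2)]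
    by blast
qed

lemma reid_step_thin:
  fixes \<kappa> :: "'c card_bound" and X :: "('k, 'u::ab_group_add) nspace set"
  assumes \<kappa>: "infinite_bound \<kappa>" "non_measurability TYPE('i) \<kappa>"
    and X: "\<And>W. W \<in> X \<Longrightarrow> banach_space abv W \<and> thin D W"
    and V: "V \<in> reid_step abv \<kappa> TYPE('i) X"
  shows "banach_space abv V \<and> thin D V"
proof -
  consider "V \<in> Fk abv" | (product) I :: "'i set" and W where "banach_space abv V" "card_below I \<kappa>"
      "\<forall>i\<in>I. W i \<in> X" "V \<cong>\<^sub>B bounded_product I W \<or> V \<cong>\<^sub>B completed_sum I W"
    using V unfolding reid_step_def reid_Pi_def reid_Sigma_def by blast
  then show ?thesis
  proof cases
    case 1
    then show ?thesis using thin_Fk by (simp add: Fk_def)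
  next
    case product
    have W: "normed_space abv (W i)" and thin: "thin D (W i)" if "i \<in> I" for i
      using X product(3) that banach_space_normed_space by blast+
    have NW: "normed abv (W i)" if "i \<in> I" for i using normed_space_normed[OF W[OF that]] .
    note NV = normed_space_normed[OF banach_space_normed_space[OF product(1)]]
    have "thin D (bounded_product I W)"
      by (rule thin_bounded_product[OF W thin non_measurability_index[OF \<kappa> product(2)]])
    moreover have "thin D (completed_sum I W)" by (rule thin_completed_sum[OF W thin])
    ultimately have "thin D V"
      using product(4) thin_isometric[OF normed_D NV] normed_bounded_product[of I W, OF NW]
        normed_completed_sum[of I W, OF NW] by blast
    then show ?thesis using product(1) by blast
  qed
qed

lemma reid_less_thin:
  fixes \<kappa> :: "'c card_bound" and \<alpha> :: "'o::wellorder"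
  assumes \<kappa>: "infinite_bound \<kappa>" "non_measurability TYPE('i) \<kappa>"
    and V: "(V :: ('k, 'u::ab_group_add) nspace) \<in> reid_less abv \<kappa> TYPE('i) \<alpha>"
  shows "banach_space abv V \<and> thin D V"
  using V
proof (induction \<alpha> arbitrary: V rule: less_induct)
  case (less \<alpha>)
  obtain \<gamma> where \<gamma>: "\<gamma> < \<alpha>"
    "V \<in> reid_step abv \<kappa> TYPE('i) (reid_less abv \<kappa> TYPE('i) \<gamma> :: ('k, 'u) nspace set)"
    using less.prems by (subst (asm) reid_less.simps) blast
  show ?case by (rule reid_step_thin[OF \<kappa> less.IH[OF \<gamma>(1)] \<gamma>(2)])
qed

lemma not_in_reid_class:
  fixes \<kappa> :: "'c card_bound"
  assumes \<kappa>: "infinite_bound \<kappa>" "non_measurability TYPE('i) \<kappa>"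
    and x: "x \<in> vcarrier D" "vnorm D x \<noteq> 0"
  shows "D \<notin> reid_class abv \<kappa> TYPE('i) TYPE('u::ab_group_add) TYPE('o::wellorder)"
proof
  assume "D \<in> reid_class abv \<kappa> TYPE('i) TYPE('u) TYPE('o)"
  then obtain \<gamma> :: 'o where
    "D \<in> reid_step abv \<kappa> TYPE('i) (reid_less abv \<kappa> TYPE('i) \<gamma> :: ('k, 'u) nspace set)"
    unfolding reid_class_def by blast
  then have "banach_space abv D \<and> thin D D"
    by (rule reid_step_thin[OF \<kappa> reid_less_thin[OF \<kappa>], rotated])
  then have thin: "thin D D" ..
  have pos: "0 < vnorm D x" using x normed_nonneg[OF normed_D x(1)] by simp
  obtain a where a: "0 < abv a" "abv a < 1 / vnorm D x"
    using abv_between[of 0 "1 / vnorm D x"] pos by auto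
  define y where "y = vscale D a x"
  have y: "y \<in> vcarrier D" "vnorm D y = abv a * vnorm D x"
    using normed_scale_mem[OF normed_D x(1)] normed_scale[OF normed_D x(1)] by (simp_all add: y_def)
  have y1: "vnorm D y \<le> 1" "0 < vnorm D y" using a pos y(2) by (auto simp: field_simps)
  have id: "bounded_map D D (\<lambda>x. x)" by (rule bounded_mapI[where C = 1]) auto
  obtain \<alpha> \<beta> where c: "compression D \<alpha> \<beta>" and small: "\<And>x. x \<in> vcarrier D \<Longrightarrow> vnorm D x \<le> 1 \<Longrightarrow>
      vnorm D (\<beta> (\<alpha> x)) \<le> vnorm D y / 2"
    using thinD[OF thin id id, of "vnorm D y / 2"] y1(2) by auto
  show False
    using small[OF y(1) y1(1)] compression_retract[OF c y(1)] y1(2) by simp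
qed

end

section \<open>Copies of the rationals\<close>

lemma rat_square_neq_2: "(x::rat)\<^sup>2 \<noteq> 2"
proof (cases x)
  case (Fract a b)
  show ?thesis
  proof
    assume "x\<^sup>2 = 2"
    then have "Fract (a * a) (b * b) = Fract 2 1"
      using Fract by (simp add: power2_eq_square Fract_of_int_eq[symmetric] rat_number_expand)
    then have eq: "a * a = 2 * (b * b)"
      using Fract by (simp add: eq_rat)
    then have "even (a * a)" by (metis dvd_triv_left)
    then have "even a" by simp
    then obtain c where c: "a = 2 * c" by blast
    then have "2 * (c * c) = b * b" using eq by simp
    then have "even (b * b)" by (metis dvd_triv_left)
    then have "even b" by simp
    with \<open>even a\<close> Fract show False
      by (metis coprime_common_divisor odd_one)
  qed
qed

lemma rat_square_continuous:
  fixes x e :: rat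
  assumes "0 < e"
  shows "\<exists>d>0. \<forall>y. \<bar>y - x\<bar> < d \<longrightarrow> \<bar>y\<^sup>2 - x\<^sup>2\<bar> < e"
proof (intro exI conjI allI impI)
  let ?K = "2 * \<bar>x\<bar> + 1"
  let ?d = "min 1 (e / ?K)"
  have K: "0 < ?K" by linarith
  then show "0 < ?d" using assms by simp
  fix y assume y: "\<bar>y - x\<bar> < ?d"
  have "\<bar>y + x\<bar> \<le> ?K" using y by linarith
  moreover have "y\<^sup>2 - x\<^sup>2 = (y - x) * (y + x)" by (simp add: power2_eq_square algebra_simps)
  ultimately have "\<bar>y\<^sup>2 - x\<^sup>2\<bar> \<le> \<bar>y - x\<bar> * ?K" by (simp add: abs_mult mult_left_mono)
  also have "\<dots> < e / ?K * ?K" using y K by (intro mult_strict_right_mono) auto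
  finally show "\<bar>y\<^sup>2 - x\<^sup>2\<bar> < e" using K by simp
qed

lemma square_less_2_open:
  fixes x :: rat
  assumes "x\<^sup>2 < 2"
  shows "\<exists>d>0. \<forall>y. \<bar>y - x\<bar> < d \<longrightarrow> y\<^sup>2 < 2"
proof -
  obtain d where "d > 0" "\<And>y. \<bar>y - x\<bar> < d \<Longrightarrow> \<bar>y\<^sup>2 - x\<^sup>2\<bar> < 2 - x\<^sup>2"
    using rat_square_continuous[of "2 - x\<^sup>2" x] assms by auto
  then show ?thesis by (intro exI[of _ d]) (auto simp: abs_less_iff)
qed

lemma square_less_2_closed:
  fixes x :: rat
  assumes "\<not> x\<^sup>2 < 2"
  shows "\<exists>d>0. \<forall>y. \<bar>y - x\<bar> < d \<longrightarrow> \<not> y\<^sup>2 < 2"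
proof -
  have "0 < x\<^sup>2 - 2" using assms rat_square_neq_2[of x] by simp
  then obtain d where d: "d > 0" "\<And>y. \<bar>y - x\<bar> < d \<Longrightarrow> \<bar>y\<^sup>2 - x\<^sup>2\<bar> < x\<^sup>2 - 2"
    using rat_square_continuous[of "x\<^sup>2 - 2" x] by auto
  have "\<not> y\<^sup>2 < 2" if "\<bar>y - x\<bar> < d" for y
    using d(2)[OF that] by (simp add: abs_less_iff)
  with d(1) show ?thesis by blast
qed

text \<open>The isomorphism is odd and linear between consecutive integers, and on the non-negative
  integers it takes the values of a sequence of rationals that increases to the square root of 2.
  This is the sequence of \<open>s \<mapsto> (3 s + 4) / (2 s + 3)\<close>, which fixes the square roots of 2.\<close>

lemma rat_order_isomorphism:
  obtains H :: "rat \<Rightarrow> rat" where "strict_mono H" "range H = {x. x\<^sup>2 < 2}"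
proof -
  define s :: "nat \<Rightarrow> rat" where "s = rec_nat 0 (\<lambda>_ s. (3 * s + 4) / (2 * s + 3))"
  have s_simps: "s 0 = 0" "s (Suc n) = (3 * s n + 4) / (2 * s n + 3)" for n
    by (simp_all add: s_def)
  have s: "0 \<le> s n \<and> 0 < 2 - (s n)\<^sup>2 \<and> (2 - (s n)\<^sup>2) * of_nat (Suc n) \<le> 2" for n
  proof (induction n)
    case (Suc n)
    let ?q = "2 * s n + 3"
    have q: "3 \<le> ?q" using Suc by simp
    have eq: "2 - (s (Suc n))\<^sup>2 = (2 - (s n)\<^sup>2) / ?q\<^sup>2"
    proof -
      have "s (Suc n) * ?q = 3 * s n + 4" using q by (simp add: s_simps)
      then have "(s (Suc n))\<^sup>2 * ?q\<^sup>2 = (3 * s n + 4)\<^sup>2" by (metis power_mult_distrib)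
      then have "(2 - (s (Suc n))\<^sup>2) * ?q\<^sup>2 = 2 - (s n)\<^sup>2"
        by (simp add: left_diff_distrib) (simp add: power2_eq_square algebra_simps)
      moreover have "?q\<^sup>2 \<noteq> 0" using q by simp
      ultimately show ?thesis by (simp add: eq_divide_eq)
    qed
    have "3\<^sup>2 \<le> ?q\<^sup>2" using q by (intro power_mono) auto
    then have "(2 - (s n)\<^sup>2) / ?q\<^sup>2 \<le> (2 - (s n)\<^sup>2) / 9"
      using Suc by (intro divide_left_mono) auto
    then have "(2 - (s (Suc n))\<^sup>2) * of_nat (Suc (Suc n)) \<le> (2 - (s n)\<^sup>2) / 9 * of_nat (Suc (Suc n))"
      unfolding eq by (intro mult_right_mono) auto
    also have "\<dots> \<le> (2 - (s n)\<^sup>2) / 9 * (2 * of_nat (Suc n))"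
      using Suc by (intro mult_left_mono) auto
    also have "\<dots> = 2 / 9 * ((2 - (s n)\<^sup>2) * of_nat (Suc n))" by simp
    also have "\<dots> \<le> 2 / 9 * 2" using Suc by (intro mult_left_mono) auto
    also have "\<dots> \<le> 2" by simp
    finally have "(2 - (s (Suc n))\<^sup>2) * of_nat (Suc (Suc n)) \<le> 2" .
    moreover have "0 \<le> s (Suc n)" using Suc by (simp add: s_simps)
    moreover have "0 < 2 - (s (Suc n))\<^sup>2" unfolding eq using Suc q by (intro divide_pos_pos) auto
    ultimately show ?case by blast
  qed (simp add: s_simps)
  have s_less: "s n < s (Suc n)" for n
  proof -
    have "s n * (2 * s n + 3) < 3 * s n + 4"
      using s[of n] by (simp add: power2_eq_square algebra_simps)
    then show ?thesis using s[of n] by (simp add: s_simps less_divide_eq)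
  qed
  have s_le: "s m \<le> s n" if "m \<le> n" for m n
    using lift_Suc_mono_le[of s, OF less_imp_le[OF s_less] that] .
  have s_limit: "\<exists>n. x < s n" if "0 \<le> x" "x\<^sup>2 < 2" for x
  proof -
    obtain n where n: "2 / (2 - x\<^sup>2) < of_nat n" using reals_Archimedean2 by blast
    then have "2 < (2 - x\<^sup>2) * of_nat n" using that by (simp add: field_simps)
    also have "\<dots> \<le> (2 - x\<^sup>2) * of_nat (Suc n)" using that by (intro mult_left_mono) auto
    finally have "(2 - (s n)\<^sup>2) * of_nat (Suc n) < (2 - x\<^sup>2) * of_nat (Suc n)"
      using s[of n] by linarith
    then have "x\<^sup>2 < (s n)\<^sup>2" using mult_less_cancel_right_pos[of "of_nat (Suc n) :: rat"] by simp
    then have "x < s n" using s[of n] power_less_imp_less_base by blast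
    then show ?thesis ..
  qed
  define N :: "rat \<Rightarrow> nat" where "N x = nat \<lfloor>x\<rfloor>" for x
  define h where "h x = s (N x) + (x - of_nat (N x)) * (s (Suc (N x)) - s (N x))" for x
  have N: "of_nat (N x) \<le> x \<and> x < of_nat (N x) + 1" if "0 \<le> x" for x
    using that by (simp add: N_def) linarith
  have N_eqI: "N x = n" if "of_nat n \<le> x" "x < of_nat n + 1" for x n
    using that by (simp add: N_def) (metis floor_unique nat_int of_int_of_nat_eq)
  have h_bounds: "s (N x) \<le> h x \<and> h x < s (Suc (N x))" if "0 \<le> x" for x
  proof
    have d: "0 < s (Suc (N x)) - s (N x)" using s_less[of "N x"] by simp
    show "s (N x) \<le> h x" using N[OF that] d by (simp add: h_def)
    have "(x - of_nat (N x)) * (s (Suc (N x)) - s (N x)) < 1 * (s (Suc (N x)) - s (N x))"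
      using N[OF that] d by (intro mult_strict_right_mono) auto
    then show "h x < s (Suc (N x))" by (simp add: h_def)
  qed
  have h_mono: "h x < h y" if "0 \<le> x" "x < y" for x y
  proof (cases "N x = N y")
    case True
    then show ?thesis using that(2) s_less[of "N y"] by (simp add: h_def)
  next
    case False
    have "N x \<le> N y" using that by (simp add: N_def nat_mono floor_mono)
    then have "s (Suc (N x)) \<le> s (N y)" using False by (intro s_le) auto
    then show ?thesis using h_bounds[of x] h_bounds[of y] that by auto
  qed
  have h0: "h 0 = 0" by (simp add: h_def N_def s_simps)
  have h_less: "(h x)\<^sup>2 < 2" if "0 \<le> x" for x
  proof -
    have "(h x)\<^sup>2 \<le> (s (Suc (N x)))\<^sup>2"
      using h_bounds[OF that] s[of "N x"] by (intro power_mono) auto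
    then show ?thesis using s[of "Suc (N x)"] by simp
  qed
  have h_surj: "\<exists>x\<ge>0. h x = y" if y: "0 \<le> y" "y\<^sup>2 < 2" for y
  proof -
    define n where "n = (LEAST n. y < s n)"
    have n: "y < s n" unfolding n_def using s_limit[OF y] by (rule LeastI_ex)
    then have "n \<noteq> 0" using y(1) by (metis s_simps(1) not_le)
    then obtain m where m: "n = Suc m" by (cases n) auto
    then have "s m \<le> y" using not_less_Least[of m "\<lambda>n. y < s n"] by (simp add: n_def not_less)
    define x where "x = of_nat m + (y - s m) / (s (Suc m) - s m)"
    have d: "0 < s (Suc m) - s m" using s_less[of m] by simp
    have frac: "0 \<le> (y - s m) / (s (Suc m) - s m)" "(y - s m) / (s (Suc m) - s m) < 1"
      using d \<open>s m \<le> y\<close> n m by (simp_all add: divide_less_eq)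
    then have "N x = m" by (intro N_eqI) (auto simp: x_def)
    then have "h x = y" using d by (simp add: h_def x_def)
    moreover have "0 \<le> x" using frac by (simp add: x_def)
    ultimately show ?thesis by blast
  qed
  define H where "H x = (if 0 \<le> x then h x else - h (- x))" for x
  have h_nonneg: "0 \<le> h x" if "0 \<le> x" for x
    using h_mono[of 0 x] h0 that by (cases "x = 0") auto
  have "strict_mono H"
  proof (rule strict_monoI)
    fix x y :: rat assume "x < y"
    then show "H x < H y"
      using h_mono[of x y] h_mono[of "- y" "- x"] h_nonneg[of y] h_mono[of 0 "- x"] h0
      by (auto simp: H_def)
  qed
  moreover have "range H = {x. x\<^sup>2 < 2}"
  proof
    show "range H \<subseteq> {x. x\<^sup>2 < 2}" using h_less by (auto simp: H_def)
    show "{x. x\<^sup>2 < 2} \<subseteq> range H"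
    proof
      fix y :: rat assume y: "y \<in> {x. x\<^sup>2 < 2}"
      show "y \<in> range H"
      proof (cases "0 \<le> y")
        case True
        then obtain x where "0 \<le> x" "h x = y" using h_surj y by blast
        then have "H x = y" by (simp add: H_def)
        then show ?thesis by blast
      next
        case False
        then obtain x where x: "0 \<le> x" "h x = - y" using h_surj[of "- y"] y by auto
        then have "x \<noteq> 0" using False h0 by auto
        then have "H (- x) = y" using x by (simp add: H_def)
        then show ?thesis by blast
      qed
    qed
  qed
  ultimately show ?thesis using that by blast
qed

text \<open>Mutually inverse homeomorphisms \<open>H\<close> and \<open>Q\<close> of the rationals and \<open>{x. x\<^sup>2 < 2}\<close>.\<close>

locale rat_copy =
  fixes H Q :: "rat \<Rightarrow> rat"
  assumes H_range: "(H x)\<^sup>2 < 2" and QH: "Q (H x) = x"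
    and H_continuous: "0 < e \<Longrightarrow> \<exists>d>0. \<forall>y. \<bar>y - x\<bar> < d \<longrightarrow> \<bar>H y - H x\<bar> < e"
    and Q_continuous: "x\<^sup>2 < 2 \<Longrightarrow> 0 < e \<Longrightarrow> \<exists>d>0. \<forall>y. y\<^sup>2 < 2 \<longrightarrow> \<bar>y - x\<bar> < d \<longrightarrow> \<bar>Q y - Q x\<bar> < e"

lemma rat_copy_exists: "\<exists>H Q. rat_copy H Q"
proof -
  obtain H :: "rat \<Rightarrow> rat" where mono: "strict_mono H" and range: "range H = {x. x\<^sup>2 < 2}"
    by (rule rat_order_isomorphism)
  define Q where "Q = inv H"
  have QH: "Q (H x) = x" for x
    unfolding Q_def using strict_mono_imp_inj_on[OF mono] by simp
  have less: "H x < H y \<longleftrightarrow> x < y" for x y using strict_mono_less[OF mono] .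
  have HQ: "\<exists>y. x = H y" if "x\<^sup>2 < 2" for x using range that by blast
  have H2: "(H x)\<^sup>2 < 2" for x using range by blast
  have H: "\<exists>d>0. \<forall>y. \<bar>y - x\<bar> < d \<longrightarrow> \<bar>H y - H x\<bar> < e" if "0 < e" for x e
  proof -
    obtain \<eta> where \<eta>: "0 < \<eta>" "\<And>u. \<bar>u - H x\<bar> < \<eta> \<Longrightarrow> u\<^sup>2 < 2"
      using square_less_2_open[OF H2] by blast
    let ?t = "min \<eta> e / 2"
    have t: "0 < ?t" "?t < \<eta>" "?t < e" using \<eta>(1) that by (auto simp: min_def)
    obtain y1 y2 where y: "H x - ?t = H y1" "H x + ?t = H y2"
      using HQ[OF \<eta>(2)[of "H x - ?t"]] HQ[OF \<eta>(2)[of "H x + ?t"]] t by auto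
    then have "y1 < x" "x < y2" using less[of y1 x] less[of x y2] t(1) by linarith+
    moreover have "\<bar>H y - H x\<bar> < e" if "\<bar>y - x\<bar> < min (x - y1) (y2 - x)" for y
    proof -
      have "y1 < y" "y < y2" using that by (auto simp: abs_less_iff)
      then have "H y1 < H y" "H y < H y2" using less by blast+
      then show ?thesis using y t(3) by (simp add: abs_less_iff)
    qed
    ultimately show ?thesis by (intro exI[of _ "min (x - y1) (y2 - x)"]) auto
  qed
  have Q: "\<exists>d>0. \<forall>y. y\<^sup>2 < 2 \<longrightarrow> \<bar>y - x\<bar> < d \<longrightarrow> \<bar>Q y - Q x\<bar> < e"
    if x: "x\<^sup>2 < 2" and "0 < e" for x e
  proof -
    obtain z where z: "x = H z" using HQ[OF x] by blast
    let ?d = "min (H z - H (z - e)) (H (z + e) - H z)"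
    have "0 < ?d" using less \<open>0 < e\<close> by simp
    moreover have "\<bar>Q y - Q x\<bar> < e" if y: "y\<^sup>2 < 2" "\<bar>y - x\<bar> < ?d" for y
    proof -
      obtain v where v: "y = H v" using HQ[OF y(1)] by blast
      have "H (z - e) < H v" "H v < H (z + e)" using y(2) v z by (auto simp: abs_less_iff)
      then have "z - e < v" "v < z + e" using less by blast+
      then show ?thesis by (auto simp: v z QH abs_less_iff)
    qed
    ultimately show ?thesis by blast
  qed
  have "rat_copy H Q" by (rule rat_copy.intro[OF H2 QH H Q])
  then show ?thesis by blast
qed

section \<open>The dual of the space of bounded continuous functions on the rationals\<close>

lemma dual_space_mem_iff:
  "\<phi> \<in> vcarrier (dual_space abv V) \<longleftrightarrow> functional abv V \<phi> \<and> (\<forall>x. x \<notin> vcarrier V \<longrightarrow> \<phi> x = 0)"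
  by (auto simp: dual_space_def bounded_map_def)

lemma dual_space_scale [simp]: "vscale (dual_space abv V) c \<phi> = (\<lambda>x. c * \<phi> x)"
  by (simp add: dual_space_def)

lemma openin_rat_topology:
  "openin rat_topology U \<longleftrightarrow> (\<forall>x\<in>U. \<exists>d>0. \<forall>y. \<bar>y - x\<bar> < d \<longrightarrow> y \<in> U)"
proof
  assume "openin rat_topology U"
  then obtain V :: "real set" where V: "open V" "U = of_rat -` V"
    unfolding rat_topology_def openin_pullback_topology by auto
  show "\<forall>x\<in>U. \<exists>d>0. \<forall>y. \<bar>y - x\<bar> < d \<longrightarrow> y \<in> U"
  proof
    fix x assume "x \<in> U"
    then obtain e where e: "0 < e" "\<And>z. dist z (of_rat x) < e \<Longrightarrow> z \<in> V"
      using V unfolding open_dist by auto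
    obtain d where d: "0 < d" "of_rat d < e" using of_rat_dense[OF e(1)] by auto
    have "y \<in> U" if "\<bar>y - x\<bar> < d" for y
    proof -
      have "y - x < d" "- d < y - x" using that by (auto simp: abs_less_iff)
      then have "of_rat (y - x) < (of_rat d :: real)" "of_rat (- d) < (of_rat (y - x) :: real)"
        by (simp_all only: of_rat_less)
      then show ?thesis using V(2) e(2) d by (simp add: of_rat_diff of_rat_minus dist_real_def abs_less_iff)
    qed
    then show "\<exists>d>0. \<forall>y. \<bar>y - x\<bar> < d \<longrightarrow> y \<in> U" using d(1) by auto
  qed
next
  assume U: "\<forall>x\<in>U. \<exists>d>0. \<forall>y. \<bar>y - x\<bar> < d \<longrightarrow> y \<in> U"
  then obtain d where d: "\<And>x. x \<in> U \<Longrightarrow> 0 < d x" "\<And>x y. x \<in> U \<Longrightarrow> \<bar>y - x\<bar> < d x \<Longrightarrow> y \<in> U"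
    by metis
  define V :: "real set" where "V = (\<Union>x\<in>U. ball (of_rat x) (of_rat (d x)))"
  have "y \<in> U" if "of_rat y \<in> V" for y
  proof -
    from that obtain x where x: "x \<in> U" "\<bar>of_rat x - of_rat y\<bar> < (of_rat (d x) :: real)"
      by (auto simp: V_def dist_real_def)
    then have "of_rat (x - y) < (of_rat (d x) :: real)" "of_rat (y - x) < (of_rat (d x) :: real)"
      by (auto simp: of_rat_diff abs_less_iff)
    then have "\<bar>y - x\<bar> < d x" by (simp only: of_rat_less abs_less_iff) simp
    then show ?thesis using d(2) x(1) by blast
  qed
  moreover have "of_rat x \<in> V" if "x \<in> U" for x
    using that d(1)[OF that] by (force simp: V_def)
  ultimately have "U = of_rat -` V" by auto
  moreover have "open V" by (auto simp: V_def)
  ultimately show "openin rat_topology U"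
    unfolding rat_topology_def openin_pullback_topology by auto
qed

lemma Cbd_rat_simps:
  "vscale (Cbd_rat abv) = vscale (bounded_functions abv)" "vnorm (Cbd_rat abv) = vnorm (bounded_functions abv)"
  by (simp_all add: Cbd_rat_def bounded_functions_def)

context valuation_field
begin

lemma Cbd_rat_mem_iff:
  "f \<in> vcarrier (Cbd_rat abv) \<longleftrightarrow> f \<in> vcarrier (bounded_functions abv) \<and>
     (\<forall>x. \<forall>e>0. \<exists>d>0. \<forall>y. \<bar>y - x\<bar> < d \<longrightarrow> abv (f y - f x) < e)"
proof -
  interpret K: Metric_space UNIV "vdist abv" by (rule Metric_space_abv)
  have topspace: "topspace rat_topology = UNIV"
    by (simp add: rat_topology_def topspace_pullback_topology)
  have "continuous_map rat_topology K.mtopology f \<longleftrightarrow>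
    (\<forall>x. \<forall>e>0. \<exists>U. openin rat_topology U \<and> x \<in> U \<and> (\<forall>y\<in>U. abv (f y - f x) < e))"
    unfolding K.continuous_map_to_metric topspace by (simp add: abv_diff_commute)
  also have "\<dots> \<longleftrightarrow> (\<forall>x. \<forall>e>0. \<exists>d>0. \<forall>y. \<bar>y - x\<bar> < d \<longrightarrow> abv (f y - f x) < e)"
  proof (intro all_cong1 imp_cong refl iffI)
    fix x and e :: real
    assume "\<exists>U. openin rat_topology U \<and> x \<in> U \<and> (\<forall>y\<in>U. abv (f y - f x) < e)"
    then show "\<exists>d>0. \<forall>y. \<bar>y - x\<bar> < d \<longrightarrow> abv (f y - f x) < e"
      unfolding openin_rat_topology by blast
  next
    fix x and e :: real
    assume "\<exists>d>0. \<forall>y. \<bar>y - x\<bar> < d \<longrightarrow> abv (f y - f x) < e"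
    then obtain d where d: "0 < d" "\<And>y. \<bar>y - x\<bar> < d \<Longrightarrow> abv (f y - f x) < e" by blast
    have "openin rat_topology {y. \<bar>y - x\<bar> < d}"
      unfolding openin_rat_topology
    proof
      fix y assume "y \<in> {y. \<bar>y - x\<bar> < d}"
      then show "\<exists>d'>0. \<forall>z. \<bar>z - y\<bar> < d' \<longrightarrow> z \<in> {y. \<bar>y - x\<bar> < d}"
        by (intro exI[of _ "d - \<bar>y - x\<bar>"]) auto
    qed
    then show "\<exists>U. openin rat_topology U \<and> x \<in> U \<and> (\<forall>y\<in>U. abv (f y - f x) < e)"
      using d by (intro exI[of _ "{y. \<bar>y - x\<bar> < d}"]) auto
  qed
  finally show ?thesis by (auto simp: Cbd_rat_def bounded_functions_def)
qed

lemma normed_Cbd_rat: "normed abv (Cbd_rat abv)"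
proof -
  let ?B = "bounded_functions abv :: ('k, rat \<Rightarrow> 'k) nspace" and ?C = "Cbd_rat abv"
  note B = normed_bounded_functions[where 'x = rat]
  have add: "f + g \<in> vcarrier ?C" if fg: "f \<in> vcarrier ?C" "g \<in> vcarrier ?C" for f g
    unfolding Cbd_rat_mem_iff
  proof (intro conjI allI impI)
    show "f + g \<in> vcarrier ?B" using fg normed_add_mem[OF B] by (auto simp: Cbd_rat_mem_iff)
    fix x and e :: real assume e: "0 < e"
    obtain d d' where d: "0 < d" "\<And>y. \<bar>y - x\<bar> < d \<Longrightarrow> abv (f y - f x) < e"
      and d': "0 < d'" "\<And>y. \<bar>y - x\<bar> < d' \<Longrightarrow> abv (g y - g x) < e"
      using fg e unfolding Cbd_rat_mem_iff by metis
    have "abv ((f + g) y - (f + g) x) < e" if "\<bar>y - x\<bar> < min d d'" for y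
    proof -
      have "(f + g) y - (f + g) x = (f y - f x) + (g y - g x)" by simp
      then show ?thesis
        using d(2)[of y] d'(2)[of y] that abv_add_le[of "f y - f x" "g y - g x"]
        by (simp del: plus_fun_apply)
    qed
    then show "\<exists>d>0. \<forall>y. \<bar>y - x\<bar> < d \<longrightarrow> abv ((f + g) y - (f + g) x) < e"
      using d(1) d'(1) by (intro exI[of _ "min d d'"]) auto
  qed
  have scale: "vscale ?C c f \<in> vcarrier ?C" if f: "f \<in> vcarrier ?C" for c f
    unfolding Cbd_rat_mem_iff
  proof (intro conjI allI impI)
    show "vscale ?C c f \<in> vcarrier ?B"
      using f normed_scale_mem[OF B, of f c] by (simp add: Cbd_rat_mem_iff Cbd_rat_simps)
    fix x and e :: real assume e: "0 < e"
    have c: "0 < abv c + 1" using abv_nonneg[of c] by linarith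
    then have "0 < e / (abv c + 1)" using e by simp
    then obtain d where d: "0 < d" "\<And>y. \<bar>y - x\<bar> < d \<Longrightarrow> abv (f y - f x) < e / (abv c + 1)"
      using f unfolding Cbd_rat_mem_iff by metis
    have "abv (vscale ?C c f y - vscale ?C c f x) < e" if "\<bar>y - x\<bar> < d" for y
    proof -
      have "vscale ?C c f y - vscale ?C c f x = c * (f y - f x)"
        by (simp add: Cbd_rat_simps algebra_simps)
      then have "abv (vscale ?C c f y - vscale ?C c f x) \<le> (abv c + 1) * abv (f y - f x)"
        by (simp add: abv_mult mult_right_mono)
      also have "\<dots> < (abv c + 1) * (e / (abv c + 1))"
        using d(2)[OF that] c by (intro mult_strict_left_mono) auto
      finally show ?thesis using c by simp
    qed
    then show "\<exists>d>0. \<forall>y. \<bar>y - x\<bar> < d \<longrightarrow> abv (vscale ?C c f y - vscale ?C c f x) < e"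
      using d(1) by blast
  qed
  have "- f = vscale ?C (- 1) f" for f by (auto simp: Cbd_rat_simps)
  then have minus: "- f \<in> vcarrier ?C" if "f \<in> vcarrier ?C" for f
    using scale[OF that, of "- 1"] by simp
  have zero: "0 \<in> vcarrier ?C"
    using normed_zero_mem[OF B] by (auto simp: Cbd_rat_mem_iff intro: exI[of _ 1])
  have sub: "f \<in> vcarrier ?B" if "f \<in> vcarrier ?C" for f using that by (simp add: Cbd_rat_mem_iff)
  note B' = B[unfolded normed_def, folded Cbd_rat_simps]
  show ?thesis
    unfolding normed_def using B' zero add minus scale sub by blast
qed

lemma dual_space_norm:
  assumes V: "normed abv V" and \<phi>: "\<phi> \<in> vcarrier (dual_space abv V)"
  shows dual_space_bound: "x \<in> vcarrier V \<Longrightarrow> abv (\<phi> x) \<le> vnorm (dual_space abv V) \<phi> * vnorm V x"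
    and dual_space_norm_le: "0 \<le> B \<Longrightarrow> (\<And>x. x \<in> vcarrier V \<Longrightarrow> abv (\<phi> x) \<le> B * vnorm V x) \<Longrightarrow>
      vnorm (dual_space abv V) \<phi> \<le> B"
proof -
  have f: "functional abv V \<phi>" using \<phi> by (simp add: dual_space_mem_iff)
  have quotient: "abv (\<phi> x) / vnorm V x \<le> B"
    if "0 \<le> B" "abv (\<phi> x) \<le> B * vnorm V x" "x \<in> vcarrier V" for B x
    using that normed_nonneg[OF V that(3)] by (cases "vnorm V x = 0") (auto simp: divide_le_eq)
  show "vnorm (dual_space abv V) \<phi> \<le> B"
    if "0 \<le> B" "\<And>x. x \<in> vcarrier V \<Longrightarrow> abv (\<phi> x) \<le> B * vnorm V x" for B
    using quotient that normed_zero_mem[OF V] by (auto simp: dual_space_def intro!: cSUP_least)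
  obtain C where C: "0 < C" "\<And>x. x \<in> vcarrier V \<Longrightarrow> abv (\<phi> x) \<le> C * vnorm V x"
    using bounded_map_bound[OF V f] by auto
  then have bdd: "bdd_above ((\<lambda>x. abv (\<phi> x) / vnorm V x) ` vcarrier V)"
    using quotient[of C] by (intro bdd_aboveI2[where M = C]) auto
  show "abv (\<phi> x) \<le> vnorm (dual_space abv V) \<phi> * vnorm V x" if x: "x \<in> vcarrier V" for x
  proof (cases "vnorm V x = 0")
    case True
    then show ?thesis using C(2)[OF x] by simp
  next
    case False
    then have "0 < vnorm V x" using normed_nonneg[OF V x] by simp
    moreover have "abv (\<phi> x) / vnorm V x \<le> vnorm (dual_space abv V) \<phi>"
      using cSUP_upper[OF x bdd] by (simp add: dual_space_def)
    ultimately show ?thesis by (simp add: divide_le_eq)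
  qed
qed

lemma dual_space_memI:
  assumes "\<And>x y. x \<in> vcarrier V \<Longrightarrow> y \<in> vcarrier V \<Longrightarrow> \<phi> (x + y) = \<phi> x + \<phi> y"
    and "\<And>c x. x \<in> vcarrier V \<Longrightarrow> \<phi> (vscale V c x) = c * \<phi> x"
    and "\<And>x. x \<in> vcarrier V \<Longrightarrow> abv (\<phi> x) \<le> B * vnorm V x"
    and "\<And>x. x \<notin> vcarrier V \<Longrightarrow> \<phi> x = 0"
  shows "\<phi> \<in> vcarrier (dual_space abv V)"
  using assms by (auto simp: dual_space_mem_iff intro!: bounded_mapI[where C = B])

lemma normed_space_dual_space:
  fixes V :: "('k, 'v::ab_group_add) nspace"
  assumes V: "normed abv V"
  shows "normed_space abv (dual_space abv V)"
proof -
  let ?D = "dual_space abv V"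
  note le = dual_space_bound[OF V] and leI = dual_space_norm_le[OF V]
  have fn: "functional abv V \<phi>" "x \<notin> vcarrier V \<Longrightarrow> \<phi> x = 0" if "\<phi> \<in> vcarrier ?D" for \<phi> x
    using that by (auto simp: dual_space_mem_iff)
  have nonneg: "0 \<le> vnorm ?D \<phi>" if \<phi>: "\<phi> \<in> vcarrier ?D" for \<phi>
  proof -
    obtain C where C: "0 < C" "\<And>x. x \<in> vcarrier V \<Longrightarrow> abv (\<phi> x) \<le> C * vnorm V x"
      using bounded_map_bound[OF V fn(1)[OF \<phi>]] by auto
    have "abv (\<phi> x) / vnorm V x \<le> C" if "x \<in> vcarrier V" for x
      using C(1) C(2)[OF that] normed_nonneg[OF V that] by (cases "vnorm V x = 0") (auto simp: divide_le_eq)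
    then have "bdd_above ((\<lambda>x. abv (\<phi> x) / vnorm V x) ` vcarrier V)"
      by (intro bdd_aboveI2[where M = C])
    from cSUP_upper[OF normed_zero_mem[OF V] this] show ?thesis
      by (simp add: dual_space_def normed_zero[OF V])
  qed
  have zero_mem: "0 \<in> vcarrier ?D"
    by (rule dual_space_memI[where B = 0]) auto
  have zero: "vnorm ?D 0 = 0"
    using leI[OF zero_mem, of 0] nonneg[OF zero_mem] by simp
  have add_le: "abv ((\<phi> + \<psi>) x) \<le> max (vnorm ?D \<phi>) (vnorm ?D \<psi>) * vnorm V x"
    if "\<phi> \<in> vcarrier ?D" "\<psi> \<in> vcarrier ?D" "x \<in> vcarrier V" for \<phi> \<psi> x
  proof -
    have "vnorm ?D \<phi> * vnorm V x \<le> max (vnorm ?D \<phi>) (vnorm ?D \<psi>) * vnorm V x"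
      "vnorm ?D \<psi> * vnorm V x \<le> max (vnorm ?D \<phi>) (vnorm ?D \<psi>) * vnorm V x"
      using normed_nonneg[OF V that(3)] by (auto intro: mult_right_mono)
    then show ?thesis
      using le[OF that(1,3)] le[OF that(2,3)] abv_add_le[of "\<phi> x" "\<psi> x"] by simp
  qed
  have add_mem: "\<phi> + \<psi> \<in> vcarrier ?D" if "\<phi> \<in> vcarrier ?D" "\<psi> \<in> vcarrier ?D" for \<phi> \<psi>
    using fn[OF that(1)] fn[OF that(2)]
    by (intro dual_space_memI[OF _ _ add_le[OF that]])
       (auto simp: bounded_map_add[of V] bounded_map_scale[of V] algebra_simps)
  have add: "vnorm ?D (\<phi> + \<psi>) \<le> max (vnorm ?D \<phi>) (vnorm ?D \<psi>)"
    if "\<phi> \<in> vcarrier ?D" "\<psi> \<in> vcarrier ?D" for \<phi> \<psi>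
    using nonneg[OF that(1)] by (intro leI[OF add_mem[OF that] _ add_le[OF that]]) auto
  have scale_le: "abv (c * \<phi> x) \<le> abv c * vnorm ?D \<phi> * vnorm V x"
    if "\<phi> \<in> vcarrier ?D" "x \<in> vcarrier V" for c \<phi> x
    using le[OF that] by (simp add: abv_mult mult.assoc mult_left_mono)
  have scale_mem: "(\<lambda>x. c * \<phi> x) \<in> vcarrier ?D" if "\<phi> \<in> vcarrier ?D" for c \<phi>
    using fn[OF that]
    by (intro dual_space_memI[OF _ _ scale_le[OF that]])
       (auto simp: bounded_map_add[of V] bounded_map_scale[of V] algebra_simps)
  have scale_norm_le: "vnorm ?D (\<lambda>x. c * \<phi> x) \<le> abv c * vnorm ?D \<phi>" if "\<phi> \<in> vcarrier ?D" for c \<phi>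
    using nonneg[OF that] by (intro leI[OF scale_mem[OF that] _ scale_le[OF that]]) auto
  have scale: "vnorm ?D (\<lambda>x. c * \<phi> x) = abv c * vnorm ?D \<phi>" if \<phi>: "\<phi> \<in> vcarrier ?D" for c \<phi>
  proof (cases "c = 0")
    case True
    then show ?thesis using zero by (simp add: zero_fun_def)
  next
    case False
    then have pos: "0 < abv c" using abv_nonneg[of c] by (simp add: less_le)
    have "vnorm ?D (\<lambda>x. inverse c * (c * \<phi> x)) \<le> abv (inverse c) * vnorm ?D (\<lambda>x. c * \<phi> x)"
      by (rule scale_norm_le[OF scale_mem[OF \<phi>]])
    then have "vnorm ?D \<phi> \<le> vnorm ?D (\<lambda>x. c * \<phi> x) / abv c"
      using False by (simp add: abv_inverse divide_inverse mult.commute flip: mult.assoc)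
    then show ?thesis using scale_norm_le[OF \<phi>, of c] pos by (simp add: field_simps)
  qed
  have minus: "- \<phi> \<in> vcarrier ?D \<and> vnorm ?D (- \<phi>) = vnorm ?D \<phi>" if "\<phi> \<in> vcarrier ?D" for \<phi>
  proof -
    have "- \<phi> = (\<lambda>x. (- 1) * \<phi> x)" by auto
    then show ?thesis using scale_mem[OF that, of "- 1"] scale[OF that, of "- 1"] by (simp del: mult_minus1)
  qed
  have "normed abv ?D"
    unfolding normed_def
    using zero zero_mem nonneg add_mem add scale_mem scale minus
    by (auto simp del: uminus_apply plus_fun_apply)
  moreover have "vector_space (vscale ?D)"
    by (auto simp: vector_space_def algebra_simps fun_eq_iff)
  ultimately show ?thesis by (simp add: normed_space_def)
qed

text \<open>The transpose of \<open>a\<close>, extended by zero off \<open>vcarrier V\<close> as required of functionals.\<close>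

definition pull :: "('k, 'v::ab_group_add) nspace \<Rightarrow> ('v \<Rightarrow> 'v) \<Rightarrow> ('v \<Rightarrow> 'k) \<Rightarrow> 'v \<Rightarrow> 'k" where
  "pull V a \<phi> x = (if x \<in> vcarrier V then \<phi> (a x) else 0)"

lemma contraction_pull:
  assumes V: "normed abv V" and a: "contraction V V a"
  shows "contraction (dual_space abv V) (dual_space abv V) (pull V a)"
proof -
  let ?D = "dual_space abv V"
  have D: "normed abv ?D" using normed_space_normed[OF normed_space_dual_space[OF V]] .
  have a': "bounded_map V V a" "\<And>x. x \<in> vcarrier V \<Longrightarrow> vnorm V (a x) \<le> vnorm V x"
    using a by (auto simp: contraction_def)
  note am = bounded_map_mem[OF a'(1)]
  have le: "abv (pull V a \<phi> x) \<le> vnorm ?D \<phi> * vnorm V x" if "\<phi> \<in> vcarrier ?D" "x \<in> vcarrier V" for \<phi> x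
  proof -
    have "abv (\<phi> (a x)) \<le> vnorm ?D \<phi> * vnorm V (a x)"
      using dual_space_bound[OF V that(1) am[OF that(2)]] .
    also have "\<dots> \<le> vnorm ?D \<phi> * vnorm V x"
      using a'(2)[OF that(2)] normed_nonneg[OF D that(1)] by (rule mult_left_mono)
    finally show ?thesis using that by (simp add: pull_def)
  qed
  have mem: "pull V a \<phi> \<in> vcarrier ?D" if \<phi>: "\<phi> \<in> vcarrier ?D" for \<phi>
  proof -
    have f: "functional abv V \<phi>" using \<phi> by (simp add: dual_space_mem_iff)
    show ?thesis
      by (intro dual_space_memI[OF _ _ le[OF \<phi>]])
         (auto simp: pull_def normed_add_mem[OF V] normed_scale_mem[OF V] am bounded_map_add[OF a'(1)]
           bounded_map_scale[OF a'(1)] bounded_map_add[OF f] bounded_map_scale[OF f])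
  qed
  have norm: "vnorm ?D (pull V a \<phi>) \<le> vnorm ?D \<phi>" if "\<phi> \<in> vcarrier ?D" for \<phi>
    by (rule dual_space_norm_le[OF V mem[OF that] normed_nonneg[OF D that] le[OF that]])
  show ?thesis
    unfolding contraction_def
    by (intro conjI ballI norm bounded_mapI[where C = 1]) (auto simp: mem norm pull_def fun_eq_iff)
qed

lemma compression_pull:
  assumes V: "normed abv V" and a: "contraction V V a" and b: "contraction V V b"
    and ba: "\<And>x. x \<in> vcarrier V \<Longrightarrow> b (a x) = x"
  shows "compression (dual_space abv V) (pull V b) (pull V a)"
  unfolding compression_def
proof (intro conjI ballI contraction_pull[OF V a] contraction_pull[OF V b])
  fix \<phi> assume "\<phi> \<in> vcarrier (dual_space abv V)"
  moreover have "a x \<in> vcarrier V" if "x \<in> vcarrier V" for x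
    using a that by (auto simp: contraction_def intro: bounded_map_mem)
  ultimately show "pull V a (pull V b \<phi>) = \<phi>"
    by (auto simp: pull_def fun_eq_iff ba dual_space_mem_iff)
qed

end

text \<open>Vectors of norm at most 1 suffice to compute the operator norm, although norms need not be
  values of \<open>abv\<close>: these values are dense.\<close>

lemma (in spherically_incomplete_field) dual_space_norming:
  assumes V: "normed abv V" and \<phi>: "\<phi> \<in> vcarrier (dual_space abv V)"
    and t: "0 < t" "t < vnorm (dual_space abv V) \<phi>"
  obtains x where "x \<in> vcarrier V" "vnorm V x \<le> 1" "t < abv (\<phi> x)"
proof -
  have "\<not> (\<forall>x\<in>vcarrier V. abv (\<phi> x) \<le> t * vnorm V x)"
    using dual_space_norm_le[OF V \<phi>, of t] t by auto
  then obtain x where x: "x \<in> vcarrier V" "t * vnorm V x < abv (\<phi> x)" by (auto simp: not_le)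
  have n: "0 \<le> vnorm V x" using normed_nonneg[OF V x(1)] .
  have pos: "0 < abv (\<phi> x)" using x(2) n t(1) by (meson le_less_trans less_imp_le mult_nonneg_nonneg)
  have "vnorm V x < abv (\<phi> x) / t" using x(2) t(1) by (simp add: field_simps)
  then obtain a where a: "vnorm V x < abv a" "abv a < abv (\<phi> x) / t"
    using abv_between n by blast
  have a0: "0 < abv a" using a(1) n by linarith
  define y where "y = vscale V (inverse a) x"
  have "vnorm V y = vnorm V x / abv a"
    by (simp add: y_def normed_scale[OF V x(1)] abv_inverse divide_inverse mult.commute)
  then have "vnorm V y \<le> 1" using a(1) a0 by simp
  moreover have "\<phi> y = inverse a * \<phi> x"
    using \<phi> bounded_map_scale[of V "field_space abv" \<phi> x] x(1) by (simp add: y_def dual_space_mem_iff)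
  then have "abv (\<phi> y) = abv (\<phi> x) / abv a"
    by (simp add: abv_mult abv_inverse divide_inverse mult.commute)
  then have "t < abv (\<phi> y)" using a(2) a0 t(1) by (simp add: field_simps)
  moreover have "y \<in> vcarrier V" unfolding y_def by (rule normed_scale_mem[OF V x(1)])
  ultimately show ?thesis using that by blast
qed

section \<open>Copies of the space of functions and of its dual\<close>

text \<open>For \<open>r > 0\<close>, the clopen sets \<open>{x. (x / r - 2)\<^sup>2 < 2}\<close> lie between \<open>r / 2\<close> and \<open>4 r\<close> and are copies of the
  rationals. Extension by zero is a section of the restriction to such a copy. Subtracting the
  value at 0, which is outside of all the copies, keeps this true and makes the restrictions tend
  to zero when the copies tend to the point 0.\<close>

context rat_copy
begin

definition extend_zero :: "rat \<Rightarrow> (rat \<Rightarrow> 'k::field) \<Rightarrow> rat \<Rightarrow> 'k" where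
  "extend_zero r f x = (if (x / r - 2)\<^sup>2 < 2 then f (Q (x / r - 2)) else 0)"

definition restrict0 :: "rat \<Rightarrow> (rat \<Rightarrow> 'k::field) \<Rightarrow> rat \<Rightarrow> 'k" where
  "restrict0 r f x = f (r * (H x + 2)) - f 0"

lemma square_less_2_bounds:
  fixes x :: rat
  assumes "x\<^sup>2 < 2"
  shows "- (3 / 2) < x" "x < 2"
proof -
  show "- (3 / 2) < x"
  proof (rule ccontr)
    assume "\<not> - (3 / 2) < x"
    then have "(3 / 2)\<^sup>2 \<le> (- x)\<^sup>2" by (intro power_mono) auto
    then show False using assms by (simp add: power2_eq_square)
  qed
  show "x < 2"
  proof (rule ccontr)
    assume "\<not> x < 2"
    then have "2\<^sup>2 \<le> x\<^sup>2" by (intro power_mono) auto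
    then show False using assms by simp
  qed
qed

lemma extend_zero_support:
  assumes "0 < r" "extend_zero r f x \<noteq> 0"
  shows "r / 2 < x"
proof -
  have "(x / r - 2)\<^sup>2 < 2" using assms(2) by (auto simp: extend_zero_def split: if_splits)
  then have "1 / 2 < x / r" using square_less_2_bounds(1)[of "x / r - 2"] by linarith
  then show ?thesis using assms(1) by (simp add: field_simps)
qed

lemma restrict0_extend_zero:
  assumes "0 < r"
  shows "restrict0 r (extend_zero r f) = f"
proof
  fix x
  have "extend_zero r f 0 = 0" using extend_zero_support[OF assms, of f 0] assms by force
  then show "restrict0 r (extend_zero r f) x = f x"
    using assms H_range by (simp add: restrict0_def extend_zero_def QH)
qed

end

locale rat_copy_valuation = rat_copy H Q + valuation_field abv
  for H Q and abv :: "'k::field \<Rightarrow> real"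
begin

abbreviation C :: "('k, rat \<Rightarrow> 'k) nspace" where "C \<equiv> Cbd_rat abv"

lemma C_coeff_le: "f \<in> vcarrier C \<Longrightarrow> abv (f x) \<le> vnorm C f"
  unfolding Cbd_rat_simps by (rule bounded_functions_coeff_le) (simp add: Cbd_rat_mem_iff)

lemma C_norm_le: "(\<And>x. abv (f x) \<le> B) \<Longrightarrow> vnorm C f \<le> B"
  unfolding Cbd_rat_simps by (rule bounded_functions_norm_le)

lemma C_memI:
  assumes "\<And>x. abv (f x) \<le> B" "\<And>x e. 0 < e \<Longrightarrow> \<exists>d>0. \<forall>y. \<bar>y - x\<bar> < d \<longrightarrow> abv (f y - f x) < e"
  shows "f \<in> vcarrier C"
  using assms bounded_functions_memI[of abv f B] by (simp add: Cbd_rat_mem_iff)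

lemma C_continuous:
  "f \<in> vcarrier C \<Longrightarrow> 0 < e \<Longrightarrow> \<exists>d>0. \<forall>y. \<bar>y - x\<bar> < d \<longrightarrow> abv (f y - f x) < e"
  by (simp add: Cbd_rat_mem_iff)

lemma contractionI:
  assumes "\<And>f. f \<in> vcarrier C \<Longrightarrow> a f \<in> vcarrier C"
    and "\<And>f x. f \<in> vcarrier C \<Longrightarrow> abv (a f x) \<le> vnorm C f"
    and "\<And>f g x. a (f + g) x = a f x + a g x" "\<And>c f x. a (\<lambda>x. c * f x) x = c * a f x"
  shows "contraction C C a"
  unfolding contraction_def
proof (intro conjI ballI bounded_mapI[where C = 1])
  show le: "vnorm C (a f) \<le> vnorm C f" if "f \<in> vcarrier C" for f
    by (rule C_norm_le) (rule assms(2)[OF that])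
  show "vnorm C (a f) \<le> 1 * vnorm C f" if "f \<in> vcarrier C" for f
    using le[OF that] by simp
  show "a (f + g) = a f + a g" for f g using assms(3) by auto
  show "a (vscale C c f) = vscale C c (a f)" for c f using assms(4) by (auto simp: Cbd_rat_simps)
qed (rule assms(1))

lemma extend_zero_contraction:
  assumes r: "0 < r"
  shows "contraction C C (extend_zero r)"
proof (rule contractionI)
  have le: "abv (extend_zero r f x) \<le> vnorm C f" if "f \<in> vcarrier C" for f x
    using C_coeff_le[OF that] normed_nonneg[OF normed_Cbd_rat that] by (simp add: extend_zero_def)
  then show "abv (extend_zero r f x) \<le> vnorm C f" if "f \<in> vcarrier C" for f x using that .
  show "extend_zero r f \<in> vcarrier C" if f: "f \<in> vcarrier C" for f
  proof (rule C_memI[OF le[OF f]])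
    fix x :: rat and e :: real assume e: "0 < e"
    define u where "u y = y / r - 2" for y
    have u: "\<bar>u y - u x\<bar> < d" if "\<bar>y - x\<bar> < d * r" for y d
    proof -
      have "u y - u x = (y - x) / r" by (simp add: u_def diff_divide_distrib)
      then show ?thesis using that r by (simp add: divide_less_eq)
    qed
    show "\<exists>d>0. \<forall>y. \<bar>y - x\<bar> < d \<longrightarrow> abv (extend_zero r f y - extend_zero r f x) < e"
    proof (cases "(u x)\<^sup>2 < 2")
      case True
      obtain d1 where d1: "0 < d1" "\<And>y. \<bar>y - u x\<bar> < d1 \<Longrightarrow> y\<^sup>2 < 2"
        using square_less_2_open[OF True] by blast
      obtain d2 where d2: "0 < d2" "\<And>y. \<bar>y - Q (u x)\<bar> < d2 \<Longrightarrow> abv (f y - f (Q (u x))) < e"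
        using C_continuous[OF f e] by blast
      obtain d3 where d3: "0 < d3" "\<And>y. y\<^sup>2 < 2 \<Longrightarrow> \<bar>y - u x\<bar> < d3 \<Longrightarrow> \<bar>Q y - Q (u x)\<bar> < d2"
        using Q_continuous[OF True d2(1)] by blast
      have "abv (extend_zero r f y - extend_zero r f x) < e" if y: "\<bar>y - x\<bar> < min d1 d3 * r" for y
      proof -
        have "\<bar>u y - u x\<bar> < d1" "\<bar>u y - u x\<bar> < d3" using u[OF y] by auto
        moreover then have y2: "(u y)\<^sup>2 < 2" using d1(2) by blast
        ultimately have "abv (f (Q (u y)) - f (Q (u x))) < e" using d2(2) d3(2) by blast
        then show ?thesis using y2 True by (simp add: extend_zero_def u_def)
      qed
      then show ?thesis using d1(1) d3(1) r by (intro exI[of _ "min d1 d3 * r"]) auto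
    next
      case False
      obtain d where d: "0 < d" "\<And>y. \<bar>y - u x\<bar> < d \<Longrightarrow> \<not> y\<^sup>2 < 2"
        using square_less_2_closed[OF False] by blast
      have "abv (extend_zero r f y - extend_zero r f x) < e" if y: "\<bar>y - x\<bar> < d * r" for y
      proof -
        have "\<not> (u y)\<^sup>2 < 2" using d(2) u[OF y] by blast
        then show ?thesis using False e by (simp add: extend_zero_def u_def)
      qed
      then show ?thesis using d(1) r by (intro exI[of _ "d * r"]) auto
    qed
  qed
qed (auto simp: extend_zero_def)

lemma restrict0_contraction:
  assumes r: "0 < r"
  shows "contraction C C (restrict0 r)"
proof (rule contractionI)
  have le: "abv (restrict0 r f x) \<le> vnorm C f" if "f \<in> vcarrier C" for f x
    using C_coeff_le[OF that, of 0] C_coeff_le[OF that, of "r * (H x + 2)"]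
      abv_diff_le[of "f (r * (H x + 2))" "f 0"]
    by (simp add: restrict0_def)
  then show "abv (restrict0 r f x) \<le> vnorm C f" if "f \<in> vcarrier C" for f x using that .
  show "restrict0 r f \<in> vcarrier C" if f: "f \<in> vcarrier C" for f
  proof (rule C_memI[OF le[OF f]])
    fix x :: rat and e :: real assume e: "0 < e"
    obtain d where d: "0 < d" "\<And>y. \<bar>y - r * (H x + 2)\<bar> < d \<Longrightarrow> abv (f y - f (r * (H x + 2))) < e"
      using C_continuous[OF f e] by blast
    obtain d' where d': "0 < d'" "\<And>y. \<bar>y - x\<bar> < d' \<Longrightarrow> \<bar>H y - H x\<bar> < d / r"
      using H_continuous[of "d / r" x] d(1) r by auto
    have "abv (restrict0 r f y - restrict0 r f x) < e" if "\<bar>y - x\<bar> < d'" for y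
    proof -
      have "r * (H y + 2) - r * (H x + 2) = r * (H y - H x)" by (simp add: algebra_simps)
      then have "\<bar>r * (H y + 2) - r * (H x + 2)\<bar> < d"
        using d'(2)[OF that] r by (simp add: abs_mult less_divide_eq mult.commute)
      then show ?thesis using d(2) by (simp add: restrict0_def)
    qed
    then show "\<exists>d>0. \<forall>y. \<bar>y - x\<bar> < d \<longrightarrow> abv (restrict0 r f y - restrict0 r f x) < e"
      using d'(1) by blast
  qed
qed (auto simp: restrict0_def algebra_simps)

lemma restrict0_small:
  assumes f: "f \<in> vcarrier C" and "0 < e"
  shows "\<exists>d>0. \<forall>r. 0 < r \<longrightarrow> r < d \<longrightarrow> vnorm C (restrict0 r f) \<le> e"
proof -
  obtain d where d: "0 < d" "\<And>y. \<bar>y - 0\<bar> < d \<Longrightarrow> abv (f y - f 0) < e"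
    using C_continuous[OF f \<open>0 < e\<close>] by blast
  have "vnorm C (restrict0 r f) \<le> e" if r: "0 < r" "r < d / 4" for r
  proof (rule C_norm_le)
    fix x
    have "0 < H x + 2" "H x + 2 < 4" using square_less_2_bounds[OF H_range[of x]] by auto
    then have "0 < r * (H x + 2)" "r * (H x + 2) < r * 4" using r(1) by auto
    then have "\<bar>r * (H x + 2) - 0\<bar> < d" using r(2) by simp
    then show "abv (restrict0 r f x) \<le> e" using d(2) by (simp add: restrict0_def less_imp_le)
  qed
  then show ?thesis using d(1) by (intro exI[of _ "d / 4"]) auto
qed

lemma sum_functions_apply: "(\<Sum>i\<in>A. f i) x = (\<Sum>i\<in>A. f i x)"
  by (induction A rule: infinite_finite_induct) auto

text \<open>The functions \<open>extend_zero (n + 1) (f n)\<close> have locally finite supports, since the \<open>n\<close>-th support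
  lies above \<open>(n + 1) / 2\<close>.\<close>

lemma locally_finite_sum:
  assumes f: "\<And>n. f n \<in> vcarrier C" "\<And>n. vnorm C (f n) \<le> 1"
  obtains L where "bounded_map (linf abv) C L"
    "\<And>n. L (unit_seq n) = extend_zero (of_nat (Suc n)) (f n)"
proof -
  define g where "g n = extend_zero (of_nat (Suc n)) (f n)" for n
  have pos: "0 < (of_nat (Suc n) :: rat)" for n by simp
  have g: "g n \<in> vcarrier C" "abv (g n x) \<le> 1" for n x
  proof -
    have c: "contraction C C (extend_zero (of_nat (Suc n)))" by (rule extend_zero_contraction[OF pos])
    then show "g n \<in> vcarrier C"
      using f(1) bounded_map_mem[of C C "extend_zero (of_nat (Suc n))" "f n"]
      by (simp add: g_def contraction_def)
    then have "abv (g n x) \<le> vnorm C (g n)" by (rule C_coeff_le)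
    also have "\<dots> \<le> vnorm C (f n)" using c f(1) by (auto simp: g_def contraction_def)
    finally show "abv (g n x) \<le> 1" using f(2)[of n] by linarith
  qed
  have supp: "of_nat n < 2 * x" if "g n x \<noteq> 0" for n x
    using extend_zero_support[OF pos, of n "f n" x] that by (simp add: g_def)
  define L where "L c x = (\<Sum>n | of_nat n < 2 * x. c n * g n x)" for c x
  have L_eq: "L c x = (\<Sum>n<N. c n * g n x)" if "2 * x \<le> of_nat N" for c x N
    unfolding L_def
  proof (rule sum.mono_neutral_left)
    show "{n. of_nat n < 2 * x} \<subseteq> {..<N}" using that by auto
    show "\<forall>n\<in>{..<N} - {n. of_nat n < 2 * x}. c n * g n x = 0" using supp by auto
  qed simp
  have le: "abv (L c x) \<le> 1 * vnorm (linf abv) c" if c: "c \<in> vcarrier (linf abv)" for c x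
    unfolding L_def
  proof (rule abv_sum_le)
    show "abv (c n * g n x) \<le> 1 * vnorm (linf abv) c" for n
      using mult_mono[OF bounded_functions_coeff_le[OF c, of n] g(2)[of n x]] normed_nonneg[OF normed_bounded_functions c]
      by (simp add: abv_mult)
  qed (use normed_nonneg[OF normed_bounded_functions c] in simp)
  have mem: "L c \<in> vcarrier C" if c: "c \<in> vcarrier (linf abv)" for c
  proof (rule C_memI[OF le[OF c]])
    fix x :: rat and e :: real assume e: "0 < e"
    obtain N where N: "2 * (x + 1) \<le> of_nat N" using real_arch_simple[of "2 * (x + 1)"] ..
    define F where "F = (\<Sum>n<N. vscale C (c n) (g n))"
    have F_eq: "F y = (\<Sum>n<N. c n * g n y)" for y
      unfolding F_def by (simp add: sum_functions_apply Cbd_rat_simps)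
    have "F \<in> vcarrier C"
      unfolding F_def using normed_scale_mem[OF normed_Cbd_rat g(1)]
      by (intro normed_sum_mem[OF normed_Cbd_rat])
    then obtain d where d: "0 < d" "\<And>y. \<bar>y - x\<bar> < d \<Longrightarrow> abv (F y - F x) < e"
      using C_continuous[OF _ e] by blast
    have "L c y = F y" if "\<bar>y - x\<bar> < 1" for y
    proof -
      have "y < x + 1" using that by (simp add: abs_less_iff)
      then have "2 * y \<le> of_nat N" using N by simp
      then show ?thesis unfolding F_eq by (rule L_eq)
    qed
    then have "abv (L c y - L c x) < e" if "\<bar>y - x\<bar> < min d 1" for y
      using that d(2) by simp
    then show "\<exists>d>0. \<forall>y. \<bar>y - x\<bar> < d \<longrightarrow> abv (L c y - L c x) < e"
      using d(1) by (intro exI[of _ "min d 1"]) auto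
  qed
  have "bounded_map (linf abv) C L"
  proof (rule bounded_mapI[OF mem])
    show "vnorm C (L c) \<le> 1 * vnorm (linf abv) c" if "c \<in> vcarrier (linf abv)" for c
      by (rule C_norm_le) (rule le[OF that])
    show "L (b + c) = L b + L c" for b c
      by (auto simp: L_def fun_eq_iff sum.distrib algebra_simps)
    show "L (vscale (linf abv) a c) = vscale C a (L c)" for a c
      by (auto simp: L_def fun_eq_iff sum_distrib_left Cbd_rat_simps mult.assoc)
  qed
  moreover have "L (unit_seq n) = extend_zero (of_nat (Suc n)) (f n)" for n
  proof
    fix x :: rat
    obtain N where N: "2 * x \<le> of_nat N" using real_arch_simple[of "2 * x"] ..
    have "L (unit_seq n) x = (\<Sum>m<max N (Suc n). unit_seq n m * g m x)"
      using N by (intro L_eq) auto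
    also have "\<dots> = (\<Sum>m<max N (Suc n). if m = n then g m x else 0)"
      by (intro sum.cong) (auto simp: unit_seq_def)
    finally show "L (unit_seq n) x = extend_zero (of_nat (Suc n)) (f n) x"
      by (simp add: sum.delta' g_def less_max_iff_disj)
  qed
  ultimately show ?thesis using that by blast
qed

abbreviation D :: "('k, (rat \<Rightarrow> 'k) \<Rightarrow> 'k) nspace" where "D \<equiv> dual_space abv C"

lemma normed_space_D: "normed_space abv D"
  by (rule normed_space_dual_space[OF normed_Cbd_rat])

lemma compression_D: "0 < r \<Longrightarrow> compression D (pull C (restrict0 r)) (pull C (extend_zero r))"
  by (rule compression_pull[OF normed_Cbd_rat extend_zero_contraction restrict0_contraction])
     (simp_all add: restrict0_extend_zero)

text \<open>The functionals \<open>\<phi> n \<circ> restrict0 (1 / (n + 1))\<close> tend to zero pointwise, so their series with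
  bounded coefficients converge pointwise.\<close>

lemma gathering_D:
  assumes \<phi>: "\<And>n. \<phi> n \<in> vcarrier D" "\<And>n. vnorm D (\<phi> n) \<le> 1"
  shows "\<exists>R. bounded_map (linf abv) D R \<and>
    (\<forall>n. R (unit_seq n) = pull C (restrict0 (1 / of_nat (Suc n))) (\<phi> n))"
proof -
  let ?L = "linf abv"
  define b where "b n = (restrict0 (1 / of_nat (Suc n)) :: (rat \<Rightarrow> 'k) \<Rightarrow> _)" for n
  have b: "contraction C C (b n)" for n unfolding b_def by (rule restrict0_contraction) simp
  have bm: "b n f \<in> vcarrier C" and b_le: "vnorm C (b n f) \<le> vnorm C f" if "f \<in> vcarrier C" for n f
    using b[of n] that bounded_map_mem[of C C "b n" f] by (auto simp: contraction_def)
  have b_add: "b n (f + g) = b n f + b n g" and b_scale: "b n (\<lambda>x. c * f x) = (\<lambda>x. c * b n f x)" for n f g c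
    by (auto simp: b_def restrict0_def algebra_simps)
  have \<phi>_le: "abv (\<phi> n f) \<le> vnorm C f" if "f \<in> vcarrier C" for n f
  proof -
    have "abv (\<phi> n f) \<le> vnorm D (\<phi> n) * vnorm C f"
      by (rule dual_space_bound[OF normed_Cbd_rat \<phi>(1) that])
    also have "\<dots> \<le> 1 * vnorm C f"
      using \<phi>(2) normed_nonneg[OF normed_Cbd_rat that] by (rule mult_right_mono)
    finally show ?thesis by simp
  qed
  have fn: "functional abv C (\<phi> n)" for n using \<phi>(1) by (simp add: dual_space_mem_iff)
  have \<phi>_add: "\<phi> n (f + g) = \<phi> n f + \<phi> n g" if "f \<in> vcarrier C" "g \<in> vcarrier C" for n f g
    using bounded_map_add[OF fn that] .
  have \<phi>_scale: "\<phi> n (\<lambda>x. c * f x) = c * \<phi> n f" if "f \<in> vcarrier C" for n f c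
    using bounded_map_scale[OF fn that, of n c] by (simp add: Cbd_rat_simps)
  have null: "(\<lambda>n. abv (\<phi> n (b n f))) \<longlonglongrightarrow> 0" if f: "f \<in> vcarrier C" for f
  proof (rule LIMSEQ_I)
    fix e :: real assume e: "0 < e"
    then have "0 < e / 2" by simp
    then obtain d where d: "0 < d" "\<And>r. 0 < r \<Longrightarrow> r < d \<Longrightarrow> vnorm C (restrict0 r f) \<le> e / 2"
      using restrict0_small[OF f] by blast
    obtain N where N: "1 / d < of_nat N" using reals_Archimedean2 by blast
    have "abv (\<phi> n (b n f)) < e" if "n \<ge> N" for n
    proof -
      have "1 / d < of_nat (Suc n)" using N that by (meson le_SucI less_le_trans of_nat_mono)
      then have "1 / of_nat (Suc n) < d" using d(1) by (simp add: field_simps)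
      then have "vnorm C (b n f) \<le> e / 2" unfolding b_def by (intro d(2)) auto
      then show ?thesis using \<phi>_le[OF bm[OF f], of n n] e by linarith
    qed
    then show "\<exists>N. \<forall>n\<ge>N. norm (abv (\<phi> n (b n f)) - 0) < e" by auto
  qed
  define R where "R c f = (if f \<in> vcarrier C then ksum (\<lambda>n. c n * \<phi> n (b n f)) else 0)" for c f
  have nullc: "(\<lambda>n. abv (c n * \<phi> n (b n f))) \<longlonglongrightarrow> 0" if "c \<in> vcarrier ?L" "f \<in> vcarrier C" for c f
    using null_mult[OF null[OF that(2)] bounded_functions_coeff_le[OF that(1)]] .
  have R_le: "abv (R c f) \<le> vnorm ?L c * vnorm C f" if c: "c \<in> vcarrier ?L" and f: "f \<in> vcarrier C" for c f
  proof -
    have "abv (c n * \<phi> n (b n f)) \<le> vnorm ?L c * vnorm C f" for n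
      unfolding abv_mult
      using bounded_functions_coeff_le[OF c, of n] order_trans[OF \<phi>_le[OF bm[OF f]] b_le[OF f]]
        normed_nonneg[OF normed_bounded_functions c] by (intro mult_mono) auto
    then show ?thesis using abv_ksum_le[OF nullc[OF c f]] f by (simp add: R_def)
  qed
  have R_mem: "R c \<in> vcarrier D" if c: "c \<in> vcarrier ?L" for c
  proof (rule dual_space_memI[OF _ _ R_le[OF c]])
    fix f g assume fg: "f \<in> vcarrier C" "g \<in> vcarrier C"
    then have "f + g \<in> vcarrier C" by (rule normed_add_mem[OF normed_Cbd_rat])
    then show "R c (f + g) = R c f + R c g"
      using fg ksum_add[OF nullc[OF c fg(1)] nullc[OF c fg(2)]]
      by (simp add: R_def b_add \<phi>_add bm distrib_left)
  next
    fix a f assume f: "f \<in> vcarrier C"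
    then have "vscale C a f \<in> vcarrier C" by (rule normed_scale_mem[OF normed_Cbd_rat])
    then show "R c (vscale C a f) = a * R c f"
      using f ksum_mult[OF nullc[OF c f], of a]
      by (simp add: R_def b_scale \<phi>_scale bm Cbd_rat_simps mult.left_commute)
  next
    fix f :: "rat \<Rightarrow> 'k" assume "f \<notin> vcarrier C"
    then show "R c f = 0" by (simp add: R_def)
  qed
  have "bounded_map ?L D R"
  proof (rule bounded_mapI[where C = 1])
    fix c d assume cd: "c \<in> vcarrier ?L" "d \<in> vcarrier ?L"
    show "R (c + d) = R c + R d"
      using ksum_add[OF nullc[OF cd(1)] nullc[OF cd(2)]] by (auto simp: R_def fun_eq_iff distrib_right)
  next
    fix a c assume c: "c \<in> vcarrier ?L"
    show "R (vscale ?L a c) = vscale D a (R c)"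
      using ksum_mult[OF nullc[OF c], of _ a] by (auto simp: R_def fun_eq_iff mult.assoc)
    show "vnorm D (R c) \<le> 1 * vnorm ?L c"
      using dual_space_norm_le[OF normed_Cbd_rat R_mem[OF c] normed_nonneg[OF normed_bounded_functions c] R_le[OF c]]
      by simp
  qed (rule R_mem)
  moreover have "R (unit_seq n) = pull C (b n) (\<phi> n)" for n
  proof
    fix f
    have "ksum (\<lambda>m. unit_seq n m * \<phi> m (b m f)) = (\<Sum>m<Suc n. unit_seq n m * \<phi> m (b m f))"
      by (rule ksum_finite) (simp add: unit_seq_def)
    also have "\<dots> = \<phi> n (b n f)" by (simp add: unit_seq_def)
    finally show "R (unit_seq n) f = pull C (b n) (\<phi> n) f" by (simp add: R_def pull_def)
  qed
  ultimately show ?thesis unfolding b_def by blast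
qed

end

locale rat_copy_spherically_incomplete = rat_copy_valuation H Q abv + spherically_incomplete_field abv
  for H Q and abv :: "'k::field \<Rightarrow> real"
begin

text \<open>If the norms of \<open>\<phi> \<circ> extend_zero (n + 1)\<close> do not tend to zero, then \<open>\<phi>\<close> is not small on
  infinitely many of the functions \<open>extend_zero (n + 1) (f n)\<close>, for suitable \<open>f n\<close> of norm at most 1,
  although these are the images of the unit sequences under an operator on \<open>\<ell>\<^sup>\<infinity>\<close>.\<close>

lemma shrinking_D:
  assumes \<phi>: "\<phi> \<in> vcarrier D"
  shows "(\<lambda>n. vnorm D (pull C (extend_zero (of_nat (Suc n))) \<phi>)) \<longlonglongrightarrow> 0"
proof (rule LIMSEQ_I)
  fix e :: real assume e: "0 < e"
  let ?\<psi> = "\<lambda>n. pull C (extend_zero (of_nat (Suc n))) \<phi>"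
  have \<psi>: "?\<psi> n \<in> vcarrier D" for n
    using compression_mem(2)[OF compression_D \<phi>] by simp
  have "\<exists>f. f \<in> vcarrier C \<and> vnorm C f \<le> 1 \<and> (e / 2 < vnorm D (?\<psi> n) \<longrightarrow> e / 2 < abv (?\<psi> n f))" for n
  proof (cases "e / 2 < vnorm D (?\<psi> n)")
    case True
    then show ?thesis
      using dual_space_norming[OF normed_Cbd_rat \<psi>, of "e / 2" n] e by (metis half_gt_zero)
  next
    case False
    then show ?thesis
      using normed_zero_mem[OF normed_Cbd_rat] normed_zero[OF normed_Cbd_rat] by (intro exI[of _ 0]) auto
  qed
  then obtain f where f: "\<And>n. f n \<in> vcarrier C" "\<And>n. vnorm C (f n) \<le> 1"
    and big: "\<And>n. e / 2 < vnorm D (?\<psi> n) \<Longrightarrow> e / 2 < abv (?\<psi> n (f n))"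
    by metis
  obtain L where L: "bounded_map (linf abv) C L" "\<And>n. L (unit_seq n) = extend_zero (of_nat (Suc n)) (f n)"
    by (rule locally_finite_sum[of f, OF f], rule that)
  have "functional abv C \<phi>" using \<phi> by (simp add: dual_space_mem_iff)
  then have "(\<lambda>n. abv (\<phi> (L (unit_seq n)))) \<longlonglongrightarrow> 0"
    by (intro functional_unit_seq_tendsto bounded_map_comp[OF normed_Cbd_rat normed_field_space L(1)])
  then obtain N where N: "\<And>n. n \<ge> N \<Longrightarrow> abv (\<phi> (L (unit_seq n))) < e / 2"
    using LIMSEQ_D[of "\<lambda>n. abv (\<phi> (L (unit_seq n)))" 0 "e / 2"] e by auto
  have "vnorm D (?\<psi> n) < e" if "n \<ge> N" for n
  proof -
    have "abv (?\<psi> n (f n)) < e / 2" using N[OF that] f(1) by (simp add: L(2) pull_def)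
    then have "vnorm D (?\<psi> n) \<le> e / 2" using big[of n] by linarith
    then show ?thesis using e by linarith
  qed
  moreover have "0 \<le> vnorm D (?\<psi> n)" for n
    using normed_nonneg[OF normed_space_normed[OF normed_space_D] \<psi>] .
  ultimately show "\<exists>N. \<forall>n\<ge>N. norm (vnorm D (?\<psi> n) - 0) < e" by auto
qed

lemma self_similar_D: "self_similar abv D"
proof
  show "normed_space abv D" by (rule normed_space_D)
next
  fix \<phi> and t :: real assume \<phi>: "\<phi> \<in> vcarrier D" and t: "0 < t" "t < vnorm D \<phi>"
  obtain f where f: "f \<in> vcarrier C" "vnorm C f \<le> 1" "t < abv (\<phi> f)"
    using dual_space_norming[OF normed_Cbd_rat \<phi> t] by blast
  have le: "abv (\<psi> f) \<le> vnorm D \<psi>" if \<psi>: "\<psi> \<in> vcarrier D" for \<psi>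
  proof -
    have "abv (\<psi> f) \<le> vnorm D \<psi> * vnorm C f" by (rule dual_space_bound[OF normed_Cbd_rat \<psi> f(1)])
    also have "\<dots> \<le> vnorm D \<psi> * 1"
      using f(2) normed_nonneg[OF normed_space_normed[OF normed_space_D] \<psi>] by (rule mult_left_mono)
    finally show ?thesis by simp
  qed
  moreover have "functional abv D (\<lambda>\<psi>. \<psi> f)"
    using le by (intro bounded_mapI[where C = 1]) auto
  ultimately show "\<exists>h. functional abv D h \<and> (\<forall>y\<in>vcarrier D. abv (h y) \<le> vnorm D y) \<and> t < abv (h \<phi>)"
    using f(3) by blast
next
  show "\<exists>\<alpha> \<beta>. (\<forall>n. compression D (\<alpha> n) (\<beta> n)) \<and>
      (\<forall>x\<in>vcarrier D. (\<lambda>n. vnorm D (\<beta> n x)) \<longlonglongrightarrow> 0)"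
    using compression_D shrinking_D
    by (intro exI[of _ "\<lambda>n. pull C (restrict0 (of_nat (Suc n)))"]
          exI[of _ "\<lambda>n. pull C (extend_zero (of_nat (Suc n)))"]) auto
  show "\<exists>\<alpha> \<beta>. (\<forall>n. compression D (\<alpha> n) (\<beta> n)) \<and>
      (\<forall>y. (\<forall>n. y n \<in> vcarrier D \<and> vnorm D (y n) \<le> 1) \<longrightarrow>
         (\<exists>R. bounded_map (linf abv) D R \<and> (\<forall>n. R (unit_seq n) = \<alpha> n (y n))))"
    using compression_D gathering_D
    by (intro exI[of _ "\<lambda>n. pull C (restrict0 (1 / of_nat (Suc n)))"]
          exI[of _ "\<lambda>n. pull C (extend_zero (1 / of_nat (Suc n)))"]) auto
qed

lemma D_nonzero: "\<exists>\<phi>\<in>vcarrier D. vnorm D \<phi> \<noteq> 0"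
proof
  let ?\<phi> = "\<lambda>f. if f \<in> vcarrier C then f 0 else 0"
  show \<phi>: "?\<phi> \<in> vcarrier D"
    using normed_add_mem[OF normed_Cbd_rat] normed_scale_mem[OF normed_Cbd_rat] C_coeff_le
    by (intro dual_space_memI[where B = 1]) (auto simp: Cbd_rat_simps)
  have "(\<lambda>_. 1) \<in> vcarrier C" by (rule C_memI[where B = 1]) (auto intro: exI[of _ 1])
  then show "vnorm D ?\<phi> \<noteq> 0" using dual_space_bound[OF normed_Cbd_rat \<phi>, of "\<lambda>_. 1"] by auto
qed

end

section \<open>The dual is not in the Reid class\<close>

theorem theorem6p3:
  fixes abv :: "'k::field \<Rightarrow> real" and \<kappa> :: "'c card_bound"
  assumes "complete_valuation_field abv"
    and "{0..} \<subseteq> closure (range abv)"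
    and "infinite_bound \<kappa>"
    and "non_measurability TYPE('i) \<kappa>"
    and "\<not> spherically_complete abv"
  shows "dual_space abv (Cbd_rat abv) \<notin>
    reid_class abv \<kappa> TYPE('i) TYPE('u::ab_group_add) TYPE('o::wellorder)"
proof -
  obtain H Q where "rat_copy H Q"
    using rat_copy_exists by blast
  then interpret rat_copy H Q .
  interpret spherically_incomplete_field abv by unfold_locales (use assms in auto)
  interpret rat_copy_spherically_incomplete H Q abv ..
  interpret S: self_similar abv D by (rule self_similar_D)
  obtain \<phi> where "\<phi> \<in> vcarrier D" "vnorm D \<phi> \<noteq> 0" using D_nonzero ..
  then show ?thesis by (rule S.not_in_reid_class[OF assms(3,4)])
qed

end
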